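(* Let $L=\{L_1,\dots,L_N\}$ be a directed acyclic linear network (DALN) with union $L^\cup=\bigcup_{i=1}^N L_i$, and let $\lambda_1$ be the length measure on $L^\cup$. (Unmarked case.) Let $\boldsymbol X$ be an unmarked point process on $L$ specified by a conditional intensity function $\lambda^*=\lambda^*(\cdot;\boldsymbol\theta)$ depending on a parameter vector $\boldsymbol\theta$, and let $\boldsymbol x\subset L^\cup$ be an observed (finite) point pattern. Then the likelihood function is $$\mathcal L(\boldsymbol\theta;\boldsymbol x)=\Bigl(\prod_{x\in\boldsymbol x}\lambda^*(x;\boldsymbol\theta)\Bigr)\exp\Bigl(-\int_{L^\cup}\lambda^*(u;\boldsymbol\theta)\,\mathrm d\lambda_1(u)\Bigr).$$ (Marked case.) Let $\boldsymbol Y$ be a marked point process on $L$ with marks in $\mathbb M$, specified by a conditional intensity function $\lambda^*(u,m;\boldsymbol\theta)=\lambda^*(u;\boldsymbol\theta)f^*(m\mid u;\boldsymbol\theta)$ depending on $\boldsymbol\theta$, and let $\boldsymbol y\subset L^\cup\times\mathbb M$ be an observed (finite) marked point pattern. Then the likelihood function is $$\mathcal L(\boldsymbol\theta;\boldsymbol y)=\Bigl(\prod_{(x,m)\in\boldsymbol y}\lambda^*(x,m;\boldsymbol\theta)\Bigr)\exp\Bigl(-\int_{L^\cup}\lambda^*(u;\boldsymbol\theta)\,\mathrm d\lambda_1(u)\Bigr).$$ In both formulas $\lambda^*$ is evaluated along the observed (marked) pattern, i.e. at each location it is computed using the part of the observed pattern that it is allowed to depend on.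
   Context: **Directed linear network.** Let $d\ge 2$. $L_1,\dots,L_N\subset\mathbb R^d$ are pairwise non-overlapping (disjoint) open line segments of finite length $|L_i|$. Each has a direction, from endpoint $\underline e_i$ to endpoint $\overline e_i$, and is parametrised by $u_i(t)=\underline e_i+t(\overline e_i-\underline e_i)/\|\overline e_i-\underline e_i\|$, $t\in(0,|L_i|)$. For $0\le t_1\le t_2\le|L_i|$, $L_i(t_1,t_2)=\{u_i(t):t\in(t_1,t_2)\}$. Segments may share endpoints. $L=\{L_1,\dots,L_N\}$ and $L^\cup=\bigcup_i L_i$. For measurable $A\subseteq L^\cup$, $\lambda_1(A)$ is the total length of $A$. **Order.** For $i\ne j$ write $L_i\to L_j$ if there are an index set $I\subseteq\{1,\dots,N\}$ with $i,j\in I$ and a bijection $\psi:\{1,\dots,|I|\}\to I$ with $\psi(1)=i$, $\psi(|I|)=j$ and $\underline e_{\psi(k)}=\overline e_{\psi(k-1)}$ for $k=2,\dots,|I|$. For points $u=u_i(t_1)$, $v=u_j(t_2)$ write $u\to v$ if $L_i\to L_j$ (when $i\neq j$) or $t_1<t_2$ (when $i=j$). $L$ is a *directed acyclic linear network (DALN)* if $u\to v$ implies $v\not\to u$ for all $u,v\in L^\cup$. Let $\Omega$ be the set of bijections $\omega$ of $\{1,\dots,N\}$ such that $L_{\omega(i)}\to L_{\omega(j)}$ implies $i<j$. For a DALN $\Omega\neq\emptyset$. Put $L^\cup_{\to i}=\bigcup_{j:L_j\to L_i}L_j$, and for $u=u_i(t)$ put $L^\cup_{\to u}=L_i(0,t)\cup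 L^\cup_{\to i}$. **Temporal conditional intensity.** A (finite, simple) point process on an interval $(0,\ell)$ has conditional intensity $\tilde\lambda^*$ if, informally, $\tilde\lambda^*(t)\,dt$ is the expected number of points in $[t,t+dt]$ given the points before $t$. Precisely, given that the first $n$ points are $t_1<\dots<t_n$ (with $t_0=0$), the conditional probability of no further point in $(t_n,t]$ is $\exp(-\int_{t_n}^t\tilde\lambda^*(s)\,ds)$ for $t<\ell$, where $\tilde\lambda^*(s)\ge 0$ on this interval is a function of $s$ and $t_1,\dots,t_n$. **Point process on a DALN specified by $\lambda^*$.** A point pattern is a finite subset of $L^\cup$, and a point process $\boldsymbol X$ is a random point pattern. Fix $\omega\in\Omega$ and define $\boldsymbol X$ recursively on $L_{\omega(1)},\dots,L_{\omega(N)}$. Given the points already defined on the earlier segments, the process on $L_i$ ($i=\omega(k)$) depends on them only through the points on $L^\cup_{\to i}$. It is the image under $u_i$ of a temporal point process on $(0,|L_i|)$ with conditional intensity $\tilde\lambda^*$, where $\tilde\lambda^*$ may depend on the points on $L^\cup_{\to i}$. One sets $\lambda^*(u)=\tilde\lambda^*(t)$ for $u=u_i(t)$. Thus $\lambda^*(u)$ may depend on the points in $L^\cup_{\to u}$. The star denotes this dependence. **Marked case.** Marks take values in a mark space $\mathbb M$ with a reference measure $\nu$. The construction is the same, with the following changes: $\lambda^*(u)$ may depend on the points and marks on $L^\cup_{\to u}$; given these and that there is a point at $u$, its mark has density $f^*(\cdot\mid u)$ with respect to $\nu$, which may also depend on the points and marks on $L^\cup_{\to u}$; and $\lambda^*(u,m)=\lambda^*(u)f^*(m\mid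 u)$. **Likelihood function.** $\mathcal L(\boldsymbol\theta;\cdot)$ is the Janossy density of the process under parameter $\boldsymbol\theta$, i.e. for measurable sets $F$ of point patterns $$P_{\boldsymbol\theta}(\boldsymbol X\in F)=\sum_{n\ge0}\frac1{n!}\int_{(L^\cup)^n}\mathbf 1[\{x_1,\dots,x_n\}\in F]\,\mathcal L(\boldsymbol\theta;\{x_1,\dots,x_n\})\,\mathrm d\lambda_1(x_1)\cdots \mathrm d\lambda_1(x_n),$$ where the $n=0$ term is $\mathbf 1[\emptyset\in F]\mathcal L(\boldsymbol\theta;\emptyset)$. In the marked case $L^\cup$ and $\lambda_1$ are replaced by $L^\cup\times\mathbb M$ and $\lambda_1\otimes\nu$. *)

theory Defs
  imports "HOL-Probability.Probability"
begin

section \<open>Directed acyclic linear networks\<close>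

text \<open>
  A network is the list of its directed segments, each given as the pair of its endpoints
  (start, end); the segments are indexed by \<open>{..<length L}\<close>.
\<close>

type_synonym 'a network = "('a \<times> 'a) list"

definition seg_start :: "'a network \<Rightarrow> nat \<Rightarrow> 'a" where
  "seg_start L i = fst (L ! i)"

definition seg_end :: "'a network \<Rightarrow> nat \<Rightarrow> 'a" where
  "seg_end L i = snd (L ! i)"

definition seg :: "'a::euclidean_space network \<Rightarrow> nat \<Rightarrow> 'a set" where
  "seg L i = open_segment (seg_start L i) (seg_end L i)"

definition seg_length :: "'a::euclidean_space network \<Rightarrow> nat \<Rightarrow> real" where
  "seg_length L i = norm (seg_end L i - seg_start L i)"

definition seg_param :: "'a::euclidean_space network \<Rightarrow> nat \<Rightarrow> real \<Rightarrow> 'a" where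
  "seg_param L i t =
     seg_start L i + (t / norm (seg_end L i - seg_start L i)) *\<^sub>R (seg_end L i - seg_start L i)"

definition subseg :: "'a::euclidean_space network \<Rightarrow> nat \<Rightarrow> real \<Rightarrow> real \<Rightarrow> 'a set" where
  "subseg L i t1 t2 = seg_param L i ` {t1<..<t2}"

definition linear_network :: "'a::euclidean_space network \<Rightarrow> bool" where
  "linear_network L \<longleftrightarrow>
     (\<forall>i<length L. seg_start L i \<noteq> seg_end L i) \<and>
     (\<forall>i<length L. \<forall>j<length L. i \<noteq> j \<longrightarrow> seg L i \<inter> seg L j = {})"

definition net_union :: "'a::euclidean_space network \<Rightarrow> 'a set" where
  "net_union L = (\<Union>i<length L. seg L i)"

definition seg_before :: "'a network \<Rightarrow> nat \<Rightarrow> nat \<Rightarrow> bool" where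
  "seg_before L i j \<longleftrightarrow> i \<noteq> j \<and>
     (\<exists>I psi. I \<subseteq> {..<length L} \<and> i \<in> I \<and> j \<in> I \<and> bij_betw psi {1..card I} I \<and>
        psi 1 = i \<and> psi (card I) = j \<and>
        (\<forall>k\<in>{2..card I}. seg_start L (psi k) = seg_end L (psi (k - 1))))"

definition point_before :: "'a::euclidean_space network \<Rightarrow> 'a \<Rightarrow> 'a \<Rightarrow> bool" where
  "point_before L u v \<longleftrightarrow>
     (\<exists>i j t1 t2. i < length L \<and> j < length L \<and>
        0 < t1 \<and> t1 < seg_length L i \<and> 0 < t2 \<and> t2 < seg_length L j \<and>
        u = seg_param L i t1 \<and> v = seg_param L j t2 \<and>
        (if i = j then t1 < t2 else seg_before L i j))"

definition daln :: "'a::euclidean_space network \<Rightarrow> bool" where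
  "daln L \<longleftrightarrow> linear_network L \<and>
     (\<forall>u\<in>net_union L. \<forall>v\<in>net_union L. point_before L u v \<longrightarrow> \<not> point_before L v u)"

definition admissible_orders :: "'a network \<Rightarrow> (nat \<Rightarrow> nat) set" where
  "admissible_orders L = {omega. bij_betw omega {..<length L} {..<length L} \<and>
     (\<forall>i<length L. \<forall>j<length L. seg_before L (omega i) (omega j) \<longrightarrow> i < j)}"

definition upstream :: "'a::euclidean_space network \<Rightarrow> nat \<Rightarrow> 'a set" where
  "upstream L i = (\<Union>j\<in>{j. j < length L \<and> seg_before L j i}. seg L j)"

text \<open>
  In a linear network a point \<open>u\<close> has exactly one representation \<open>u = seg_param L i t\<close>, so the
  union below has a single member.
\<close>

definition past :: "'a::euclidean_space network \<Rightarrow> 'a \<Rightarrow> 'a set" where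
  "past L u = \<Union>{subseg L i 0 t \<union> upstream L i | i t.
     i < length L \<and> 0 < t \<and> t < seg_length L i \<and> u = seg_param L i t}"

definition earlier :: "'a::euclidean_space network \<Rightarrow> (nat \<Rightarrow> nat) \<Rightarrow> nat \<Rightarrow> 'a set" where
  "earlier L omega k = (\<Union>l<k. seg L (omega l))"

definition length_measure :: "'a::euclidean_space network \<Rightarrow> 'a measure" where
  "length_measure L = measure_of (net_union L) (sets (restrict_space borel (net_union L)))
     (\<lambda>A. \<Sum>i<length L. emeasure lborel {t \<in> {0<..<seg_length L i}. seg_param L i t \<in> A})"

lemma seg_param_measurable: "seg_param L i \<in> borel_measurable borel"
  unfolding seg_param_def by measurable

lemma seg_eq: "seg_start L i \<noteq> seg_end L i \<Longrightarrow> seg L i = subseg L i 0 (seg_length L i)"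
proof -
  assume a: "seg_start L i \<noteq> seg_end L i"
  define s where "s = seg_start L i" 
  define e where "e = seg_end L i"
  have n: "norm (e - s) > 0" using a by (simp add: s_def e_def)
  show ?thesis
    unfolding seg_def subseg_def seg_param_def[abs_def] seg_length_def s_def[symmetric] e_def[symmetric]
  proof (intro equalityI subsetI)
    fix x assume "x \<in> open_segment s e"
    then obtain u where u: "0<u" "u<1" "x = (1-u) *\<^sub>R s + u *\<^sub>R e" by (auto simp: in_segment)
    show "x \<in> (\<lambda>t. s + (t / norm (e - s)) *\<^sub>R (e - s)) ` {0<..<norm (e - s)}"
      by (rule image_eqI[of _ _ "u * norm (e-s)"]) (use u n in \<open>auto simp: algebra_simps\<close>)
  next
    fix x assume "x \<in> (\<lambda>t. s + (t / norm (e - s)) *\<^sub>R (e - s)) ` {0<..<norm (e - s)}"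
    then obtain t where t: "0<t" "t<norm (e-s)" "x = s + (t / norm (e - s)) *\<^sub>R (e - s)" by auto
    show "x \<in> open_segment s e" unfolding in_segment
      using t n a by (auto simp: s_def e_def intro!: exI[of _ "t / norm (e-s)"] simp: algebra_simps)
  qed
qed

lemma sets_length_measure: "sets (length_measure L) = sets (restrict_space borel (net_union L))"
  and space_length_measure: "space (length_measure L) = net_union L"
proof -
  have sp: "space (restrict_space borel (net_union L)) = net_union L" by (simp add: space_restrict_space)
  show "sets (length_measure L) = sets (restrict_space borel (net_union L))"
    unfolding length_measure_def using sets.sets_measure_of_eq[of "restrict_space borel (net_union L)"] sp by simp
  show "space (length_measure L) = net_union L"
    unfolding length_measure_def using sets.space_measure_of_eq[of "restrict_space borel (net_union L)"] sp by simp
qed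

lemma emeasure_length_measure:
  assumes "A \<in> sets (length_measure L)"
  shows "emeasure (length_measure L) A =
    (\<Sum>i<length L. emeasure lborel {t \<in> {0<..<seg_length L i}. seg_param L i t \<in> A})"
proof (rule emeasure_measure_of[OF length_measure_def _ _ _ assms])
  let ?R = "restrict_space borel (net_union L)"
  have b: "{t \<in> {0<..<seg_length L i}. seg_param L i t \<in> A} \<in> sets borel" if "A \<in> sets ?R" for A i
  proof -
    from that obtain B where B: "B \<in> sets borel" "A = net_union L \<inter> B" by (auto simp: sets_restrict_space)
    have "open_segment a b \<in> sets borel" for a b :: 'a
      by (metis borel_closed closed_segment_def closed_segment open_segment_def sets.Diff borel_singleton sets.empty_sets sets.insert_in_sets finite.intros(1) finite_imp_closed finite.insertI)
    then have "A \<in> sets borel" using B by (auto simp: net_union_def seg_def)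
    then show ?thesis using measurable_sets[OF seg_param_measurable, of A L i]
      by (simp add: Collect_conj_eq vimage_def)
  qed
  show "countably_additive (sets (length_measure L))
     (\<lambda>A. \<Sum>i<length L. emeasure lborel {t \<in> {0<..<seg_length L i}. seg_param L i t \<in> A})"
    unfolding countably_additive_def sets_length_measure
  proof (intro allI impI)
    fix A :: "nat \<Rightarrow> 'a set"
    assume A: "range A \<subseteq> sets ?R" "disjoint_family A"
    have "(\<Sum>n. \<Sum>i<length L. emeasure lborel {t \<in> {0<..<seg_length L i}. seg_param L i t \<in> A n}) =
      (\<Sum>i<length L. \<Sum>n. emeasure lborel {t \<in> {0<..<seg_length L i}. seg_param L i t \<in> A n})"
      by (rule suminf_sum) simp
    also have "\<dots> = (\<Sum>i<length L. emeasure lborel (\<Union>n. {t \<in> {0<..<seg_length L i}. seg_param L i t \<in> A n}))"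
      using A b by (intro sum.cong refl suminf_emeasure) (auto simp: disjoint_family_on_def)
    also have "\<dots> = (\<Sum>i<length L. emeasure lborel {t \<in> {0<..<seg_length L i}. seg_param L i t \<in> \<Union>(range A)})"
      by (intro sum.cong refl arg_cong[where f="emeasure lborel"]) auto
    finally show "(\<Sum>n. \<Sum>i<length L. emeasure lborel {t \<in> {0<..<seg_length L i}. seg_param L i t \<in> A n}) =
      (\<Sum>i<length L. emeasure lborel {t \<in> {0<..<seg_length L i}. seg_param L i t \<in> \<Union>(range A)})" .
  qed
qed (auto simp: positive_def sets_restrict_space)


section \<open>Spaces of point patterns\<close>

text \<open>
  Patterns are finite sets of points \<open>p\<close> located at \<open>loc p\<close>, at most one at each location, with
  the sigma-algebra generated by the counts. The map \<open>loc\<close> is the identity for unmarked points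
  and the first projection for pairs (location, mark).
\<close>

definition patterns :: "('p \<Rightarrow> 'l) \<Rightarrow> 'p measure \<Rightarrow> 'p set measure" where
  "patterns loc S = (let \<Omega> = {x. finite x \<and> x \<subseteq> space S \<and> inj_on loc x}
     in sigma \<Omega> {{x \<in> \<Omega>. card (x \<inter> A) = n} | A n. A \<in> sets S})"

abbreviation net_patterns :: "'a::euclidean_space network \<Rightarrow> 'a set measure" where
  "net_patterns L \<equiv> patterns (\<lambda>u. u) (length_measure L)"

abbreviation marked_net_patterns ::
    "'a::euclidean_space network \<Rightarrow> 'm measure \<Rightarrow> ('a \<times> 'm) set measure" where
  "marked_net_patterns L nu \<equiv> patterns fst (length_measure L \<Otimes>\<^sub>M nu)"

definition time_space :: "real \<Rightarrow> real measure" where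
  "time_space l = restrict_space borel {0<..<l}"


section \<open>Conditional laws\<close>

text \<open>
  \<open>K (H w)\<close> is a regular version of the conditional law of \<open>X\<close> given \<open>H\<close> under \<open>P\<close>. For a
  probability measure \<open>P\<close> the case \<open>A = space MX\<close> shows that \<open>K (H w)\<close> has total mass 1 for
  almost every \<open>w\<close>.
\<close>

definition cond_law ::
    "'w measure \<Rightarrow> ('w \<Rightarrow> 'h) \<Rightarrow> 'h measure \<Rightarrow> ('w \<Rightarrow> 'x) \<Rightarrow> 'x measure \<Rightarrow> ('h \<Rightarrow> 'x measure) \<Rightarrow> bool"
  where
  "cond_law P H MH X MX K \<longleftrightarrow>
     H \<in> measurable P MH \<and> X \<in> measurable P MX \<and>
     (\<forall>h\<in>space MH. sets (K h) = sets MX) \<and>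
     (\<forall>A\<in>sets MX. (\<lambda>h. emeasure (K h) A) \<in> borel_measurable MH) \<and>
     (\<forall>A\<in>sets MX. \<forall>B\<in>sets MH.
        emeasure P {w \<in> space P. H w \<in> B \<and> X w \<in> A} =
        (\<integral>\<^sup>+w. indicator B (H w) * emeasure (K (H w)) A \<partial>P))"


section \<open>Temporal point processes\<close>

text \<open>\<open>exp (-a)\<close>, with value 0 for infinite \<open>a\<close>; integrals of intensities may diverge.\<close>

definition exp_neg :: "ennreal \<Rightarrow> real" where
  "exp_neg a = (if a = \<infinity> then 0 else exp (- enn2real a))"

definition first_points :: "('r \<Rightarrow> real) \<Rightarrow> nat \<Rightarrow> 'r set \<Rightarrow> 'r set" where
  "first_points loc n y = {p \<in> y. card {q \<in> y. loc q < loc p} < n}"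

text \<open>The point with exactly \<open>n\<close> points before it, i.e. the one following the first \<open>n\<close>.\<close>

definition next_point :: "('r \<Rightarrow> real) \<Rightarrow> nat \<Rightarrow> 'r set \<Rightarrow> 'r" where
  "next_point loc n y = (THE p. p \<in> y \<and> card {q \<in> y. loc q < loc p} = n)"

definition last_time :: "('r \<Rightarrow> real) \<Rightarrow> 'r set \<Rightarrow> real" where
  "last_time loc h = Max (insert 0 (loc ` h))"

text \<open>
  \<open>Q\<close> is the law of a (possibly marked) point process on \<open>(0, l)\<close>, and \<open>lam s h\<close> is the
  conditional intensity at time \<open>s\<close> when the points before \<open>s\<close> are \<open>h\<close>. The survival formula
  holds for all \<open>t\<close> simultaneously outside one null set of histories.
\<close>

definition has_cond_intensity ::
    "('r \<Rightarrow> real) \<Rightarrow> 'r measure \<Rightarrow> real \<Rightarrow> (real \<Rightarrow> 'r set \<Rightarrow> real) \<Rightarrow> 'r set measure \<Rightarrow> bool" where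
  "has_cond_intensity loc S l lam Q \<longleftrightarrow>
     prob_space Q \<and> sets Q = sets (patterns loc S) \<and>
     (\<forall>n. \<exists>K.
        cond_law Q (first_points loc n) (patterns loc S) (\<lambda>y. y) (patterns loc S) K \<and>
        (AE y in Q. n \<le> card y \<longrightarrow>
           (let h = first_points loc n y; tn = last_time loc h in
            \<forall>t. tn \<le> t \<and> t < l \<longrightarrow>
              measure (K h) {y' \<in> space (patterns loc S). \<forall>p\<in>y'. loc p \<notin> {tn<..t}} =
              exp_neg (\<integral>\<^sup>+s\<in>{tn<..t}. ennreal (lam s h) \<partial>lborel))))"

text \<open>
  Given the first \<open>n\<close> marked points \<open>h\<close> and the time \<open>t\<close> of the next point, the mark of the next
  point has density \<open>\<lambda>m. f m t h\<close> with respect to \<open>nu\<close>.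
\<close>

definition has_mark_density ::
    "real \<Rightarrow> 'm measure \<Rightarrow> ('m \<Rightarrow> real \<Rightarrow> (real \<times> 'm) set \<Rightarrow> real) \<Rightarrow> (real \<times> 'm) set measure \<Rightarrow> bool"
  where
  "has_mark_density l nu f Q \<longleftrightarrow>
     (\<forall>n. cond_law (restrict_space Q {y \<in> space Q. n < card y})
        (\<lambda>y. (first_points fst n y, fst (next_point fst n y)))
        (patterns fst (time_space l \<Otimes>\<^sub>M nu) \<Otimes>\<^sub>M time_space l)
        (\<lambda>y. snd (next_point fst n y)) nu
        (\<lambda>(h, t). density nu (\<lambda>m. ennreal (f m t h))))"


section \<open>Point processes on a network\<close>

text \<open>
  Intensities \<open>lam u x\<close> and mark densities \<open>f m u x\<close> take the history as the argument \<open>x\<close>; they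
  are only ever used on patterns contained in \<open>past L u\<close>.
\<close>

definition intensity_fun ::
    "'a measure \<Rightarrow> 'p set measure \<Rightarrow> ('a \<Rightarrow> 'p set \<Rightarrow> real) \<Rightarrow> bool" where
  "intensity_fun S PS lam \<longleftrightarrow>
     (\<lambda>(u, x). lam u x) \<in> borel_measurable (S \<Otimes>\<^sub>M PS) \<and>
     (\<forall>u\<in>space S. \<forall>x\<in>space PS. 0 \<le> lam u x)"

definition mark_density_fun ::
    "'a measure \<Rightarrow> 'p set measure \<Rightarrow> 'm measure \<Rightarrow> ('m \<Rightarrow> 'a \<Rightarrow> 'p set \<Rightarrow> real) \<Rightarrow> bool" where
  "mark_density_fun S PS nu f \<longleftrightarrow>
     (\<lambda>(m, u, x). f m u x) \<in> borel_measurable (nu \<Otimes>\<^sub>M (S \<Otimes>\<^sub>M PS)) \<and>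
     (\<forall>m\<in>space nu. \<forall>u\<in>space S. \<forall>x\<in>space PS. 0 \<le> f m u x)"

text \<open>
  Given the points on the segments that come earlier in \<open>omega\<close>, the process on the segment
  \<open>omega k\<close> is the image of a temporal process with law \<open>Q z\<close>, where \<open>z\<close> consists of the
  points upstream.
\<close>

definition network_process ::
    "'a::euclidean_space network \<Rightarrow> (nat \<Rightarrow> nat) \<Rightarrow> ('a \<Rightarrow> 'a set \<Rightarrow> real) \<Rightarrow>
     'w measure \<Rightarrow> ('w \<Rightarrow> 'a set) \<Rightarrow> bool" where
  "network_process L omega lam P X \<longleftrightarrow>
     prob_space P \<and> X \<in> measurable P (net_patterns L) \<and>
     (\<forall>k<length L. let i = omega k in
        \<exists>Q. cond_law P
              (\<lambda>w. X w \<inter> earlier L omega k) (net_patterns L)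
              (\<lambda>w. X w \<inter> seg L i) (net_patterns L)
              (\<lambda>h. distr (Q (h \<inter> upstream L i)) (net_patterns L) (\<lambda>y. seg_param L i ` y)) \<and>
            (AE w in P. let z = X w \<inter> upstream L i in
               has_cond_intensity (\<lambda>t. t) (time_space (seg_length L i)) (seg_length L i)
                 (\<lambda>t h. lam (seg_param L i t) (z \<union> seg_param L i ` h)) (Q z)))"

definition marked_network_process ::
    "'a::euclidean_space network \<Rightarrow> (nat \<Rightarrow> nat) \<Rightarrow> 'm measure \<Rightarrow>
     ('a \<Rightarrow> ('a \<times> 'm) set \<Rightarrow> real) \<Rightarrow> ('m \<Rightarrow> 'a \<Rightarrow> ('a \<times> 'm) set \<Rightarrow> real) \<Rightarrow>
     'w measure \<Rightarrow> ('w \<Rightarrow> ('a \<times> 'm) set) \<Rightarrow> bool" where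
  "marked_network_process L omega nu lam f P Y \<longleftrightarrow>
     prob_space P \<and> Y \<in> measurable P (marked_net_patterns L nu) \<and>
     (\<forall>k<length L. let i = omega k; emb = map_prod (seg_param L i) (\<lambda>m. m) in
        \<exists>Q. cond_law P
              (\<lambda>w. Y w \<inter> fst -` earlier L omega k) (marked_net_patterns L nu)
              (\<lambda>w. Y w \<inter> fst -` seg L i) (marked_net_patterns L nu)
              (\<lambda>h. distr (Q (h \<inter> fst -` upstream L i)) (marked_net_patterns L nu) (\<lambda>y. emb ` y)) \<and>
            (AE w in P. let z = Y w \<inter> fst -` upstream L i in
               has_cond_intensity fst (time_space (seg_length L i) \<Otimes>\<^sub>M nu) (seg_length L i)
                 (\<lambda>t h. lam (seg_param L i t) (z \<union> emb ` h)) (Q z) \<and>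
               has_mark_density (seg_length L i) nu
                 (\<lambda>m t h. f m (seg_param L i t) (z \<union> emb ` h)) (Q z)))"


section \<open>Likelihood functions\<close>

text \<open>
  The pattern with points \<open>xs 0, \<dots>, xs (n - 1)\<close> is \<open>xs ` {..<n}\<close>. For \<open>n = 0\<close> the product
  measure is a unit mass, so the corresponding term is \<open>indicator F {} * J {}\<close>.
\<close>

definition janossy_density ::
    "('p \<Rightarrow> 'l) \<Rightarrow> 'p measure \<Rightarrow> 'w measure \<Rightarrow> ('w \<Rightarrow> 'p set) \<Rightarrow> ('p set \<Rightarrow> real) \<Rightarrow> bool" where
  "janossy_density loc S P X J \<longleftrightarrow>
     J \<in> borel_measurable (patterns loc S) \<and> (\<forall>x\<in>space (patterns loc S). 0 \<le> J x) \<and>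
     (\<forall>F\<in>sets (patterns loc S).
        emeasure P {w \<in> space P. X w \<in> F} =
        (\<Sum>n. ennreal (1 / fact n) *
           (\<integral>\<^sup>+xs. indicator F (xs ` {..<n}) * ennreal (J (xs ` {..<n})) \<partial>PiM {..<n} (\<lambda>_. S))))"

definition likelihood_function ::
    "('p \<Rightarrow> 'l) \<Rightarrow> 'p measure \<Rightarrow> 'q set \<Rightarrow> ('q \<Rightarrow> 'w measure) \<Rightarrow> ('w \<Rightarrow> 'p set) \<Rightarrow>
     ('q \<Rightarrow> 'p set \<Rightarrow> real) \<Rightarrow> bool" where
  "likelihood_function loc S Theta P X lik \<longleftrightarrow>
     (\<forall>theta\<in>Theta. janossy_density loc S (P theta) X (lik theta))"

end

theory Submission imports Defs begin

text \<open>
  On one segment, the survival formula determines the law of the next point given the first \<open>n\<close>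
  points: it is found at \<open>t\<close> with density \<open>\<lambda>(t) exp (- \<integral> \<lambda>)\<close>, the integral running from the last point
  to \<open>t\<close>. Multiplying these densities gives the density of the ordered \<open>n\<close>-tuple, and since each of
  the \<open>n\<close> points is equally likely to be the last one under the symmetric measure, passing to
  unordered patterns produces the factor \<open>1/n!\<close>. Segments are then added one at a time along
  \<open>omega\<close>. If, under the measure \<open>\<Sum> 1/n! \<lambda>\<^sub>1\<^sup>n\<close>, the pattern is split into its parts on two
  disjoint sets, the binomial theorem turns the measure into a product; hence the density of the
  union is the product of the density on the earlier segments and the conditional density on the
  new one, and the exponents add up to the integral over the whole network.
\<close>

section \<open>Measurability on spaces of point patterns\<close>

text \<open>All laws are expressed as identities between integrals of nonnegative functions of a
  pattern: \<open>pat_integral\<close> integrates a function of a set one point at a time.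
  Coinciding locations receive the value 0, and only the final comparison with the tuple integrals
  of \<open>janossy_density\<close> uses that the length measure has no atoms. The analytic obstacle
  is the survival formula. It is available only before the end of the segment, and the integral
  Lambda of the intensity may diverge. The integral of lambda exp(-Lambda) equals 1 - exp(-Lambda)
  only if Lambda never jumps from a finite value to infinity; countable additivity of the law of the
  next point rules such a jump out. As Lambda need not be differentiable everywhere, exp(-Lambda) is
  written as the tail of a unit exponential variable and the order of integration is exchanged.
  Conditional laws are determined only up to null sets, so they are replaced by genuine kernels
  before being integrated. Gluing along \<open>omega\<close> succeeds because the past of a point
  never meets a later segment: adding a segment leaves the density on the earlier ones
  unchanged.\<close>

lemma space_patterns: "space (patterns loc S) = {x. finite x \<and> x \<subseteq> space S \<and> inj_on loc x}"
  by (simp add: patterns_def Let_def space_measure_of_conv)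

lemma sets_patterns:
  "sets (patterns loc S) = sigma_sets (space (patterns loc S))
     {{x \<in> space (patterns loc S). card (x \<inter> A) = n} | A n. A \<in> sets S}"
  unfolding space_patterns unfolding patterns_def Let_def
  by (rule sets_measure_of) auto

lemma patterns_cong: "sets S = sets S' \<Longrightarrow> patterns loc S = patterns loc S'"
  using sets_eq_imp_space_eq[of S S'] by (simp add: patterns_def)

lemma finite_patterns: "x \<in> space (patterns loc S) \<Longrightarrow> finite x"
  by (simp add: space_patterns)

lemma empty_in_patterns [simp]: "{} \<in> space (patterns loc S)"
  by (simp add: space_patterns)

lemma subset_in_patterns: "x \<in> space (patterns loc S) \<Longrightarrow> y \<subseteq> x \<Longrightarrow> y \<in> space (patterns loc S)"
  by (auto simp: space_patterns intro: finite_subset inj_on_subset)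

lemma measurable_card_Int:
  assumes "A \<in> sets S"
  shows "(\<lambda>x. card (x \<inter> A)) \<in> measurable (patterns loc S) (count_space UNIV)"
proof (subst measurable_count_space_eq2_countable, safe)
  fix n
  have "(\<lambda>x. card (x \<inter> A)) -` {n} \<inter> space (patterns loc S) =
      {x \<in> space (patterns loc S). card (x \<inter> A) = n}" by auto
  also have "\<dots> \<in> sets (patterns loc S)"
    unfolding sets_patterns using assms by (intro sigma_sets.Basic) auto
  finally show "(\<lambda>x. card (x \<inter> A)) -` {n} \<inter> space (patterns loc S) \<in> sets (patterns loc S)" .
qed auto

lemma measurable_patternsI:
  assumes "\<And>a. a \<in> space M \<Longrightarrow> f a \<in> space (patterns loc S)"
    and "\<And>A. A \<in> sets S \<Longrightarrow> (\<lambda>a. card (f a \<inter> A)) \<in> measurable M (count_space UNIV)"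
  shows "f \<in> measurable M (patterns loc S)"
proof (rule measurable_sigma_sets[OF sets_patterns])
  fix B assume "B \<in> {{x \<in> space (patterns loc S). card (x \<inter> A) = n} | A n. A \<in> sets S}"
  then obtain A n where B: "A \<in> sets S" "B = {x \<in> space (patterns loc S). card (x \<inter> A) = n}" by auto
  have "f -` B \<inter> space M = (\<lambda>a. card (f a \<inter> A)) -` {n} \<inter> space M"
    using assms(1) B(2) by auto
  also have "\<dots> \<in> sets M" using assms(2)[OF B(1)] by (rule measurable_sets) simp
  finally show "f -` B \<inter> space M \<in> sets M" .
qed (use assms(1) in auto)

text \<open>On a rectangle \<open>A \<times> B\<close> the sum is \<open>indicator A a\<close> times
  the count of points in \<open>B\<close>, and counts generate the sigma-algebra of patterns; the
  pi-lambda theorem does the rest. The parameter \<open>a\<close> is essential: filters, histories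
  and densities all test a point against data that vary with the pattern.\<close>

lemma measurable_pattern_sum_indicator:
  assumes "C \<in> sets (M \<Otimes>\<^sub>M S)"
  shows "(\<lambda>(a, y). \<Sum>p\<in>y. indicator C (a, p) :: ennreal) \<in> borel_measurable (M \<Otimes>\<^sub>M patterns loc S)"
  using Int_stable_pair_measure_generator pair_measure_closed assms[unfolded sets_pair_measure]
proof (induction rule: sigma_sets_induct_disjoint)
  case (basic C)
  then obtain A B where C: "C = A \<times> B" "A \<in> sets M" "B \<in> sets S" by auto
  have [measurable]: "A \<in> sets M" "B \<in> sets S" by fact+
  have [measurable]: "(\<lambda>y. card (y \<inter> B)) \<in> measurable (patterns loc S) (count_space UNIV)"
    by (rule measurable_card_Int) fact
  have "(\<lambda>(a, y). indicator A a * of_nat (card (y \<inter> B)) :: ennreal) \<in> borel_measurable (M \<Otimes>\<^sub>M patterns loc S)"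
    by measurable
  also have "?this \<longleftrightarrow> ?case"
  proof (intro measurable_cong, clarsimp simp: space_pair_measure)
    fix a y assume "y \<in> space (patterns loc S)"
    then have "finite y" by (rule finite_patterns)
    then have "(\<Sum>p\<in>y. indicator C (a, p) :: ennreal) = indicator A a * (\<Sum>p\<in>y. indicator B p)"
      by (simp add: C(1) indicator_times sum_distrib_left)
    then show "indicator A a * of_nat (card (y \<inter> B)) = (\<Sum>p\<in>y. indicator C (a, p) :: ennreal)"
      using \<open>finite y\<close> by (simp add: indicator_def sum.If_cases)
  qed
  finally show ?case .
next
  case empty
  then show ?case by simp
next
  case (compl C)
  have [measurable]: "(\<lambda>y. card (y \<inter> space S)) \<in> measurable (patterns loc S) (count_space UNIV)"
    by (rule measurable_card_Int) simp
  note [measurable] = compl.IH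
  \<comment> \<open>The sum over a complement is the number of all points minus the sum over
    \<open>C\<close>. Patterns are finite, so the truncated subtraction of \<open>ennreal\<close> is
    the true difference here.\<close>
  have "(\<lambda>(a, y). of_nat (card (y \<inter> space S)) - (\<Sum>p\<in>y. indicator C (a, p)) :: ennreal)
      \<in> borel_measurable (M \<Otimes>\<^sub>M patterns loc S)"
    using compl.IH by (simp add: split_beta')
  also have "?this \<longleftrightarrow> ?case"
  proof (intro measurable_cong, clarsimp simp: space_pair_measure)
    fix a y assume a: "a \<in> space M" and "y \<in> space (patterns loc S)"
    then have y: "finite y" "y \<subseteq> space S" by (auto simp: space_patterns)
    have "of_nat (card (y \<inter> space S)) = (\<Sum>p\<in>y. 1 :: ennreal)" using y by (simp add: Int_absorb2)
    also have "\<dots> = (\<Sum>p\<in>y. indicator C (a, p)) + (\<Sum>p\<in>y. indicator (space M \<times> space S - C) (a, p))"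
      unfolding sum.distrib[symmetric] using y a by (intro sum.cong) (auto simp: indicator_def)
    finally show "of_nat (card (y \<inter> space S)) - (\<Sum>p\<in>y. indicator C (a, p)) =
        (\<Sum>p\<in>y. indicator (space M \<times> space S - C) (a, p) :: ennreal)"
      by (simp add: ennreal_add_diff_cancel_left y indicator_def flip: of_nat_sum)
  qed
  finally show ?case .
next
  case (union C)
  have "(\<lambda>x. \<Sum>i. (case x of (a, y) \<Rightarrow> \<Sum>p\<in>y. (indicator (C i) (a, p) :: ennreal))) \<in>
      borel_measurable (M \<Otimes>\<^sub>M patterns loc S)"
    using union.IH by measurable
  also have "?this \<longleftrightarrow> ?case"
    using suminf_indicator[OF union(1)]
    by (intro measurable_cong) (auto simp: suminf_sum)
  finally show ?case .
qed

lemma measurable_pattern_sum: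
  fixes G :: "'a \<times> 'p \<Rightarrow> ennreal"
  assumes "G \<in> borel_measurable (M \<Otimes>\<^sub>M S)"
  shows "(\<lambda>(a, y). \<Sum>p\<in>y. G (a, p)) \<in> borel_measurable (M \<Otimes>\<^sub>M patterns loc S)"
  using assms
proof induction
  case (cong f g)
  have "(\<lambda>(a, y). \<Sum>p\<in>y. f (a, p)) \<in> borel_measurable (M \<Otimes>\<^sub>M patterns loc S) \<longleftrightarrow>
     (\<lambda>(a, y). \<Sum>p\<in>y. g (a, p)) \<in> borel_measurable (M \<Otimes>\<^sub>M patterns loc S)"
    by (intro measurable_cong) (auto simp: space_pair_measure space_patterns intro!: sum.cong cong.hyps(3))
  then show ?case using cong.IH by simp
next
  case (set A)
  then show ?case by (rule measurable_pattern_sum_indicator)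
next
  case (mult u c)
  then show ?case by (simp add: sum_distrib_left[symmetric] split_beta')
next
  case (add u v)
  then show ?case by (simp add: sum.distrib split_beta')
next
  case (seq U)
  have "(\<lambda>(a, y). \<Sum>p\<in>y. (SUP i. U i) (a, p)) = (\<lambda>x. SUP i. case x of (a, y) \<Rightarrow> \<Sum>p\<in>y. U i (a, p))"
  proof
    fix x :: "'a \<times> 'p set"
    obtain a y where x: "x = (a, y)" by (cases x)
    have "(\<Sum>p\<in>y. (SUP i. U i) (a, p)) = (\<Sum>p\<in>y. SUP i. U i (a, p))"
      by (simp add: SUP_apply image_comp)
    also have "\<dots> = (SUP i. \<Sum>p\<in>y. U i (a, p))"
      by (rule ennreal_SUP_sum[symmetric]) (use seq.hyps(3) in \<open>auto simp: incseq_def le_fun_def\<close>)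
    finally show "(case x of (a, y) \<Rightarrow> \<Sum>p\<in>y. (SUP i. U i) (a, p)) =
        (SUP i. case x of (a, y) \<Rightarrow> \<Sum>p\<in>y. U i (a, p))"
      by (simp add: x)
  qed
  then show ?case using seq.IH by simp
qed

lemma measurable_pattern_sum' [measurable (raw)]:
  fixes G :: "'a \<Rightarrow> 'p \<Rightarrow> ennreal"
  assumes "case_prod G \<in> borel_measurable (M \<Otimes>\<^sub>M S)" and Y: "Y \<in> measurable M (patterns loc S)"
  shows "(\<lambda>a. \<Sum>p\<in>Y a. G a p) \<in> borel_measurable M"
  using measurable_compose[OF measurable_Pair[OF measurable_ident Y] measurable_pattern_sum[OF assms(1)]]
  by simp

lemma measurable_pattern_card [measurable (raw)]:
  assumes [measurable]: "Measurable.pred (M \<Otimes>\<^sub>M S) (case_prod R)" and Y[measurable]: "Y \<in> measurable M (patterns loc S)"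
  shows "(\<lambda>a. card {p \<in> Y a. R a p}) \<in> measurable M (count_space UNIV)"
proof (subst measurable_count_space_eq2_countable, safe)
  fix n
  have fin: "finite (Y a)" if "a \<in> space M" for a
    using measurable_space[OF Y that] by (rule finite_patterns)
  have "(\<lambda>a. card {p \<in> Y a. R a p}) -` {n} \<inter> space M =
      {a \<in> space M. (\<Sum>p\<in>Y a. if R a p then 1 else 0 :: ennreal) = of_nat n}"
    using fin by (auto simp flip: sum.inter_filter)
  also have "\<dots> \<in> sets M" by measurable
  finally show "(\<lambda>a. card {p \<in> Y a. R a p}) -` {n} \<inter> space M \<in> sets M" .
qed auto

lemma measurable_pattern_filter [measurable (raw)]:
  assumes R[measurable]: "Measurable.pred (M \<Otimes>\<^sub>M S) (case_prod R)" and Y[measurable]: "Y \<in> measurable M (patterns loc S)"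
  shows "(\<lambda>a. {p \<in> Y a. R a p}) \<in> measurable M (patterns loc S)"
proof (rule measurable_patternsI)
  show "{p \<in> Y a. R a p} \<in> space (patterns loc S)" if "a \<in> space M" for a
    using measurable_space[OF Y that] by (rule subset_in_patterns) auto
  fix A assume [measurable]: "A \<in> sets S"
  have "{p \<in> Y a. R a p} \<inter> A = {p \<in> Y a. R a p \<and> p \<in> A}" for a by auto
  then show "(\<lambda>a. card ({p \<in> Y a. R a p} \<inter> A)) \<in> measurable M (count_space UNIV)"
    by simp
qed

text \<open>The product is the exponential of a sum of logarithms. Sums over patterns are handled in
  \<open>ennreal\<close>, hence the positive and negative parts of the logarithm are summed
  separately; patterns with a vanishing factor are singled out by a count.\<close>

lemma measurable_pattern_prod:
  fixes G :: "'a \<Rightarrow> 'p \<Rightarrow> real"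
  assumes G[measurable]: "case_prod G \<in> borel_measurable (M \<Otimes>\<^sub>M S)" and Y[measurable]: "Y \<in> measurable M (patterns loc S)"
    and nonneg: "\<And>a p. a \<in> space M \<Longrightarrow> p \<in> Y a \<Longrightarrow> 0 \<le> G a p"
  shows "(\<lambda>a. \<Prod>p\<in>Y a. G a p) \<in> borel_measurable M"
proof -
  have fin: "finite (Y a)" if "a \<in> space M" for a
    using measurable_space[OF Y that] by (rule finite_patterns)
  have "(\<lambda>a. if card {p \<in> Y a. G a p = 0} = 0 then
       exp (enn2real (\<Sum>p\<in>Y a. ennreal (ln (G a p))) - enn2real (\<Sum>p\<in>Y a. ennreal (- ln (G a p)))) else 0)
     \<in> borel_measurable M"
    by measurable
  also have "?this \<longleftrightarrow> ?thesis"
  proof (intro measurable_cong)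
    fix a assume a: "a \<in> space M"
    show "(if card {p \<in> Y a. G a p = 0} = 0 then
       exp (enn2real (\<Sum>p\<in>Y a. ennreal (ln (G a p))) - enn2real (\<Sum>p\<in>Y a. ennreal (- ln (G a p)))) else 0)
      = (\<Prod>p\<in>Y a. G a p)"
    proof (cases "{p \<in> Y a. G a p = 0} = {}")
      case True
      have pos: "0 < G a p" if "p \<in> Y a" for p
        using nonneg[OF a that] True that by force
      have e: "enn2real (\<Sum>p\<in>Y a. ennreal (H p)) = (\<Sum>p\<in>Y a. max 0 (H p))" for H
      proof -
        have "(\<Sum>p\<in>Y a. ennreal (H p)) = ennreal (\<Sum>p\<in>Y a. max 0 (H p))"
          by (subst sum_ennreal[symmetric]) (simp, intro sum.cong refl, simp add: max_def ennreal_neg)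
        then show ?thesis by (simp add: sum_nonneg)
      qed
      have "(\<Sum>p\<in>Y a. max 0 (ln (G a p))) - (\<Sum>p\<in>Y a. max 0 (- ln (G a p))) = (\<Sum>p\<in>Y a. ln (G a p))"
        unfolding sum_subtractf[symmetric] by (intro sum.cong) auto
      moreover have "exp (\<Sum>p\<in>Y a. ln (G a p)) = (\<Prod>p\<in>Y a. G a p)"
        using fin[OF a] pos by (simp add: exp_sum)
      moreover have "card {p \<in> Y a. G a p = 0} = 0" using True by (metis card.empty)
      ultimately show ?thesis by (simp add: e)
    next
      case False
      then show ?thesis using fin[OF a] by (auto simp: prod_zero_iff)
    qed
  qed
  finally show ?thesis .
qed

text \<open>The value \<open>{}\<close> on overlapping locations makes the union measurable on all pairs of patterns.\<close>

definition pat_union :: "('p \<Rightarrow> 'l) \<Rightarrow> 'p set \<Rightarrow> 'p set \<Rightarrow> 'p set" where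
  "pat_union loc x y = (if loc ` x \<inter> loc ` y = {} then x \<union> y else {})"

lemma pat_union_in_patterns:
  "x \<in> space (patterns loc S) \<Longrightarrow> y \<in> space (patterns loc S) \<Longrightarrow> pat_union loc x y \<in> space (patterns loc S)"
  by (auto simp: pat_union_def space_patterns inj_on_Un)

lemma measurable_singleton_pattern:
  "(\<lambda>p. {p}) \<in> measurable S (patterns loc S)"
proof (rule measurable_patternsI)
  fix A assume [measurable]: "A \<in> sets S"
  have "card ({p} \<inter> A) = (if p \<in> A then 1 else 0)" for p by auto
  then show "(\<lambda>p. card ({p} \<inter> A)) \<in> measurable S (count_space UNIV)" by simp
qed (simp add: space_patterns)

lemma measurable_loc_mem [measurable (raw)]:
  fixes loc :: "'p \<Rightarrow> 'l::euclidean_space"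
  assumes [measurable]: "loc \<in> borel_measurable S" "u \<in> borel_measurable M" and Y[measurable]: "Y \<in> measurable M (patterns loc S)"
  shows "Measurable.pred M (\<lambda>a. u a \<in> loc ` Y a)"
proof -
  have fin: "finite (Y a)" if "a \<in> space M" for a
    using measurable_space[OF Y that] by (rule finite_patterns)
  have "Measurable.pred M (\<lambda>a. card {p \<in> Y a. loc p = u a} \<noteq> 0)" by measurable
  also have "?this \<longleftrightarrow> ?thesis"
  proof (intro measurable_cong)
    fix a assume "a \<in> space M"
    then have "card {p \<in> Y a. loc p = u a} \<noteq> 0 \<longleftrightarrow> {p \<in> Y a. loc p = u a} \<noteq> {}" using fin by simp
    then show "(card {p \<in> Y a. loc p = u a} \<noteq> 0) = (u a \<in> loc ` Y a)" by force
  qed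
  finally show ?thesis .
qed

lemma measurable_pat_union [measurable (raw)]:
  fixes loc :: "'p \<Rightarrow> 'l::euclidean_space"
  assumes [measurable]: "loc \<in> borel_measurable S" and X[measurable]: "X \<in> measurable M (patterns loc S)"
   and Y[measurable]: "Y \<in> measurable M (patterns loc S)"
  shows "(\<lambda>a. pat_union loc (X a) (Y a)) \<in> measurable M (patterns loc S)"
proof (rule measurable_patternsI)
  show "pat_union loc (X a) (Y a) \<in> space (patterns loc S)" if "a \<in> space M" for a
    using measurable_space[OF X that] measurable_space[OF Y that] by (rule pat_union_in_patterns)
  fix A assume A[measurable]: "A \<in> sets S"
  have fin: "finite (Y a)" "finite (X a)" if "a \<in> space M" for a
    using measurable_space[OF Y that] measurable_space[OF X that] by (simp_all add: finite_patterns)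
  have "(\<lambda>a. if card {p \<in> X a. loc p \<in> loc ` Y a} = 0 then card {p \<in> X a. p \<in> A} + card {p \<in> Y a. p \<in> A} else 0)
     \<in> measurable M (count_space UNIV)"
    by measurable
  also have "?this \<longleftrightarrow> (\<lambda>a. card (pat_union loc (X a) (Y a) \<inter> A)) \<in> measurable M (count_space UNIV)"
  proof (intro measurable_cong)
    fix a assume a: "a \<in> space M"
    have *: "card {p \<in> X a. loc p \<in> loc ` Y a} = 0 \<longleftrightarrow> loc ` X a \<inter> loc ` Y a = {}"
      using fin[OF a] by auto
    have "card ((X a \<union> Y a) \<inter> A) = card {p \<in> X a. p \<in> A} + card {p \<in> Y a. p \<in> A}"
      if "loc ` X a \<inter> loc ` Y a = {}"
      using fin[OF a] that
      by (subst card_Un_disjoint[symmetric]) (auto intro!: arg_cong[where f=card])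
    then show "(if card {p \<in> X a. loc p \<in> loc ` Y a} = 0 then card {p \<in> X a. p \<in> A} + card {p \<in> Y a. p \<in> A} else 0) =
      card (pat_union loc (X a) (Y a) \<inter> A)"
      unfolding * by (simp add: pat_union_def)
  qed
  finally show "(\<lambda>a. card (pat_union loc (X a) (Y a) \<inter> A)) \<in> measurable M (count_space UNIV)" .
qed

lemma measurable_image_pattern:
  assumes e: "e \<in> measurable S S'" and "\<And>y. y \<in> space (patterns loc S) \<Longrightarrow> inj_on (\<lambda>p. loc' (e p)) y"
  shows "(\<lambda>y. e ` y) \<in> measurable (patterns loc S) (patterns loc' S')"
proof (rule measurable_patternsI)
  show "e ` y \<in> space (patterns loc' S')" if "y \<in> space (patterns loc S)" for y
    using that assms(2)[OF that] measurable_space[OF e]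
    by (auto simp: space_patterns inj_on_def)
  fix A assume "A \<in> sets S'"
  then have [measurable]: "e -` A \<inter> space S \<in> sets S" using e by (rule measurable_sets[rotated])
  have "(\<lambda>y. card (y \<inter> (e -` A \<inter> space S))) \<in> measurable (patterns loc S) (count_space UNIV)"
    by (rule measurable_card_Int) measurable
  also have "?this \<longleftrightarrow> (\<lambda>y. card (e ` y \<inter> A)) \<in> measurable (patterns loc S) (count_space UNIV)"
  proof (intro measurable_cong)
    fix y assume y: "y \<in> space (patterns loc S)"
    then have "inj_on e y" using assms(2)[OF y] by (auto simp: inj_on_def)
    moreover have "e ` y \<inter> A = e ` (y \<inter> (e -` A \<inter> space S))" using y by (auto simp: space_patterns)
    ultimately show "card (y \<inter> (e -` A \<inter> space S)) = card (e ` y \<inter> A)"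
      by (metis card_image inf_le1 inj_on_subset)
  qed
  finally show "(\<lambda>y. card (e ` y \<inter> A)) \<in> measurable (patterns loc S) (count_space UNIV)" .
qed

section \<open>Integration over point patterns\<close>

text \<open>The value 0 at coinciding locations keeps \<open>F\<close> from being evaluated outside
  \<open>space (patterns loc S)\<close>, where nothing is known about it, and keeps a repeated point
  from lowering the cardinality.\<close>

definition add_pt :: "('p \<Rightarrow> 'l) \<Rightarrow> 'p \<Rightarrow> ('p set \<Rightarrow> ennreal) \<Rightarrow> 'p set \<Rightarrow> ennreal" where
  "add_pt loc x F y = (if loc x \<in> loc ` y then 0 else F (insert x y))"

text \<open>This is the integral over ordered \<open>n\<close>-tuples from \<open>A\<close> with
  distinct locations. Peeling off one point at a time makes induction on \<open>n\<close> possible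
  while \<open>F\<close> remains a function of sets.\<close>

primrec pat_integral ::
    "('p \<Rightarrow> 'l) \<Rightarrow> 'p measure \<Rightarrow> 'p set \<Rightarrow> nat \<Rightarrow> ('p set \<Rightarrow> ennreal) \<Rightarrow> ennreal" where
  "pat_integral loc S A 0 F = F {}"
| "pat_integral loc S A (Suc n) F = (\<integral>\<^sup>+x. indicator A x * pat_integral loc S A n (add_pt loc x F) \<partial>S)"

text \<open>Integration against the Lebesgue-Poisson measure on the finite configurations in
  \<open>A\<close>; the right-hand side of a Janossy density is of this form up to tuples with
  coinciding locations.\<close>

definition pat_total ::
    "('p \<Rightarrow> 'l) \<Rightarrow> 'p measure \<Rightarrow> 'p set \<Rightarrow> ('p set \<Rightarrow> ennreal) \<Rightarrow> ennreal" where
  "pat_total loc S A F = (\<Sum>n. ennreal (1 / fact n) * pat_integral loc S A n F)"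

lemma insert_in_patterns:
  "x \<in> space S \<Longrightarrow> y \<in> space (patterns loc S) \<Longrightarrow> loc x \<notin> loc ` y \<Longrightarrow> insert x y \<in> space (patterns loc S)"
  by (auto simp: space_patterns)

lemma pat_integral_cong:
  assumes "\<And>y. y \<in> space (patterns loc S) \<Longrightarrow> y \<subseteq> A \<Longrightarrow> card y = n \<Longrightarrow> F y = G y"
  shows "pat_integral loc S A n F = pat_integral loc S A n G"
  using assms
proof (induction n arbitrary: F G)
  case (Suc n)
  have "indicator A x * pat_integral loc S A n (add_pt loc x F) = indicator A x * pat_integral loc S A n (add_pt loc x G)"
    if x: "x \<in> space S" for x
  proof (cases "x \<in> A")
    case True
    have "pat_integral loc S A n (add_pt loc x F) = pat_integral loc S A n (add_pt loc x G)"
    proof (rule Suc.IH)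
      fix y assume y: "y \<in> space (patterns loc S)" "y \<subseteq> A" "card y = n"
      show "add_pt loc x F y = add_pt loc x G y"
      proof (cases "loc x \<in> loc ` y")
        case False
        have "F (insert x y) = G (insert x y)"
          using x y True False finite_patterns[OF y(1)]
          by (intro Suc.prems insert_in_patterns) (auto simp: card_insert_if)
        then show ?thesis by (simp add: add_pt_def)
      qed (simp add: add_pt_def)
    qed
    then show ?thesis by simp
  qed simp
  then show ?case by (auto intro: nn_integral_cong)
qed simp

lemma pat_integral_zero [simp]: "pat_integral loc S A n (\<lambda>_. 0) = 0"
proof (induction n)
  case (Suc n)
  have "add_pt loc x (\<lambda>_. 0) = (\<lambda>_. 0)" for x :: 'a by (auto simp: add_pt_def)
  then show ?case by (simp add: Suc)
qed simp

section \<open>Superposition of patterns on disjoint sets\<close>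

lemma sum_binomial_Suc:
  fixes a :: "nat \<Rightarrow> nat \<Rightarrow> 'a::comm_semiring_1"
  shows "(\<Sum>k\<le>n. of_nat (n choose k) * (a (Suc k) (n - k) + a k (Suc (n - k)))) =
    (\<Sum>k\<le>Suc n. of_nat (Suc n choose k) * a k (Suc n - k))"
proof -
  have rearr: "x + z = w \<Longrightarrow> x + y + z = w + y" for x y z w :: 'a
    by (metis add.assoc add.commute)
  have "(\<Sum>k\<le>Suc n. of_nat (Suc n choose k) * a k (Suc n - k)) =
      a 0 (Suc n) + (\<Sum>k\<le>n. of_nat (n choose k) * a (Suc k) (n - k))
      + (\<Sum>k\<le>n. of_nat (n choose Suc k) * a (Suc k) (n - k))"
    by (subst sum.atMost_Suc_shift) (simp add: algebra_simps sum.distrib)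
  also have "a 0 (Suc n) + (\<Sum>k\<le>n. of_nat (n choose Suc k) * a (Suc k) (n - k)) =
      (\<Sum>k\<le>Suc n. of_nat (n choose k) * a k (Suc n - k))"
    by (subst sum.atMost_Suc_shift) simp
  then have "a 0 (Suc n) + (\<Sum>k\<le>n. of_nat (n choose k) * a (Suc k) (n - k))
      + (\<Sum>k\<le>n. of_nat (n choose Suc k) * a (Suc k) (n - k)) =
      (\<Sum>k\<le>Suc n. of_nat (n choose k) * a k (Suc n - k)) + (\<Sum>k\<le>n. of_nat (n choose k) * a (Suc k) (n - k))"
    by (rule rearr)
  also have "(\<Sum>k\<le>Suc n. of_nat (n choose k) * a k (Suc n - k)) = (\<Sum>k\<le>n. of_nat (n choose k) * a k (Suc (n - k)))"
    by (simp add: Suc_diff_le binomial_eq_0)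
  finally show ?thesis by (simp add: algebra_simps sum.distrib)
qed

lemma ennreal_Cauchy_product:
  fixes a :: "nat \<Rightarrow> nat \<Rightarrow> ennreal"
  shows "(\<Sum>n. \<Sum>k\<le>n. a k (n - k)) = (\<Sum>k. \<Sum>m. a k m)"
proof -
  have "(\<Sum>n. \<Sum>k\<le>n. a k (n - k)) = (\<Sum>n. \<Sum>k. if k \<le> n then a k (n - k) else 0)"
  proof (intro suminf_cong)
    fix n
    have "(\<Sum>k. if k \<le> n then a k (n - k) else 0) = (\<Sum>k\<le>n. if k \<le> n then a k (n - k) else 0)"
      by (rule suminf_finite) auto
    then show "(\<Sum>k\<le>n. a k (n - k)) = (\<Sum>k. if k \<le> n then a k (n - k) else 0)" by simp
  qed
  also have "\<dots> = (\<integral>\<^sup>+n. (\<Sum>k. if k \<le> n then a k (n - k) else 0) \<partial>count_space UNIV)"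
    by (simp add: nn_integral_count_space_nat)
  also have "\<dots> = (\<Sum>k. \<integral>\<^sup>+n. (if k \<le> n then a k (n - k) else 0) \<partial>count_space UNIV)"
    by (rule nn_integral_suminf) simp
  also have "\<dots> = (\<Sum>k n. if k \<le> n then a k (n - k) else 0)"
    by (simp add: nn_integral_count_space_nat)
  also have "\<dots> = (\<Sum>k. \<Sum>m. a k m)"
  proof (rule suminf_cong)
    fix k
    have "(\<Sum>n. if k \<le> n then a k (n - k) else 0) = (\<Sum>m. if k \<le> m + k then a k (m + k - k) else 0)"
      by (subst suminf_offset[where i=k]) auto
    then show "(\<Sum>n. if k \<le> n then a k (n - k) else 0) = (\<Sum>m. a k m)" by simp
  qed
  finally show ?thesis .
qed

locale pat_space = sigma_finite_measure S for S :: "'p measure" +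
  fixes loc :: "'p \<Rightarrow> 'l::euclidean_space"
  assumes loc_measurable [measurable]: "loc \<in> borel_measurable S"
begin

abbreviation "PS \<equiv> patterns loc S"
abbreviation "PI \<equiv> pat_integral loc S"

lemma measurable_singleton_PS [measurable (raw)]: "f \<in> measurable M S \<Longrightarrow> (\<lambda>a. {f a}) \<in> measurable M PS"
  by (rule measurable_compose[OF _ measurable_singleton_pattern])

lemma add_pt_eq: "add_pt loc x F y = (if loc x \<in> loc ` y then 0 else F (pat_union loc {x} y))"
  by (auto simp: add_pt_def pat_union_def)

lemma measurable_add_pt [measurable (raw)]:
  assumes F: "(\<lambda>(a, y). F a y) \<in> borel_measurable (M \<Otimes>\<^sub>M PS)" and [measurable]: "X \<in> measurable M S" "Y \<in> measurable M PS"
  shows "(\<lambda>a. add_pt loc (X a) (F a) (Y a)) \<in> borel_measurable M"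
proof -
  have "(\<lambda>a. F a (pat_union loc {X a} (Y a))) \<in> borel_measurable M"
    using measurable_compose[OF measurable_Pair[OF measurable_ident] F,
       of "\<lambda>a. pat_union loc {X a} (Y a)"] by simp
  then show ?thesis unfolding add_pt_eq by measurable
qed

text \<open>The pattern \<open>z\<close> of the points already chosen is carried along because the parameter space \<open>M\<close>
  cannot change its type in the induction.\<close>

lemma measurable_PI_aux:
  assumes A[measurable]: "A \<in> sets S" and F[measurable]: "case_prod F \<in> borel_measurable (M \<Otimes>\<^sub>M PS)"
  shows "(\<lambda>(a, z). PI A n (\<lambda>y. if loc ` z \<inter> loc ` y = {} then F a (z \<union> y) else 0)) \<in> borel_measurable (M \<Otimes>\<^sub>M PS)"
proof (induction n)
  case 0
  have "(\<lambda>(a, z). F a z) \<in> borel_measurable (M \<Otimes>\<^sub>M PS)" by (rule F)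
  then show ?case by simp
next
  case (Suc n)
  let ?G = "\<lambda>n a z. PI A n (\<lambda>y. if loc ` z \<inter> loc ` y = {} then F a (z \<union> y) else 0)"
  have [measurable]: "(\<lambda>b. ?G n (f b) (g b)) \<in> borel_measurable N"
    if "f \<in> measurable N M" "g \<in> measurable N PS" for f g and N :: "(('a \<times> 'p set) \<times> 'p) measure"
    using measurable_compose[OF measurable_Pair[OF that] Suc] by simp
  \<comment> \<open>The point \<open>x\<close> integrated at this stage is moved into the pattern
    carried along. If it collides with that pattern, both sides are 0 by the disjointness
    condition.\<close>
  have "(\<lambda>az. \<integral>\<^sup>+x. indicator A x * (if loc x \<in> loc ` snd az then 0 else ?G n (fst az) (pat_union loc {x} (snd az))) \<partial>S)
      \<in> borel_measurable (M \<Otimes>\<^sub>M PS)" by measurable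
  also have "?this \<longleftrightarrow> (\<lambda>az. ?G (Suc n) (fst az) (snd az)) \<in> borel_measurable (M \<Otimes>\<^sub>M PS)"
    unfolding pat_integral.simps
  proof (intro measurable_cong nn_integral_cong arg_cong2[where f="(*)"] refl)
    fix x az
    show "(if loc x \<in> loc ` snd az then 0 else ?G n (fst az) (pat_union loc {x} (snd az))) =
      PI A n (add_pt loc x (\<lambda>y. if loc ` snd az \<inter> loc ` y = {} then F (fst az) (snd az \<union> y) else 0))"
    proof (cases "loc x \<in> loc ` snd az")
      case True
      then have "add_pt loc x (\<lambda>y. if loc ` snd az \<inter> loc ` y = {} then F (fst az) (snd az \<union> y) else 0) = (\<lambda>_. 0)"
        by (auto simp: add_pt_def fun_eq_iff)
      then show ?thesis using True by simp
    next
      case False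
      then have *: "pat_union loc {x} (snd az) = insert x (snd az)" by (auto simp: pat_union_def)
      show ?thesis unfolding * using False
        by (auto simp: add_pt_def intro!: arg_cong[where f="PI A n"])
    qed
  qed
  finally show ?case by (simp add: split_beta')
qed

lemma measurable_PI [measurable (raw)]:
  assumes "A \<in> sets S" and "case_prod F \<in> borel_measurable (M \<Otimes>\<^sub>M PS)"
  shows "(\<lambda>a. PI A n (F a)) \<in> borel_measurable M"
proof -
  have "(\<lambda>a. (a, {})) \<in> measurable M (M \<Otimes>\<^sub>M PS)" by simp
  from measurable_compose[OF this measurable_PI_aux[OF assms]] show ?thesis by simp
qed

lemma measurable_pat_total [measurable (raw)]:
  assumes [measurable]: "A \<in> sets S" "case_prod F \<in> borel_measurable (M \<Otimes>\<^sub>M PS)"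
  shows "(\<lambda>a. pat_total loc S A (F a)) \<in> borel_measurable M"
  unfolding pat_total_def by measurable

text \<open>Tonelli, applied once per point. With counting measure for \<open>M\<close> it yields
  additivity over series, and with \<open>S\<close> itself it moves a single point past the integral
  over a pattern.\<close>

lemma PI_swap:
  assumes A[measurable]: "A \<in> sets S" and M: "sigma_finite_measure M"
    and F: "case_prod F \<in> borel_measurable (M \<Otimes>\<^sub>M PS)"
  shows "(\<integral>\<^sup>+a. PI A n (F a) \<partial>M) = PI A n (\<lambda>y. \<integral>\<^sup>+a. F a y \<partial>M)"
  using F
proof (induction n arbitrary: F)
  case (Suc n)
  note [measurable] = Suc.prems
  interpret M: sigma_finite_measure M by fact
  interpret pair_sigma_finite M S ..
  have m: "(\<lambda>(a, x). indicator A x * PI A n (add_pt loc x (F a))) \<in> borel_measurable (M \<Otimes>\<^sub>M S)"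
    by measurable
  have "(\<integral>\<^sup>+a. PI A (Suc n) (F a) \<partial>M) = (\<integral>\<^sup>+x. \<integral>\<^sup>+a. indicator A x * PI A n (add_pt loc x (F a)) \<partial>M \<partial>S)"
    using Fubini'[OF m] by simp
  also have "\<dots> = (\<integral>\<^sup>+x. indicator A x * PI A n (add_pt loc x (\<lambda>y. \<integral>\<^sup>+a. F a y \<partial>M)) \<partial>S)"
  proof (intro nn_integral_cong)
    fix x assume x[measurable]: "x \<in> space S"
    have m: "case_prod (\<lambda>a. add_pt loc x (F a)) \<in> borel_measurable (M \<Otimes>\<^sub>M PS)"
      by measurable
    have "(\<integral>\<^sup>+a. indicator A x * PI A n (add_pt loc x (F a)) \<partial>M) = indicator A x * PI A n (\<lambda>y. \<integral>\<^sup>+a. add_pt loc x (F a) y \<partial>M)"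
      by (subst nn_integral_cmult) (use m in \<open>simp_all add: Suc.IH\<close>)
    also have "(\<lambda>y. \<integral>\<^sup>+a. add_pt loc x (F a) y \<partial>M) = add_pt loc x (\<lambda>y. \<integral>\<^sup>+a. F a y \<partial>M)"
      by (auto simp: add_pt_def fun_eq_iff)
    finally show "(\<integral>\<^sup>+a. indicator A x * PI A n (add_pt loc x (F a)) \<partial>M) =
       indicator A x * PI A n (add_pt loc x (\<lambda>y. \<integral>\<^sup>+a. F a y \<partial>M))" .
  qed
  finally show ?case by simp
qed simp

lemma PI_cmult:
  assumes A[measurable]: "A \<in> sets S" and F: "F \<in> borel_measurable PS"
  shows "PI A n (\<lambda>y. c * F y) = c * PI A n F"
  using F
proof (induction n arbitrary: F)
  case (Suc n)
  note [measurable] = Suc.prems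
  have "PI A n (add_pt loc x (\<lambda>y. c * F y)) = c * PI A n (add_pt loc x F)" if [measurable]: "x \<in> space S" for x
  proof -
    have "add_pt loc x (\<lambda>y. c * F y) = (\<lambda>y. c * add_pt loc x F y)"
      by (auto simp: add_pt_def)
    moreover have "add_pt loc x F \<in> borel_measurable PS" by measurable
    ultimately show ?thesis by (simp add: Suc.IH)
  qed
  then have "PI A (Suc n) (\<lambda>y. c * F y) = (\<integral>\<^sup>+x. c * (indicator A x * PI A n (add_pt loc x F)) \<partial>S)"
    by (auto intro!: nn_integral_cong simp: ac_simps)
  also have "\<dots> = c * PI A (Suc n) F"
    by (simp add: nn_integral_cmult)
  finally show ?case .
qed simp

lemma PI_suminf:
  fixes F :: "nat \<Rightarrow> 'p set \<Rightarrow> ennreal"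
  assumes A[measurable]: "A \<in> sets S" and F: "\<And>i. F i \<in> borel_measurable PS"
  shows "PI A n (\<lambda>y. \<Sum>i. F i y) = (\<Sum>i. PI A n (F i))"
proof -
  have "PI A n (\<lambda>y. \<integral>\<^sup>+i. F i y \<partial>count_space UNIV) = (\<integral>\<^sup>+i. PI A n (F i) \<partial>count_space UNIV)"
  proof (rule PI_swap[symmetric, OF A])
    show "sigma_finite_measure (count_space (UNIV :: nat set))"
      by (rule sigma_finite_measure_count_space)
    show "case_prod F \<in> borel_measurable (count_space UNIV \<Otimes>\<^sub>M PS)"
      using F by (intro measurable_pair_measure_countable1) auto
  qed
  then show ?thesis by (simp add: nn_integral_count_space_nat)
qed

text \<open>The binomial coefficient counts which \<open>k\<close> of the \<open>n\<close>
  coordinates lie in \<open>A\<close>. In the induction the first coordinate lies in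
  \<open>A\<close> or in \<open>B\<close> and raises \<open>k\<close> or \<open>n - k\<close> by
  one; Pascal's rule recombines the two sums. Disjointness is required of the locations, so that
  \<open>pat_union\<close> is always the plain union.\<close>

lemma PI_superposition_aux:
  assumes A[measurable]: "A \<in> sets S" and B[measurable]: "B \<in> sets S" and F: "F \<in> borel_measurable PS"
    and disj: "loc ` A \<inter> loc ` B = {}"
  shows "PI (A \<union> B) n F = (\<Sum>k\<le>n. of_nat (n choose k) * PI A k (\<lambda>x. PI B (n - k) (\<lambda>y. F (pat_union loc x y))))"
  using F
proof (induction n arbitrary: F)
  case 0
  then show ?case by (simp add: pat_union_def)
next
  case (Suc n)
  note [measurable] = Suc.prems
  define T where "T F k m = PI A k (\<lambda>x. PI B m (\<lambda>y. F (pat_union loc x y)))" for k m F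
  have AB: "A \<inter> B = {}" using disj by auto
  have pu: "pat_union loc u v = u \<union> v" if "u \<subseteq> A" "v \<subseteq> B" for u v
  proof -
    have "loc ` u \<inter> loc ` v = {}" using disj that by blast
    then show ?thesis by (simp add: pat_union_def)
  qed
  \<comment> \<open>A first point in \<open>A\<close> belongs to the outer integral already, and it
    cannot collide with a point of \<open>B\<close>.\<close>
  have 1: "(\<integral>\<^sup>+x. indicator A x * T (add_pt loc x F) k m \<partial>S) = T F (Suc k) m" for k m
    unfolding T_def pat_integral.simps(2)
  proof (intro nn_integral_cong)
    fix x assume x: "x \<in> space S"
    show "indicator A x * PI A k (\<lambda>xa. PI B m (\<lambda>y. add_pt loc x F (pat_union loc xa y))) =
      indicator A x * PI A k (add_pt loc x (\<lambda>x. PI B m (\<lambda>y. F (pat_union loc x y))))"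
    proof (cases "x \<in> A")
      case True
      have "PI A k (\<lambda>xa. PI B m (\<lambda>y. add_pt loc x F (pat_union loc xa y))) =
        PI A k (add_pt loc x (\<lambda>x. PI B m (\<lambda>y. F (pat_union loc x y))))"
      proof (rule pat_integral_cong)
        fix u assume u: "u \<subseteq> A"
        have "PI B m (\<lambda>y. add_pt loc x F (pat_union loc u y)) =
           PI B m (\<lambda>y. if loc x \<notin> loc ` u then F (pat_union loc (insert x u) y) else 0)"
        proof (rule pat_integral_cong)
          fix v assume v: "v \<subseteq> B"
          have "loc x \<notin> loc ` v" using disj True v by auto
          then show "add_pt loc x F (pat_union loc u v) =
             (if loc x \<notin> loc ` u then F (pat_union loc (insert x u) v) else 0)"
            using u v True by (auto simp: add_pt_def pu)
        qed
        then show "PI B m (\<lambda>y. add_pt loc x F (pat_union loc u y)) = add_pt loc x (\<lambda>x. PI B m (\<lambda>y. F (pat_union loc x y))) u"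
          by (simp add: add_pt_def)
      qed
      then show ?thesis by simp
    qed simp
  qed
  \<comment> \<open>A first point in \<open>B\<close> has to pass the integral over the pattern in
    \<open>A\<close>, which is an application of \<open>PI_swap\<close>.\<close>
  have 2: "(\<integral>\<^sup>+x. indicator B x * T (add_pt loc x F) k m \<partial>S) = T F k (Suc m)" for k m
  proof -
    have [measurable]: "(\<lambda>xu. PI B m (\<lambda>v. add_pt loc (fst xu) F (pat_union loc (snd xu) v)))
        \<in> borel_measurable (S \<Otimes>\<^sub>M PS)"
      by measurable
    have m: "case_prod (\<lambda>x u. indicator B x * PI B m (\<lambda>v. add_pt loc x F (pat_union loc u v)))
        \<in> borel_measurable (S \<Otimes>\<^sub>M PS)"
      unfolding split_beta' by measurable
    have "(\<integral>\<^sup>+x. indicator B x * T (add_pt loc x F) k m \<partial>S) =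
      (\<integral>\<^sup>+x. PI A k (\<lambda>u. indicator B x * PI B m (\<lambda>v. add_pt loc x F (pat_union loc u v))) \<partial>S)"
      unfolding T_def by (intro nn_integral_cong PI_cmult[symmetric]) measurable
    also have "\<dots> = PI A k (\<lambda>u. \<integral>\<^sup>+x. indicator B x * PI B m (\<lambda>v. add_pt loc x F (pat_union loc u v)) \<partial>S)"
      using PI_swap[OF A sigma_finite_measure_axioms m] by simp
    also have "\<dots> = T F k (Suc m)"
      unfolding T_def pat_integral.simps(2)
    proof (intro pat_integral_cong nn_integral_cong)
      fix u x assume u: "u \<subseteq> A"
      show "indicator B x * PI B m (\<lambda>v. add_pt loc x F (pat_union loc u v)) =
        indicator B x * PI B m (add_pt loc x (\<lambda>y. F (pat_union loc u y)))"
      proof (cases "x \<in> B")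
        case True
        have "PI B m (\<lambda>v. add_pt loc x F (pat_union loc u v)) = PI B m (add_pt loc x (\<lambda>y. F (pat_union loc u y)))"
        proof (rule pat_integral_cong)
          fix v assume v: "v \<subseteq> B"
          have "loc x \<notin> loc ` u" using disj True u by auto
          then show "add_pt loc x F (pat_union loc u v) = add_pt loc x (\<lambda>y. F (pat_union loc u y)) v"
            using u v True by (auto simp: add_pt_def pu)
        qed
        then show ?thesis by simp
      qed simp
    qed
    finally show ?thesis .
  qed
  have Tm[measurable]: "(\<lambda>x. T (add_pt loc x F) k m) \<in> borel_measurable S" for k m
    unfolding T_def by measurable
  have "PI (A \<union> B) (Suc n) F = (\<integral>\<^sup>+x. (indicator A x + indicator B x) *
      (\<Sum>k\<le>n. of_nat (n choose k) * T (add_pt loc x F) k (n - k)) \<partial>S)"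
    unfolding pat_integral.simps(2)
  proof (intro nn_integral_cong)
    fix x assume [measurable]: "x \<in> space S"
    have "PI (A \<union> B) n (add_pt loc x F) = (\<Sum>k\<le>n. of_nat (n choose k) * T (add_pt loc x F) k (n - k))"
      unfolding T_def by (rule Suc.IH) measurable
    then show "indicator (A \<union> B) x * PI (A \<union> B) n (add_pt loc x F) =
       (indicator A x + indicator B x) * (\<Sum>k\<le>n. of_nat (n choose k) * T (add_pt loc x F) k (n - k))"
      using AB by (auto simp: indicator_def)
  qed
  also have "\<dots> = (\<integral>\<^sup>+x. (\<Sum>k\<le>n. of_nat (n choose k) * (indicator A x * T (add_pt loc x F) k (n - k))
      + of_nat (n choose k) * (indicator B x * T (add_pt loc x F) k (n - k))) \<partial>S)"
    by (intro nn_integral_cong, subst sum_distrib_left, intro sum.cong refl)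
       (simp only: distrib_right distrib_left mult.left_commute)
  also have "\<dots> = (\<Sum>k\<le>n. of_nat (n choose k) * (T F (Suc k) (n - k) + T F k (Suc (n - k))))"
    by (subst nn_integral_sum, measurable)
       (simp add: nn_integral_add nn_integral_cmult 1 2 distrib_left)
  also have "\<dots> = (\<Sum>k\<le>Suc n. of_nat (Suc n choose k) * T F k (Suc n - k))"
    by (rule sum_binomial_Suc)
  finally show ?case by (simp add: T_def)
qed

text \<open>The weights factorise, as \<open>n choose k\<close> divided by n! is 1/k! times 1/(n -
  k)!. The sum over \<open>n\<close> thus becomes a Cauchy product, and patterns on the two sets are
  integrated independently.\<close>

lemma pat_total_superposition:
  assumes A[measurable]: "A \<in> sets S" and B[measurable]: "B \<in> sets S" and F[measurable]: "F \<in> borel_measurable PS"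
    and disj: "loc ` A \<inter> loc ` B = {}"
  shows "pat_total loc S (A \<union> B) F = pat_total loc S A (\<lambda>x. pat_total loc S B (\<lambda>y. F (pat_union loc x y)))"
proof -
  let ?T = "\<lambda>k m. PI A k (\<lambda>x. PI B m (\<lambda>y. F (pat_union loc x y)))"
  let ?a = "\<lambda>k m. ennreal (1 / fact k) * (ennreal (1 / fact m) * ?T k m)"
  have "pat_total loc S (A \<union> B) F = (\<Sum>n. \<Sum>k\<le>n. ?a k (n - k))"
    unfolding pat_total_def
  proof (intro suminf_cong)
    fix n
    have "ennreal (1 / fact n) * (of_nat (n choose k) * t) = ennreal (1 / fact k) * (ennreal (1 / fact (n - k)) * t)"
      if "k \<le> n" for k t
    proof -
      have "ennreal (1 / fact n) * of_nat (n choose k) = ennreal (1 / fact k * (1 / fact (n - k)))"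
        using that by (simp add: ennreal_of_nat_eq_real_of_nat ennreal_mult[symmetric] binomial_fact field_simps)
      also have "\<dots> = ennreal (1 / fact k) * ennreal (1 / fact (n - k))"
        by (rule ennreal_mult) auto
      finally show ?thesis by (simp only: mult.assoc[symmetric])
    qed
    then show "ennreal (1 / fact n) * PI (A \<union> B) n F = (\<Sum>k\<le>n. ?a k (n - k))"
      unfolding PI_superposition_aux[OF assms] sum_distrib_left by (intro sum.cong) auto
  qed
  also have "\<dots> = (\<Sum>k. \<Sum>m. ?a k m)" by (rule ennreal_Cauchy_product)
  also have "\<dots> = (\<Sum>k. ennreal (1 / fact k) * (\<Sum>m. ennreal (1 / fact m) * ?T k m))"
    by simp
  also have "\<dots> = pat_total loc S A (\<lambda>x. pat_total loc S B (\<lambda>y. F (pat_union loc x y)))"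
    unfolding pat_total_def by (simp add: PI_suminf PI_cmult)
  finally show ?thesis .
qed

lemma pat_total_cong:
  assumes "\<And>y. y \<in> space PS \<Longrightarrow> y \<subseteq> A \<Longrightarrow> F y = G y"
  shows "pat_total loc S A F = pat_total loc S A G"
  unfolding pat_total_def by (intro suminf_cong arg_cong2[where f="(*)"] refl pat_integral_cong assms)

lemma pat_total_cmult:
  assumes "A \<in> sets S" "F \<in> borel_measurable PS"
  shows "pat_total loc S A (\<lambda>y. c * F y) = c * pat_total loc S A F"
  unfolding pat_total_def by (simp add: PI_cmult[OF assms] mult.left_commute)

end

lemma measurable_pattern_Ball [measurable (raw)]:
  assumes R[measurable]: "Measurable.pred (M \<Otimes>\<^sub>M S) (case_prod R)" and Y[measurable]: "Y \<in> measurable M (patterns loc S)"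
  shows "Measurable.pred M (\<lambda>a. \<forall>p\<in>Y a. R a p)"
proof -
  have "Measurable.pred M (\<lambda>a. card {p \<in> Y a. \<not> R a p} = 0)" by measurable
  also have "?this \<longleftrightarrow> ?thesis"
    using measurable_space[OF Y] finite_patterns by (intro measurable_cong) fastforce
  finally show ?thesis .
qed

context pat_space
begin

lemma PI_add:
  assumes A[measurable]: "A \<in> sets S" and F: "F \<in> borel_measurable PS" and G: "G \<in> borel_measurable PS"
  shows "PI A n (\<lambda>y. F y + G y) = PI A n F + PI A n G"
  using F G
proof (induction n arbitrary: F G)
  case (Suc n)
  note [measurable] = Suc.prems
  have "PI A n (add_pt loc x (\<lambda>y. F y + G y)) = PI A n (add_pt loc x F) + PI A n (add_pt loc x G)"
    if [measurable]: "x \<in> space S" for x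
  proof -
    have "add_pt loc x (\<lambda>y. F y + G y) = (\<lambda>y. add_pt loc x F y + add_pt loc x G y)"
      by (auto simp: add_pt_def)
    moreover have "add_pt loc x F \<in> borel_measurable PS" "add_pt loc x G \<in> borel_measurable PS" by measurable
    ultimately show ?thesis by (simp add: Suc.IH)
  qed
  then have "PI A (Suc n) (\<lambda>y. F y + G y) =
      (\<integral>\<^sup>+x. indicator A x * PI A n (add_pt loc x F) + indicator A x * PI A n (add_pt loc x G) \<partial>S)"
    by (auto intro!: nn_integral_cong simp: distrib_left)
  also have "\<dots> = PI A (Suc n) F + PI A (Suc n) G"
    by (simp add: nn_integral_add)
  finally show ?case .
qed simp

section \<open>Integrals over tuples and integrals over patterns\<close>

lemma measurable_PiM_inj:
  assumes I[simp]: "finite I"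
  shows "Measurable.pred (PiM I (\<lambda>_. S)) (\<lambda>xs. inj_on (\<lambda>i. loc (xs i)) I)"
proof -
  have [measurable]: "Measurable.pred (PiM I (\<lambda>_. S)) (\<lambda>xs. loc (xs i) = loc (xs j))" if "i \<in> I" "j \<in> I" for i j
    using that unfolding pred_def by (intro measurable_equality_set) measurable
  show ?thesis unfolding inj_on_def by measurable
qed

lemma measurable_PiM_pattern:
  assumes I: "finite I"
  shows "(\<lambda>xs. if inj_on (\<lambda>i. loc (xs i)) I then xs ` I else {}) \<in> measurable (PiM I (\<lambda>_. S)) PS"
proof (rule measurable_patternsI)
  fix xs assume "xs \<in> space (PiM I (\<lambda>_. S))"
  then show "(if inj_on (\<lambda>i. loc (xs i)) I then xs ` I else {}) \<in> space PS"
    using I by (auto simp: space_patterns space_PiM PiE_iff inj_on_def)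
next
  fix A assume [measurable]: "A \<in> sets S"
  note I[simp] and measurable_PiM_inj[OF I, unfolded inj_on_def, measurable]
  have "(\<lambda>xs. if \<forall>i\<in>I. \<forall>j\<in>I. loc (xs i) = loc (xs j) \<longrightarrow> i = j then \<Sum>i\<in>I. if xs i \<in> A then 1 else 0 else 0)
     \<in> measurable (PiM I (\<lambda>_. S)) (count_space (UNIV :: nat set))"
    by measurable
  also have "(\<lambda>xs. if \<forall>i\<in>I. \<forall>j\<in>I. loc (xs i) = loc (xs j) \<longrightarrow> i = j then \<Sum>i\<in>I. if xs i \<in> A then 1 else 0 else 0 :: nat)
    = (\<lambda>xs. card ((if inj_on (\<lambda>i. loc (xs i)) I then xs ` I else {}) \<inter> A))"
  proof
    fix xs
    have "(\<Sum>i\<in>I. if xs i \<in> A then 1 else 0 :: nat) = card (xs ` I \<inter> A)" if "inj_on (\<lambda>i. loc (xs i)) I"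
    proof -
      have "inj_on xs {i \<in> I. xs i \<in> A}" using that by (auto simp: inj_on_def)
      then have "card (xs ` {i \<in> I. xs i \<in> A}) = card {i \<in> I. xs i \<in> A}" by (rule card_image)
      moreover have "xs ` {i \<in> I. xs i \<in> A} = xs ` I \<inter> A" by auto
      ultimately show ?thesis by (simp flip: sum.inter_filter)
    qed
    then show "(if \<forall>i\<in>I. \<forall>j\<in>I. loc (xs i) = loc (xs j) \<longrightarrow> i = j then \<Sum>i\<in>I. if xs i \<in> A then 1 else 0 else 0) =
      card ((if inj_on (\<lambda>i. loc (xs i)) I then xs ` I else {}) \<inter> A)"
      by (auto simp: inj_on_def)
  qed
  finally show "(\<lambda>xs. card ((if inj_on (\<lambda>i. loc (xs i)) I then xs ` I else {}) \<inter> A))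
     \<in> measurable (PiM I (\<lambda>_. S)) (count_space UNIV)" .
qed

text \<open>The outermost point of the recursion is the coordinate with index \<open>n\<close>,
  split off from \<open>{..<Suc n}\<close>. Restricting to injective tuples matches the zero in
  \<open>add_pt\<close>.\<close>

lemma PiM_integral_eq_PI:
  assumes F: "F \<in> borel_measurable PS"
  shows "(\<integral>\<^sup>+xs. (if inj_on (\<lambda>i. loc (xs i)) {..<n} then F (xs ` {..<n}) else 0) \<partial>PiM {..<n} (\<lambda>_. S)) =
    PI (space S) n F"
  using F
proof (induction n arbitrary: F)
  case 0
  interpret product_sigma_finite "\<lambda>_::nat. S" ..
  show ?case by (simp add: PiM_empty nn_integral_count_space_finite)
next
  case (Suc n)
  note [measurable] = Suc.prems
  interpret product_sigma_finite "\<lambda>_::nat. S" ..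
  let ?f = "\<lambda>xs. if inj_on (\<lambda>i. loc (xs i)) {..<Suc n} then F (xs ` {..<Suc n}) else 0"
  have "(\<lambda>xs. if inj_on (\<lambda>i. loc (xs i)) {..<Suc n} then
      F (if inj_on (\<lambda>i. loc (xs i)) {..<Suc n} then xs ` {..<Suc n} else {}) else 0)
    \<in> borel_measurable (PiM {..<Suc n} (\<lambda>_. S))"
    by (intro measurable_If measurable_compose[OF measurable_PiM_pattern Suc.prems] measurable_PiM_inj[unfolded pred_def]) auto
  then have "?f \<in> borel_measurable (PiM {..<Suc n} (\<lambda>_. S))"
    by (simp cong: if_cong)
  then have m: "?f \<in> borel_measurable (PiM (insert n {..<n}) (\<lambda>_. S))"
    by (simp only: lessThan_Suc)
  have "(\<integral>\<^sup>+xs. ?f xs \<partial>PiM {..<Suc n} (\<lambda>_. S)) = (\<integral>\<^sup>+y. \<integral>\<^sup>+xs. ?f (xs(n := y)) \<partial>PiM {..<n} (\<lambda>_. S) \<partial>S)"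
    unfolding lessThan_Suc[of n] by (rule product_nn_integral_insert_rev) (use m in \<open>simp_all only: lessThan_Suc, simp_all\<close>)
  also have "\<dots> = (\<integral>\<^sup>+y. indicator (space S) y * PI (space S) n (add_pt loc y F) \<partial>S)"
  proof (rule nn_integral_cong)
    fix y assume y[measurable]: "y \<in> space S"
    have "?f (xs(n := y)) = (if inj_on (\<lambda>i. loc (xs i)) {..<n} then add_pt loc y F (xs ` {..<n}) else 0)" for xs
    proof -
      have "inj_on (\<lambda>i. loc ((xs(n := y)) i)) {..<Suc n} \<longleftrightarrow>
          inj_on (\<lambda>i. loc (xs i)) {..<n} \<and> loc y \<notin> loc ` xs ` {..<n}"
        unfolding lessThan_Suc inj_on_insert by (auto simp: inj_on_def image_iff)
      moreover have "(xs(n := y)) ` {..<Suc n} = insert y (xs ` {..<n})"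
        by (auto simp: lessThan_Suc)
      ultimately show ?thesis by (simp add: add_pt_def)
    qed
    then have "(\<integral>\<^sup>+xs. ?f (xs(n := y)) \<partial>PiM {..<n} (\<lambda>_. S)) =
       (\<integral>\<^sup>+xs. (if inj_on (\<lambda>i. loc (xs i)) {..<n} then add_pt loc y F (xs ` {..<n}) else 0) \<partial>PiM {..<n} (\<lambda>_. S))"
      by simp
    also have "\<dots> = PI (space S) n (add_pt loc y F)"
      by (rule Suc.IH) measurable
    finally show "(\<integral>\<^sup>+xs. ?f (xs(n := y)) \<partial>PiM {..<n} (\<lambda>_. S)) =
        indicator (space S) y * PI (space S) n (add_pt loc y F)" using y by simp
  qed
  finally show ?case by simp
qed

text \<open>Once the first coordinates have distinct locations, the next one only has to avoid
  finitely many null sets; Tonelli turns this into a statement about the product.\<close>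

lemma AE_PiM_inj:
  fixes n :: nat
  assumes diffuse: "\<And>c. AE x in S. loc x \<noteq> c"
  shows "AE xs in PiM {..<n} (\<lambda>_. S). inj_on (\<lambda>i. loc (xs i)) {..<n}"
proof (induction n)
  case (Suc n)
  interpret product_sigma_finite "\<lambda>_::nat. S" ..
  let ?g = "\<lambda>(n::nat) xs. (if inj_on (\<lambda>i. loc (xs i)) {..<n} then 0 else 1 :: ennreal)"
  have [measurable]: "?g n \<in> borel_measurable (PiM {..<n} (\<lambda>_. S))" for n
    by (intro measurable_If measurable_PiM_inj[unfolded pred_def]) auto
  have m: "?g (Suc n) \<in> borel_measurable (PiM (insert n {..<n}) (\<lambda>_. S))"
    unfolding lessThan_Suc[symmetric] by measurable
  have "(\<integral>\<^sup>+xs. ?g (Suc n) xs \<partial>PiM {..<Suc n} (\<lambda>_. S)) =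
      (\<integral>\<^sup>+xs. \<integral>\<^sup>+y. ?g (Suc n) (xs(n := y)) \<partial>S \<partial>PiM {..<n} (\<lambda>_. S))"
    unfolding lessThan_Suc[of n] by (rule product_nn_integral_insert) (use m in \<open>simp_all only: lessThan_Suc, simp_all\<close>)
  also have "\<dots> = (\<integral>\<^sup>+xs. 0 \<partial>PiM {..<n} (\<lambda>_. S))"
  proof (rule nn_integral_cong_AE, use Suc in eventually_elim)
    fix xs assume inj: "inj_on (\<lambda>i. loc (xs i)) {..<n}"
    have "AE y in S. \<forall>i\<in>{..<n}. loc y \<noteq> loc (xs i)"
      using diffuse by (intro AE_finite_allI) auto
    then have "AE y in S. ?g (Suc n) (xs(n := y)) = 0"
    proof eventually_elim
      case (elim y)
      then have "inj_on (\<lambda>i. loc ((xs(n := y)) i)) {..<Suc n}"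
        using inj unfolding lessThan_Suc inj_on_insert by (auto simp: inj_on_def)
      then show ?case by simp
    qed
    then have "(\<integral>\<^sup>+y. ?g (Suc n) (xs(n := y)) \<partial>S) = (\<integral>\<^sup>+y. 0 \<partial>S)" by (rule nn_integral_cong_AE)
    then show "(\<integral>\<^sup>+y. ?g (Suc n) (xs(n := y)) \<partial>S) = 0" by simp
  qed
  finally have "(\<integral>\<^sup>+xs. ?g (Suc n) xs \<partial>PiM {..<Suc n} (\<lambda>_. S)) = 0" by simp
  then have "AE xs in PiM {..<Suc n} (\<lambda>_. S). ?g (Suc n) xs = 0"
    by (subst (asm) nn_integral_0_iff_AE) measurable
  then show ?case by eventually_elim (auto split: if_splits)
qed simp

text \<open>Diffuseness enters through this bridge: \<open>janossy_density\<close> integrates over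
  all tuples, including those with coinciding locations, on which the pattern integral is 0 by
  convention.\<close>

lemma janossy_sum_eq_pat_total:
  assumes diffuse: "\<And>c. AE x in S. loc x \<noteq> c" and F: "F \<in> borel_measurable PS"
  shows "(\<Sum>n. ennreal (1 / fact n) * (\<integral>\<^sup>+xs. F (xs ` {..<n}) \<partial>PiM {..<n} (\<lambda>_. S))) = pat_total loc S (space S) F"
  unfolding pat_total_def PiM_integral_eq_PI[OF F, symmetric]
proof (intro suminf_cong arg_cong2[where f="(*)"] refl nn_integral_cong_AE)
  fix n :: nat
  show "AE xs in PiM {..<n} (\<lambda>_. S). F (xs ` {..<n}) =
    (if inj_on (\<lambda>i. loc (xs i)) {..<n} then F (xs ` {..<n}) else 0)"
    using AE_PiM_inj[OF diffuse] by eventually_elim auto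
qed

end

text \<open>Serves to pass from a segment to its time axis. The assumption \<open>int\<close> is the
  change of variables for one point and \<open>inj\<close> says that collisions are preserved;
  induction gives the change of variables for \<open>n\<close> points.\<close>

lemma pat_integral_transport:
  fixes loc :: "'p \<Rightarrow> 'l::euclidean_space" and tloc :: "'r \<Rightarrow> 'k::euclidean_space"
  assumes "pat_space S loc" and T: "pat_space T tloc"
    and e[measurable]: "e \<in> measurable T S" and A[measurable]: "A \<in> sets S"
    and inj: "\<And>r r'. r \<in> space T \<Longrightarrow> r' \<in> space T \<Longrightarrow> loc (e r) = loc (e r') \<longleftrightarrow> tloc r = tloc r'"
    and int: "\<And>F. F \<in> borel_measurable S \<Longrightarrow> (\<integral>\<^sup>+x. indicator A x * F x \<partial>S) = (\<integral>\<^sup>+r. F (e r) \<partial>T)"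
    and F: "F \<in> borel_measurable (patterns loc S)"
  shows "pat_integral loc S A n F = pat_integral tloc T (space T) n (\<lambda>y. F (e ` y))"
  using F
proof (induction n arbitrary: F)
  case (Suc n)
  interpret S: pat_space S loc by fact
  note [measurable] = Suc.prems
  have "pat_integral loc S A (Suc n) F = (\<integral>\<^sup>+r. pat_integral loc S A n (add_pt loc (e r) F) \<partial>T)"
    unfolding pat_integral.simps by (rule int) measurable
  also have "\<dots> = (\<integral>\<^sup>+r. indicator (space T) r * pat_integral tloc T (space T) n (add_pt tloc r (\<lambda>y. F (e ` y))) \<partial>T)"
  proof (rule nn_integral_cong)
    fix r assume r[measurable]: "r \<in> space T"
    have "pat_integral loc S A n (add_pt loc (e r) F) = pat_integral tloc T (space T) n (\<lambda>y. add_pt loc (e r) F (e ` y))"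
      by (rule Suc.IH) measurable
    also have "\<dots> = pat_integral tloc T (space T) n (add_pt tloc r (\<lambda>y. F (e ` y)))"
    proof (rule pat_integral_cong)
      fix y assume "y \<subseteq> space T"
      then have "loc (e r) \<in> loc ` e ` y \<longleftrightarrow> tloc r \<in> tloc ` y" using inj r by (force simp: image_iff)
      then show "add_pt loc (e r) F (e ` y) = add_pt tloc r (\<lambda>y. F (e ` y)) y"
        by (simp add: add_pt_def)
    qed
    finally show "pat_integral loc S A n (add_pt loc (e r) F) =
      indicator (space T) r * pat_integral tloc T (space T) n (add_pt tloc r (\<lambda>y. F (e ` y)))"
      using r by simp
  qed
  finally show ?case by simp
qed simp

section \<open>The last point of a pattern on the line\<close>

definition top_pt :: "('p \<Rightarrow> real) \<Rightarrow> 'p \<Rightarrow> ('p set \<Rightarrow> ennreal) \<Rightarrow> 'p set \<Rightarrow> ennreal" where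
  "top_pt loc x G h = (if \<forall>q\<in>h. loc q < loc x then G (insert x h) else 0)"

locale line_space = pat_space S loc for S :: "'p measure" and loc :: "'p \<Rightarrow> real"
begin

lemma top_pt_add_pt: "top_pt loc x G h = (if \<forall>q\<in>h. loc q < loc x then add_pt loc x G h else 0)"
  by (force simp: top_pt_def add_pt_def)

lemma measurable_top_pt [measurable (raw)]:
  assumes F[measurable]: "(\<lambda>(a, y). F a y) \<in> borel_measurable (M \<Otimes>\<^sub>M PS)" and [measurable]: "X \<in> measurable M S" "Y \<in> measurable M PS"
  shows "(\<lambda>a. top_pt loc (X a) (F a) (Y a)) \<in> borel_measurable M"
  unfolding top_pt_add_pt by measurable

text \<open>Symmetry of the product measure, proved without permutations. Peel off a point
  \<open>x\<close> and let \<open>p\<close> be the last of the remaining ones. If \<open>p\<close>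
  lies after \<open>x\<close> it is last overall (\<open>U\<close>), otherwise \<open>x\<close> is
  (\<open>V\<close>). The case \<open>U\<close> carries the factor of the induction hypothesis and
  \<open>V\<close> contributes once more, which raises the factor by one.\<close>

lemma PI_last_point:
  assumes A[measurable]: "A \<in> sets S" and G: "G \<in> borel_measurable PS"
  shows "PI A (Suc n) G = of_nat (Suc n) * (\<integral>\<^sup>+x. indicator A x * PI A n (top_pt loc x G) \<partial>S)"
  using G
proof (induction n arbitrary: G)
  case 0
  then show ?case by (simp add: top_pt_def add_pt_def)
next
  case (Suc n)
  note [measurable] = Suc.prems
  interpret SS: pair_sigma_finite S S ..
  let ?c = "of_nat (Suc n) :: ennreal"
  define U where "U x p = PI A n (add_pt loc x (top_pt loc p G))" for x p
  define V where "V x p = PI A n (top_pt loc p (top_pt loc x G))" for x p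
  have [measurable]: "case_prod U \<in> borel_measurable (S \<Otimes>\<^sub>M S)" "case_prod V \<in> borel_measurable (S \<Otimes>\<^sub>M S)"
    unfolding U_def V_def by measurable
  \<comment> \<open>Ties between \<open>x\<close> and \<open>p\<close> contribute 0 on both sides,
    so the two strict orders exhaust the integral.\<close>
  have split: "PI A n (top_pt loc p (add_pt loc x G)) = U x p + V x p"
    if [measurable]: "x \<in> space S" "p \<in> space S" for x p
  proof -
    have "top_pt loc p (add_pt loc x G) = (\<lambda>h. add_pt loc x (top_pt loc p G) h + top_pt loc p (top_pt loc x G) h)"
    proof
      fix h
      consider "loc x < loc p" | "loc x = loc p" | "loc p < loc x" by linarith
      then show "top_pt loc p (add_pt loc x G) h = add_pt loc x (top_pt loc p G) h + top_pt loc p (top_pt loc x G) h"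
        by cases (force simp: top_pt_def add_pt_def insert_commute)+
    qed
    then show ?thesis
      unfolding U_def V_def by (simp add: PI_add)
  qed
  have "PI A (Suc (Suc n)) G = (\<integral>\<^sup>+x. indicator A x * (?c * (\<integral>\<^sup>+p. indicator A p * PI A n (top_pt loc p (add_pt loc x G)) \<partial>S)) \<partial>S)"
    unfolding pat_integral.simps(2)[of loc S A "Suc n"]
    by (intro nn_integral_cong arg_cong2[where f="(*)"] refl Suc.IH) measurable
  also have "\<dots> = (\<integral>\<^sup>+x. indicator A x * (?c * (\<integral>\<^sup>+p. indicator A p * (U x p + V x p) \<partial>S)) \<partial>S)"
    by (intro nn_integral_cong arg_cong2[where f="(*)"] refl split)
  also have "\<dots> = (\<integral>\<^sup>+x. ?c * (\<integral>\<^sup>+p. indicator A x * indicator A p * U x p \<partial>S) + indicator A x * (?c * (\<integral>\<^sup>+p. indicator A p * V x p \<partial>S)) \<partial>S)"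
    by (intro nn_integral_cong) (simp add: nn_integral_add nn_integral_cmult distrib_left ac_simps)
  also have "\<dots> = ?c * (\<integral>\<^sup>+x. \<integral>\<^sup>+p. indicator A x * indicator A p * U x p \<partial>S \<partial>S) + 
     (\<integral>\<^sup>+x. indicator A x * (?c * (\<integral>\<^sup>+p. indicator A p * V x p \<partial>S)) \<partial>S)"
    by (simp add: nn_integral_add nn_integral_cmult)
  \<comment> \<open>The induction hypothesis for \<open>top_pt loc x G\<close>, read from right to
    left; it absorbs the factor \<open>?c\<close>.\<close>
  also have "(\<integral>\<^sup>+x. indicator A x * (?c * (\<integral>\<^sup>+p. indicator A p * V x p \<partial>S)) \<partial>S) = 
     (\<integral>\<^sup>+x. indicator A x * PI A (Suc n) (top_pt loc x G) \<partial>S)"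
    unfolding V_def
    by (intro nn_integral_cong arg_cong2[where f="(*)"] refl Suc.IH[symmetric]) measurable
  also have "(\<integral>\<^sup>+x. \<integral>\<^sup>+p. indicator A x * indicator A p * U x p \<partial>S \<partial>S) =
     (\<integral>\<^sup>+p. \<integral>\<^sup>+x. indicator A x * indicator A p * U x p \<partial>S \<partial>S)"
    by (rule SS.Fubini') measurable
  also have "\<dots> = (\<integral>\<^sup>+p. indicator A p * PI A (Suc n) (top_pt loc p G) \<partial>S)"
    unfolding pat_integral.simps(2) U_def[symmetric]
    by (intro nn_integral_cong) (simp add: nn_integral_cmult[symmetric] ac_simps)
  finally show ?case
    by (simp add: distrib_right)
qed

end

section \<open>Conditional laws and hazard rates\<close>

text \<open>With the whole space for \<open>A\<close>, the defining equation exhibits 1 and the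
  total mass of \<open>K h\<close> as two densities of the law of \<open>H\<close>, and densities
  are unique almost everywhere. Finite measures are allowed because the law of a mark is conditioned
  on the event \<open>n < card y\<close>, on which the measure is not normalised.\<close>

lemma cond_law_AE_prob_space:
  assumes "finite_measure P" and K: "cond_law P H MH X MX K"
  shows "AE w in P. prob_space (K (H w))"
proof -
  interpret finite_measure P by fact
  have [measurable]: "H \<in> measurable P MH" "X \<in> measurable P MX"
    and sK: "\<And>h. h \<in> space MH \<Longrightarrow> sets (K h) = sets MX"
    and mK: "\<And>A. A \<in> sets MX \<Longrightarrow> (\<lambda>h. emeasure (K h) A) \<in> borel_measurable MH"
    and eq: "\<And>A B. A \<in> sets MX \<Longrightarrow> B \<in> sets MH \<Longrightarrow>
       emeasure P {w \<in> space P. H w \<in> B \<and> X w \<in> A} = (\<integral>\<^sup>+w. indicator B (H w) * emeasure (K (H w)) A \<partial>P)"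
    using K by (auto simp: cond_law_def)
  have [measurable]: "(\<lambda>h. emeasure (K h) (space MX)) \<in> borel_measurable MH" by (rule mK) simp
  interpret D: finite_measure "distr P MH H" by (rule finite_measure_distr) measurable
  have "AE h in distr P MH H. 1 = emeasure (K h) (space MX)"
  proof (rule D.density_unique_finite_measure)
    fix B assume "B \<in> sets (distr P MH H)"
    then have B[measurable]: "B \<in> sets MH" by simp
    have "(\<integral>\<^sup>+h. 1 * indicator B h \<partial>distr P MH H) = emeasure P (H -` B \<inter> space P)"
      by (simp add: emeasure_distr)
    also have "H -` B \<inter> space P = {w \<in> space P. H w \<in> B \<and> X w \<in> space MX}"
      using measurable_space[of X P MX] by auto
    also have "emeasure P \<dots> = (\<integral>\<^sup>+w. indicator B (H w) * emeasure (K (H w)) (space MX) \<partial>P)"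
      by (rule eq) auto
    also have "\<dots> = (\<integral>\<^sup>+h. emeasure (K h) (space MX) * indicator B h \<partial>distr P MH H)"
      by (simp add: nn_integral_distr mult.commute)
    finally show "(\<integral>\<^sup>+h. 1 * indicator B h \<partial>distr P MH H) =
      (\<integral>\<^sup>+h. emeasure (K h) (space MX) * indicator B h \<partial>distr P MH H)" .
  qed auto
  then have "AE w in P. 1 = emeasure (K (H w)) (space MX)"
    by (rule AE_distrD[rotated]) measurable
  with AE_space show ?thesis
  proof eventually_elim
    case (elim w)
    then have "H w \<in> space MH" by (auto intro: measurable_space)
    then show ?case using elim sets_eq_imp_space_eq[OF sK] by (intro prob_spaceI) simp
  qed
qed

text \<open>The measures \<open>K h\<close> are known to be probabilities only almost surely.
  Correcting them on the exceptional set gives a kernel to which \<open>bind\<close> applies, and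
  the defining equation on rectangles then extends to all integrands because rectangles determine a
  finite measure.\<close>

lemma cond_law_kernel:
  assumes "finite_measure P" and K: "cond_law P H MH X MX K" and ne: "space MX \<noteq> {}"
  obtains K' where "K' \<in> measurable MH (subprob_algebra MX)" "AE w in P. K' (H w) = K (H w)"
    "\<And>F. F \<in> borel_measurable (MH \<Otimes>\<^sub>M MX) \<Longrightarrow>
       (\<integral>\<^sup>+w. F (H w, X w) \<partial>P) = (\<integral>\<^sup>+w. \<integral>\<^sup>+y. F (H w, y) \<partial>K' (H w) \<partial>P)"
proof -
  interpret finite_measure P by fact
  have H[measurable]: "H \<in> measurable P MH" and [measurable]: "X \<in> measurable P MX"
    and sK: "\<And>h. h \<in> space MH \<Longrightarrow> sets (K h) = sets MX"
    and mK: "\<And>A. A \<in> sets MX \<Longrightarrow> (\<lambda>h. emeasure (K h) A) \<in> borel_measurable MH"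
    and eq: "\<And>A B. A \<in> sets MX \<Longrightarrow> B \<in> sets MH \<Longrightarrow>
       emeasure P {w \<in> space P. H w \<in> B \<and> X w \<in> A} = (\<integral>\<^sup>+w. indicator B (H w) * emeasure (K (H w)) A \<partial>P)"
    using K by (auto simp: cond_law_def)
  have [measurable]: "(\<lambda>h. emeasure (K h) (space MX)) \<in> borel_measurable MH" by (rule mK) simp
  \<comment> \<open>The total mass is measurable in \<open>h\<close>, so this case distinction keeps
    the kernel measurable.\<close>
  define K' where "K' h = (if emeasure (K h) (space MX) = 1 then K h else null_measure MX)" for h
  have K'[measurable]: "K' \<in> measurable MH (subprob_algebra MX)"
  proof (rule measurable_subprob_algebra)
    fix h assume "h \<in> space MH"
    then show "sets (K' h) = sets MX" using sK by (simp add: K'_def)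
    then have "space (K' h) = space MX" by (rule sets_eq_imp_space_eq)
    then show "subprob_space (K' h)" using ne
      by (intro subprob_spaceI) (auto simp: K'_def)
  next
    fix A assume [measurable]: "A \<in> sets MX"
    have [measurable]: "(\<lambda>h. emeasure (K h) A) \<in> borel_measurable MH" by (rule mK) simp
    have "(\<lambda>h. if emeasure (K h) (space MX) = 1 then emeasure (K h) A else 0) \<in> borel_measurable MH"
      by measurable
    also have "(\<lambda>h. if emeasure (K h) (space MX) = 1 then emeasure (K h) A else 0) = (\<lambda>h. emeasure (K' h) A)"
      by (auto simp: K'_def)
    finally show "(\<lambda>h. emeasure (K' h) A) \<in> borel_measurable MH" .
  qed
  have K'_eq: "AE w in P. K' (H w) = K (H w)"
    using cond_law_AE_prob_space[OF assms(1) K] AE_space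
  proof eventually_elim
    case (elim w)
    interpret prob_space "K (H w)" by (rule elim)
    have "space (K (H w)) = space MX"
      using elim by (intro sets_eq_imp_space_eq sK measurable_space[OF H]) 
    then show ?case using emeasure_space_1 by (simp add: K'_def)
  qed
  define M1 where "M1 = distr P (MH \<Otimes>\<^sub>M MX) (\<lambda>w. (H w, X w))"
  define k where "k = (\<lambda>w. distr (K' (H w)) (MH \<Otimes>\<^sub>M MX) (Pair (H w)))"
  \<comment> \<open>On an empty space \<open>bind\<close> does not carry the sigma-algebra of
    \<open>MH \<Otimes>\<^sub>M MX\<close>, hence the separate case.\<close>
  define M2 where "M2 = (if space P = {} then null_measure (MH \<Otimes>\<^sub>M MX) else P \<bind> k)"
  have k[measurable]: "k \<in> measurable P (subprob_algebra (MH \<Otimes>\<^sub>M MX))"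
    unfolding k_def by (rule measurable_distr2[where M=MX]) measurable
  have sM2: "sets M2 = sets (MH \<Otimes>\<^sub>M MX)"
    using sets_bind[OF sets_kernel[OF k], of P] by (simp add: M2_def)
  let ?E = "{a \<times> b | a b. a \<in> sets MH \<and> b \<in> sets MX}"
  have M12: "M1 = M2"
  proof (rule measure_eqI_generator_eq[where \<Omega>="space MH \<times> space MX" and
        E="?E" and A="\<lambda>_. space MH \<times> space MX"])
    show "Int_stable ?E"
      by (rule Int_stable_pair_measure_generator)
    show "?E \<subseteq> Pow (space MH \<times> space MX)"
      by (rule pair_measure_closed)
    show "sets M1 = sigma_sets (space MH \<times> space MX) ?E"
      by (simp add: M1_def sets_pair_measure)
    show "sets M2 = sigma_sets (space MH \<times> space MX) ?E"
      by (simp add: sM2 sets_pair_measure)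
    show "range (\<lambda>_. space MH \<times> space MX) \<subseteq> ?E" by auto
    show "emeasure M1 (space MH \<times> space MX) \<noteq> \<infinity>"
      unfolding M1_def by (subst emeasure_distr) auto
    fix C assume "C \<in> ?E"
    then obtain B A where C: "C = B \<times> A" and [measurable]: "B \<in> sets MH" "A \<in> sets MX" by auto
    show "emeasure M1 C = emeasure M2 C"
    proof (cases "space P = {}")
      case True
      then show ?thesis unfolding M1_def M2_def C by (simp add: emeasure_distr)
    next
      case False
      have "emeasure M1 C = emeasure P {w \<in> space P. H w \<in> B \<and> X w \<in> A}"
        unfolding M1_def C by (subst emeasure_distr) (auto intro!: arg_cong[where f="emeasure P"])
      also have "\<dots> = (\<integral>\<^sup>+w. indicator B (H w) * emeasure (K (H w)) A \<partial>P)" by (rule eq) measurable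
      also have "\<dots> = (\<integral>\<^sup>+w. emeasure (k w) C \<partial>P)"
      proof (rule nn_integral_cong_AE)
        show "AE w in P. indicator B (H w) * emeasure (K (H w)) A = emeasure (k w) C"
          using K'_eq AE_space
        proof eventually_elim
          case (elim w)
          have Hw[measurable]: "H w \<in> space MH" using elim by (auto intro: measurable_space[OF H])
          have s: "sets (K' (H w)) = sets MX" using K' Hw by (rule sets_kernel)
          have "emeasure (k w) C = emeasure (K' (H w)) (Pair (H w) -` C \<inter> space (K' (H w)))"
            unfolding k_def C by (rule emeasure_distr) (auto simp: measurable_cong_sets[OF s])
          also have "Pair (H w) -` C \<inter> space (K' (H w)) = (if H w \<in> B then A else {})"
            using sets_eq_imp_space_eq[OF s] sets.sets_into_space[of A MX] by (auto simp: C)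
          also have "emeasure (K' (H w)) \<dots> = indicator B (H w) * emeasure (K (H w)) A"
            using elim by auto
          finally show ?case by simp
        qed
      qed
      also have "\<dots> = emeasure M2 C"
        unfolding M2_def using False emeasure_bind[OF False k, of C] C by simp
      finally show ?thesis .
    qed
  qed auto
  have "(\<integral>\<^sup>+w. F (H w, X w) \<partial>P) = (\<integral>\<^sup>+w. \<integral>\<^sup>+y. F (H w, y) \<partial>K' (H w) \<partial>P)"
    if [measurable]: "F \<in> borel_measurable (MH \<Otimes>\<^sub>M MX)" for F
  proof (cases "space P = {}")
    case True
    have "integral\<^sup>N P G = 0" for G
      using nn_integral_cong[of P G "\<lambda>_. 0"] True by simp
    then show ?thesis by simp
  next
    case False
    have "(\<integral>\<^sup>+w. F (H w, X w) \<partial>P) = (\<integral>\<^sup>+z. F z \<partial>M2)"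
      unfolding M12[symmetric] M1_def by (simp add: nn_integral_distr)
    also have "\<dots> = (\<integral>\<^sup>+w. \<integral>\<^sup>+z. F z \<partial>k w \<partial>P)"
      using False nn_integral_bind[OF that k] by (simp add: M2_def)
    also have "\<dots> = (\<integral>\<^sup>+w. \<integral>\<^sup>+y. F (H w, y) \<partial>K' (H w) \<partial>P)"
    proof (rule nn_integral_cong)
      fix w assume "w \<in> space P"
      then have Hw[measurable]: "H w \<in> space MH" by (auto intro: measurable_space[OF H])
      have s: "sets (K' (H w)) = sets MX" using K' Hw by (rule sets_kernel)
      show "(\<integral>\<^sup>+z. F z \<partial>k w) = (\<integral>\<^sup>+y. F (H w, y) \<partial>K' (H w))"
        unfolding k_def by (rule nn_integral_distr) (auto simp: measurable_cong_sets[OF s])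
    qed
    finally show ?thesis .
  qed
  with that K' K'_eq show ?thesis by blast
qed

section \<open>The exponential on the extended nonnegative half-line\<close>

lemma exp_neg_nonneg [simp]: "0 \<le> exp_neg x"
  by (simp add: exp_neg_def)

lemma exp_neg_le_1: "exp_neg x \<le> 1"
  by (simp add: exp_neg_def)

lemma exp_neg_zero [simp]: "exp_neg 0 = 1"
  by (simp add: exp_neg_def)

lemma exp_neg_top [simp]: "exp_neg \<infinity> = 0" "exp_neg top = 0"
  by (simp_all add: exp_neg_def)

lemma exp_neg_eq_0_iff: "exp_neg x = 0 \<longleftrightarrow> x = \<infinity>"
  by (simp add: exp_neg_def)

lemma exp_neg_ennreal: "0 \<le> r \<Longrightarrow> exp_neg (ennreal r) = exp (- r)"
  by (simp add: exp_neg_def)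

lemma exp_neg_add: "exp_neg (a + b) = exp_neg a * exp_neg b"
  by (auto simp: exp_neg_def enn2real_plus less_top exp_add[symmetric])

lemma exp_neg_antimono: "a \<le> b \<Longrightarrow> exp_neg b \<le> exp_neg a"
  by (auto simp: exp_neg_def less_top top_unique intro: enn2real_mono)

lemma borel_measurable_exp_neg [measurable]: "exp_neg \<in> borel_measurable borel"
  unfolding exp_neg_def[abs_def] by measurable

lemma tendsto_exp_neg:
  assumes "(f \<longlongrightarrow> x) F" shows "((\<lambda>a. exp_neg (f a)) \<longlongrightarrow> exp_neg x) F"
proof (cases "x = \<infinity>")
  case True
  show ?thesis unfolding True exp_neg_top
  proof (rule order_tendstoI)
    fix e :: real assume e: "0 < e"
    \<comment> \<open>Beyond this level the exponential is at most e/2. The \<open>max 0\<close>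
      covers e > 2, where the level would be negative.\<close>
    have "eventually (\<lambda>a. ennreal (max 0 (- ln (e / 2))) < f a) F"
      using assms by (rule order_tendstoD) (simp add: True)
    then show "eventually (\<lambda>a. exp_neg (f a) < e) F"
    proof eventually_elim
      case (elim a)
      have "exp_neg (f a) \<le> exp_neg (ennreal (max 0 (- ln (e / 2))))"
        using elim by (intro exp_neg_antimono) auto
      also have "\<dots> \<le> exp (ln (e / 2))" by (subst exp_neg_ennreal) auto
      also have "\<dots> < e" using e by simp
      finally show ?case .
    qed
  next
    fix e :: real assume "e < 0"
    then show "eventually (\<lambda>a. e < exp_neg (f a)) F"
      by (intro always_eventually allI) (rule less_le_trans[OF _ exp_neg_nonneg])
  qed
next
  case False
  then have x: "x < top" by (simp add: less_top)
  have "((\<lambda>a. exp (- enn2real (f a))) \<longlongrightarrow> exp (- enn2real x)) F"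
    using assms x by (intro tendsto_intros tendsto_enn2real) auto
  moreover have "eventually (\<lambda>a. exp (- enn2real (f a)) = exp_neg (f a)) F"
    using order_tendstoD(2)[OF assms x] by eventually_elim (auto simp: exp_neg_def)
  moreover have "exp_neg x = exp (- enn2real x)" using x by (auto simp: exp_neg_def)
  ultimately show ?thesis by (simp add: Lim_transform_eventually)
qed

lemma nn_integral_exp_tail:
  assumes "0 \<le> x"
  shows "(\<integral>\<^sup>+c. indicator {x..} c * ennreal (exp (- c)) \<partial>lborel) = ennreal (exp (- x))"
proof -
  have "(\<integral>\<^sup>+c. ennreal (exp (- c)) * indicator {x..} c \<partial>lborel) = ennreal (0 - (- exp (- x)))"
  proof (rule nn_integral_FTC_atLeast)
    show "((\<lambda>c::real. - exp (- c)) \<longlongrightarrow> 0) at_top"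
      using tendsto_minus[OF filterlim_compose[OF exp_at_bot filterlim_uminus_at_bot_at_top]] by simp
  qed (auto intro!: derivative_eq_intros)
  then show ?thesis by (simp add: mult.commute)
qed

text \<open>exp(-x) is the probability that a unit exponential variable \<open>c\<close> is at least
  \<open>x\<close>, also for infinite \<open>x\<close>. In this form an exchange of integrals can
  replace the chain rule.\<close>

lemma exp_neg_eq_nn_integral:
  "ennreal (exp_neg x) = (\<integral>\<^sup>+c. indicator {0..} c * (indicator {r. x \<le> ennreal r} c * ennreal (exp (- c))) \<partial>lborel)"
proof (cases x)
  case (real r)
  have "(\<integral>\<^sup>+c. indicator {0..} c * (indicator {r. x \<le> ennreal r} c * ennreal (exp (- c))) \<partial>lborel) =
      (\<integral>\<^sup>+c. indicator {r..} c * ennreal (exp (- c)) \<partial>lborel)"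
    using real by (intro nn_integral_cong) (auto simp: indicator_def)
  also have "\<dots> = ennreal (exp (- r))" using real by (intro nn_integral_exp_tail) auto
  finally show ?thesis using real by (simp add: exp_neg_ennreal)
next
  case top
  then show ?thesis by (simp add: top_unique)
qed

text \<open>The mean of min(c, x) for a unit exponential \<open>c\<close>. By the layer-cake formula
  it is the integral over 0 \<le> r < x of the probability that c is at least r, that is, of
  exp(-r).\<close>

lemma nn_integral_exp_min:
  "(\<integral>\<^sup>+c. indicator {0..} c * (min (ennreal c) x * ennreal (exp (- c))) \<partial>lborel) = ennreal (1 - exp_neg x)"
proof -
  let ?A = "\<lambda>r t. indicator {0..} r * (indicator {r. ennreal r < x} r * t)"
  let ?B = "\<lambda>r c t. indicator {0..} c * (ennreal (exp (- c)) * (?A r t))"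
  let ?M = "\<integral>\<^sup>+c. indicator {0..} c * (min (ennreal c) x * ennreal (exp (- c))) \<partial>lborel"
  interpret lborel_pair: pair_sigma_finite "lborel :: real measure" "lborel :: real measure" ..
  have min: "min (ennreal c) x = (\<integral>\<^sup>+r. ?A r (indicator {..c} r) \<partial>lborel)"
    if c: "0 \<le> c" for c
  proof (cases x)
    case (real s)
    have "(\<integral>\<^sup>+r. ?A r (indicator {..c} r) \<partial>lborel) =
        (\<integral>\<^sup>+r. indicator (if s \<le> c then {0..<s} else {0..c}) r \<partial>lborel)"
      using real by (intro nn_integral_cong) (auto simp: indicator_def ennreal_less_iff)
    then show ?thesis using real c by (auto simp: min_def)
  next
    case top
    have "(\<integral>\<^sup>+r. ?A r (indicator {..c} r) \<partial>lborel) =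
        (\<integral>\<^sup>+r. indicator {0..c} r \<partial>lborel)"
      using top by (intro nn_integral_cong) (auto simp: indicator_def)
    then show ?thesis using top c by simp
  qed
  have "?M =
    (\<integral>\<^sup>+c. \<integral>\<^sup>+r. ?B r c (indicator {..c} r) \<partial>lborel \<partial>lborel)"
  proof (intro nn_integral_cong)
    fix c :: real
    show "indicator {0..} c * (min (ennreal c) x * ennreal (exp (- c))) =
     (\<integral>\<^sup>+r. ?B r c (indicator {..c} r) \<partial>lborel)"
      by (cases "0 \<le> c") (simp_all add: min nn_integral_cmult mult.commute)
  qed
  also have "\<dots> = (\<integral>\<^sup>+r. \<integral>\<^sup>+c. ?B r c (indicator {r..} c) \<partial>lborel \<partial>lborel)"
    by (subst lborel_pair.Fubini') (auto simp: indicator_def intro!: nn_integral_cong)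
  also have "\<dots> = (\<integral>\<^sup>+r. ?A r (ennreal (exp (- r))) \<partial>lborel)"
  proof (intro nn_integral_cong)
    fix r :: real
    have "(\<integral>\<^sup>+c. ?B r c (indicator {r..} c) \<partial>lborel) =
      (\<integral>\<^sup>+c. indicator {0..} r * indicator {r. ennreal r < x} r * (indicator {r..} c * ennreal (exp (- c))) \<partial>lborel)"
      by (intro nn_integral_cong) (auto simp: indicator_def)
    also have "\<dots> = ?A r (ennreal (exp (- r)))"
      by (subst nn_integral_cmult, measurable, cases "0 \<le> r") (simp_all add: nn_integral_exp_tail mult.assoc)
    finally show "(\<integral>\<^sup>+c. ?B r c (indicator {r..} c) \<partial>lborel) =
      ?A r (ennreal (exp (- r)))" .
  qed
  finally have L: "?M =
    (\<integral>\<^sup>+r. ?A r (ennreal (exp (- r))) \<partial>lborel)" .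
  \<comment> \<open>The part beyond \<open>x\<close> of the exponential law has mass
    \<open>exp_neg x\<close> and the total mass is 1, so the remaining part needs no evaluation of
    its own, whether \<open>x\<close> is finite or not.\<close>
  have "ennreal (exp_neg x) + (\<integral>\<^sup>+r. ?A r (ennreal (exp (- r))) \<partial>lborel) =
    (\<integral>\<^sup>+c. indicator {0..} c * (indicator {r. x \<le> ennreal r} c * ennreal (exp (- c))) +
       indicator {0..} c * (indicator {r. ennreal r < x} c * ennreal (exp (- c))) \<partial>lborel)"
    unfolding exp_neg_eq_nn_integral by (rule nn_integral_add[symmetric]) measurable
  also have "\<dots> = (\<integral>\<^sup>+c. indicator {0..} c * ennreal (exp (- c)) \<partial>lborel)"
    by (intro nn_integral_cong) (auto simp: indicator_def)
  also have "\<dots> = 1" by (simp add: nn_integral_exp_tail)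
  finally have "ennreal (exp_neg x) + (\<integral>\<^sup>+r. ?A r (ennreal (exp (- r))) \<partial>lborel) = 1" .
  then show ?thesis unfolding L
    by (metis ennreal_1 ennreal_add_diff_cancel_left ennreal_minus ennreal_neq_top exp_neg_nonneg infinity_ennreal_def)
qed

section \<open>Cumulated intensities and hazard rates\<close>

definition cumul :: "(real \<Rightarrow> ennreal) \<Rightarrow> real \<Rightarrow> real \<Rightarrow> ennreal" where
  "cumul lam a t = (\<integral>\<^sup>+s. indicator {a<..t} s * lam s \<partial>lborel)"

lemma cumul_mono: "s \<le> t \<Longrightarrow> cumul lam a s \<le> cumul lam a t"
  unfolding cumul_def by (intro nn_integral_mono) (auto simp: indicator_def)

lemma cumul_self [simp]: "t \<le> a \<Longrightarrow> cumul lam a t = 0"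
  unfolding cumul_def by simp

lemma borel_measurable_cumul [measurable]:
  assumes [measurable]: "lam \<in> borel_measurable borel"
  shows "cumul lam a \<in> borel_measurable borel"
  unfolding cumul_def greaterThanAtMost_iff indicator_def by measurable

lemma cumul_add:
  assumes [measurable]: "lam \<in> borel_measurable borel" and "a \<le> b" "b \<le> c"
  shows "cumul lam a c = cumul lam a b + cumul lam b c"
  unfolding cumul_def using assms(2,3)
  by (subst nn_integral_add[symmetric]) (auto simp: indicator_def intro!: nn_integral_cong)

lemma cumul_sup_left:
  assumes [measurable]: "lam \<in> borel_measurable borel" and X: "incseq X" "\<And>n. X n < b" "X \<longlonglongrightarrow> b"
  shows "(\<lambda>n. cumul lam a (X n)) \<longlonglongrightarrow> cumul lam a b"
proof -
  have "(\<Union>n. {a<..X n}) = {a<..<b}"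
  proof (intro equalityI subsetI)
    fix x assume "x \<in> {a<..<b}"
    moreover from this have "eventually (\<lambda>n. x < X n) sequentially"
      using X(3) by (intro order_tendstoD) auto
    then obtain n where "x < X n" by (auto simp: eventually_sequentially)
    ultimately show "x \<in> (\<Union>n. {a<..X n})" by (auto intro: less_imp_le)
  next
    fix x assume "x \<in> (\<Union>n. {a<..X n})"
    then show "x \<in> {a<..<b}" using X(2) by (force intro: le_less_trans)
  qed
  moreover have e: "cumul lam a t = emeasure (density lborel lam) {a<..t}" for t
    unfolding cumul_def by (simp add: emeasure_density mult.commute)
  have "(\<lambda>n. emeasure (density lborel lam) {a<..X n}) \<longlonglongrightarrow> emeasure (density lborel lam) (\<Union>n. {a<..X n})"
  proof (intro Lim_emeasure_incseq incseq_SucI)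
    show "{a<..X n} \<subseteq> {a<..X (Suc n)}" for n using incseq_SucD[OF X(1), of n] by auto
  qed auto
  moreover have "emeasure (density lborel lam) {a<..<b} = (\<integral>\<^sup>+s. lam s * indicator {a<..<b} s \<partial>lborel)"
    by (simp add: emeasure_density)
  moreover have "\<dots> = cumul lam a b"
    unfolding cumul_def
  proof (rule nn_integral_cong_AE, use AE_lborel_singleton[of b] in eventually_elim)
    case (elim s)
    then have "indicator {a<..<b} s = (indicator {a<..b} s :: ennreal)" by (auto simp: indicator_def)
    then show ?case by (simp add: mult.commute)
  qed
  ultimately show ?thesis unfolding e by simp
qed

text \<open>Continuity from above of a measure requires a finite value to start from. From the left
  there is no such condition, so a cumulated intensity can be discontinuous only by becoming
  infinite immediately to the right of a point.\<close>

lemma cumul_right: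
  assumes [measurable]: "lam \<in> borel_measurable borel" and X: "decseq X" "\<And>n. b < X n" "X \<longlonglongrightarrow> b"
    and fin: "cumul lam a (X 0) < \<infinity>"
  shows "(\<lambda>n. cumul lam a (X n)) \<longlonglongrightarrow> cumul lam a b"
proof -
  have "(\<Inter>n. {a<..X n}) = {a<..b}"
  proof (intro equalityI subsetI)
    fix x assume x: "x \<in> (\<Inter>n. {a<..X n})"
    then have "x \<le> b" by (intro LIMSEQ_le_const[OF X(3)]) auto
    then show "x \<in> {a<..b}" using x by auto
  next
    fix x assume "x \<in> {a<..b}"
    then show "x \<in> (\<Inter>n. {a<..X n})" using X(2) by (force intro: less_imp_le le_less_trans)
  qed
  moreover have e: "cumul lam a t = emeasure (density lborel lam) {a<..t}" for t
    unfolding cumul_def by (simp add: emeasure_density mult.commute)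
  have "emeasure (density lborel lam) {a<..X i} \<noteq> \<infinity>" for i
    using cumul_mono[of "X i" "X 0" lam a] X(1) fin unfolding e[symmetric] by (auto simp: decseq_def)
  then have "(\<lambda>n. emeasure (density lborel lam) {a<..X n}) \<longlonglongrightarrow> emeasure (density lborel lam) (\<Inter>n. {a<..X n})"
  proof (intro Lim_emeasure_decseq decseq_SucI)
    show "{a<..X (Suc n)} \<subseteq> {a<..X n}" for n using decseq_SucD[OF X(1), of n] by auto
  qed auto
  ultimately show ?thesis unfolding e by simp
qed

lemma left_approx:
  fixes a b :: real assumes "a < b"
  obtains X where "incseq X" "\<And>n. a \<le> X n" "\<And>n::nat. X n < b" "X \<longlonglongrightarrow> b"
proof
  define X where "X n = b - (b - a) / real (Suc n)" for n
  show "incseq X" unfolding X_def incseq_def using assms by (auto intro!: divide_left_mono)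
  show "a \<le> X n" for n
  proof -
    have "(b - a) / real (Suc n) \<le> (b - a) / 1" using assms by (intro divide_left_mono) auto
    then show ?thesis by (simp add: X_def)
  qed
  show "X n < b" for n using assms by (simp add: X_def)
  have "X \<longlonglongrightarrow> b - (b - a) * 0"
    unfolding X_def divide_inverse by (intro tendsto_intros LIMSEQ_inverse_real_of_nat)
  then show "X \<longlonglongrightarrow> b" by simp
qed

lemma right_approx:
  fixes a b :: real assumes "a < b"
  obtains X where "decseq X" "\<And>n. X n \<le> b" "\<And>n::nat. a < X n" "X \<longlonglongrightarrow> a"
proof -
  obtain Y where Y: "incseq Y" "\<And>n. -b \<le> Y n" "\<And>n::nat. Y n < -a" "Y \<longlonglongrightarrow> -a"
    using left_approx[of "-b" "-a"] assms by auto
  show thesis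
  proof
    show "decseq (\<lambda>n. - Y n)" using Y(1) by (auto simp: decseq_def incseq_def)
    show "- Y n \<le> b" for n using Y(2)[of n] by linarith
    show "a < - Y n" for n using Y(3)[of n] by linarith
    show "(\<lambda>n. - Y n) \<longlonglongrightarrow> a" using tendsto_minus[OF Y(4)] by simp
  qed
qed

text \<open>
  Without the side condition the cumulated intensity could jump from a finite value to \<open>\<infinity>\<close>, and
  \<open>exp_neg\<close> of it would lose mass there.
\<close>

lemma cumul_sublevel:
  assumes lam[measurable]: "lam \<in> borel_measurable borel" and ab: "a \<le> b"
    and nojump: "\<And>s. a \<le> s \<Longrightarrow> s < b \<Longrightarrow> cumul lam a s < \<infinity> \<Longrightarrow> \<exists>r>s. r \<le> b \<and> cumul lam a r < \<infinity>"
    and c: "0 \<le> c"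
  shows "(\<integral>\<^sup>+s. indicator {a<..b} s * (lam s * indicator {s. cumul lam a s \<le> ennreal c} s) \<partial>lborel) = min (ennreal c) (cumul lam a b)"
    (is "?I = _")
proof (cases "cumul lam a b \<le> ennreal c")
  case True
  have "?I = cumul lam a b"
    unfolding cumul_def[of lam a b]
  proof (intro nn_integral_cong)
    fix s
    show "indicator {a<..b} s * (lam s * indicator {s. cumul lam a s \<le> ennreal c} s) = indicator {a<..b} s * lam s"
      using order_trans[OF cumul_mono True, of s] by (auto simp: indicator_def)
  qed
  then show ?thesis using True by (simp add: min_def)
next
  case False
  define M where "M = {s \<in> {a..b}. cumul lam a s \<le> ennreal c}"
  have aM: "a \<in> M" using ab by (simp add: M_def)
  have bdd: "bdd_above M" by (auto simp: M_def)
  \<comment> \<open>The last time at which the level \<open>c\<close> is not exceeded. Left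
    continuity shows that it is not exceeded at \<open>s\<close>; right continuity, made available
    by \<open>nojump\<close>, shows that it is attained there, so the integral up to
    \<open>s\<close> is exactly \<open>c\<close>.\<close>
  define s where "s = Sup M"
  have as: "a \<le> s" unfolding s_def using aM bdd by (rule cSup_upper)
  have sb: "s \<le> b" unfolding s_def using aM by (intro cSup_least) (auto simp: M_def)
  have below: "cumul lam a r \<le> ennreal c" if "r < s" for r
  proof -
    have "\<exists>m\<in>M. r < m" using less_cSup_iff[of M r] aM bdd that unfolding s_def by blast
    then obtain m where "m \<in> M" "r < m" by blast
    then show ?thesis using cumul_mono[of r m lam a] by (auto simp: M_def)
  qed
  have le: "cumul lam a s \<le> ennreal c"
  proof (cases "a = s")
    case False
    then obtain X where X: "incseq X" "\<And>n. a \<le> X n" "\<And>n::nat. X n < s" "X \<longlonglongrightarrow> s"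
      using left_approx[of a s] as by auto
    show ?thesis
      using below[OF X(3)] by (intro LIMSEQ_le_const2[OF cumul_sup_left[OF lam X(1,3,4)]]) auto
  qed (use c in auto)
  then have "s \<noteq> b" using False by auto
  then have sb: "s < b" using sb by auto
  have above: "\<not> cumul lam a r \<le> ennreal c" if "s < r" "r \<le> b" for r
  proof
    assume "cumul lam a r \<le> ennreal c"
    then have "r \<in> M" using that as by (auto simp: M_def)
    then have "r \<le> s" unfolding s_def using bdd by (rule cSup_upper)
    then show False using that by simp
  qed
  have ge: "ennreal c \<le> cumul lam a s"
  proof -
    have "cumul lam a s < \<infinity>" using le by (auto simp: less_top[symmetric] top_unique)
    then obtain r where r: "s < r" "r \<le> b" "cumul lam a r < \<infinity>" using nojump[OF as sb] by auto
    obtain X where X: "decseq X" "\<And>n. X n \<le> r" "\<And>n::nat. s < X n" "X \<longlonglongrightarrow> s"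
      using right_approx[OF r(1)] by auto
    have "cumul lam a (X 0) < \<infinity>" using cumul_mono[OF X(2), of lam a 0] r(3) by (rule le_less_trans)
    from cumul_right[OF lam X(1,3,4) this] show ?thesis
    proof (rule LIMSEQ_le_const, intro exI allI impI)
      fix n show "ennreal c \<le> cumul lam a (X n)"
        using above[OF X(3)[of n] order_trans[OF X(2)[of n] r(2)]] by simp
    qed
  qed
  have "?I = cumul lam a s"
    unfolding cumul_def[of lam a s]
  proof (intro nn_integral_cong)
    fix r
    have "r \<le> s \<Longrightarrow> cumul lam a r \<le> ennreal c" using le below by (cases "r = s") auto
    then show "indicator {a<..b} r * (lam r * indicator {s. cumul lam a s \<le> ennreal c} r) = indicator {a<..s} r * lam r"
      using above[of r] sb by (auto simp: indicator_def)
  qed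
  then show ?thesis using le ge False by (simp add: min_def)
qed

text \<open>The substitution x = \<open>cumul lam a s\<close> in the integral of exp(-x), without
  differentiating. Writing the exponential as the mass of all \<open>c\<close> above the cumulated
  intensity and exchanging integrals, the inner integral of \<open>lam\<close> over a sublevel set
  is min(c, \<open>cumul lam a b\<close>), whose mean under the exponential law is known.\<close>

lemma nn_integral_hazard:
  assumes lam[measurable]: "lam \<in> borel_measurable borel" and ab: "a \<le> b"
    and nojump: "\<And>s. a \<le> s \<Longrightarrow> s < b \<Longrightarrow> cumul lam a s < \<infinity> \<Longrightarrow> \<exists>r>s. r \<le> b \<and> cumul lam a r < \<infinity>"
  shows "(\<integral>\<^sup>+s. indicator {a<..b} s * (lam s * ennreal (exp_neg (cumul lam a s))) \<partial>lborel) =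
     ennreal (1 - exp_neg (cumul lam a b))"
proof -
  let ?G = "\<lambda>s c. indicator {a<..b} s * lam s * (indicator {0..} c * (indicator {r. cumul lam a s \<le> ennreal r} c * ennreal (exp (- c))))"
  interpret lborel_pair: pair_sigma_finite "lborel :: real measure" "lborel :: real measure" ..
  have "(\<integral>\<^sup>+s. indicator {a<..b} s * (lam s * ennreal (exp_neg (cumul lam a s))) \<partial>lborel) =
     (\<integral>\<^sup>+s. \<integral>\<^sup>+c. ?G s c \<partial>lborel \<partial>lborel)"
    unfolding exp_neg_eq_nn_integral
    by (intro nn_integral_cong) (subst nn_integral_cmult, auto simp: mult.assoc)
  also have "\<dots> = (\<integral>\<^sup>+c. \<integral>\<^sup>+s. ?G s c \<partial>lborel \<partial>lborel)"
    unfolding indicator_def mem_Collect_eq by (rule lborel_pair.Fubini') measurable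
  also have "\<dots> = (\<integral>\<^sup>+c. indicator {0..} c * (min (ennreal c) (cumul lam a b) * ennreal (exp (- c))) \<partial>lborel)"
  proof (rule nn_integral_cong)
    fix c :: real
    show "(\<integral>\<^sup>+s. ?G s c \<partial>lborel) =
      indicator {0..} c * (min (ennreal c) (cumul lam a b) * ennreal (exp (- c)))"
    proof (cases "0 \<le> c")
      case True
      have "(\<integral>\<^sup>+s. ?G s c \<partial>lborel) =
        (\<integral>\<^sup>+s. ennreal (exp (- c)) * (indicator {a<..b} s * (lam s * indicator {s. cumul lam a s \<le> ennreal c} s)) \<partial>lborel)"
        using True by (intro nn_integral_cong) (auto simp: indicator_def mult.commute)
      also have "\<dots> = ennreal (exp (- c)) * min (ennreal c) (cumul lam a b)"
        by (subst nn_integral_cmult) (use cumul_sublevel[OF lam ab nojump True] in auto)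
      finally show ?thesis using True by (simp add: mult.commute)
    qed simp
  qed
  also have "\<dots> = ennreal (1 - exp_neg (cumul lam a b))" by (rule nn_integral_exp_min)
  finally show ?thesis .
qed

text \<open>The value \<open>b\<close> of the waiting time stands for "no event".\<close>

lemma hazard_law:
  assumes "prob_space mu" and sets_mu: "sets mu = sets borel" and ab: "a < b"
    and lam[measurable]: "lam \<in> borel_measurable borel"
    and supp: "AE t in mu. a < t \<and> t \<le> b"
    and surv: "\<And>t. a \<le> t \<Longrightarrow> t < b \<Longrightarrow> measure mu {t<..} = exp_neg (cumul lam a t)"
  shows "emeasure mu {b} = ennreal (exp_neg (cumul lam a b))"
    and "F \<in> borel_measurable borel \<Longrightarrow> (\<integral>\<^sup>+t. indicator {..<b} t * F t \<partial>mu) =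
      (\<integral>\<^sup>+t. indicator {a<..<b} t * (lam t * ennreal (exp_neg (cumul lam a t)) * F t) \<partial>lborel)"
proof -
  interpret prob_space mu by fact
  note [measurable_cong] = sets_mu
  have surv': "emeasure mu {t<..} = ennreal (exp_neg (cumul lam a t))" if "a \<le> t" "t < b" for t
    using surv[OF that] by (simp add: emeasure_eq_measure)
  \<comment> \<open>Were the cumulated intensity infinite immediately after \<open>s\<close>, the
    survival probability would vanish at times decreasing to \<open>s\<close>. Continuity from below
    then gives \<open>{s<..}\<close> mass 0, contradicting the positive value exp(-x) at the finite
    x = \<open>cumul lam a s\<close>.\<close>
  have nojump: "\<exists>r>s. r \<le> b \<and> cumul lam a r < \<infinity>" if s: "a \<le> s" "s < b" "cumul lam a s < \<infinity>" for s
  proof (rule ccontr)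
    assume no: "\<not> (\<exists>r>s. r \<le> b \<and> cumul lam a r < \<infinity>)"
    obtain X where X: "decseq X" "\<And>n. X n \<le> (s + b) / 2" "\<And>n::nat. s < X n" "X \<longlonglongrightarrow> s"
      using right_approx[of s "(s + b) / 2"] s by auto
    have Xb: "X n < b" for n using X(2)[of n] s by (simp add: field_simps) 
    have "emeasure mu (\<Union>n. {X n<..}) = 0"
    proof (intro emeasure_UN_eq_0)
      fix n
      have "cumul lam a (X n) = \<infinity>" using no X(3)[of n] Xb[of n] by (auto simp: less_top[symmetric] intro: less_imp_le)
      then show "emeasure mu {X n<..} = 0" using surv'[of "X n"] Xb[of n] X(3)[of n] s by simp
    qed auto
    also have "(\<Union>n. {X n<..}) = {s<..}"
    proof (intro equalityI subsetI)
      fix x assume "x \<in> {s<..}"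
      then have "eventually (\<lambda>n. X n < x) sequentially" using X(4) by (intro order_tendstoD) auto
      then show "x \<in> (\<Union>n. {X n<..})" by (auto simp: eventually_sequentially)
    next
      fix x assume "x \<in> (\<Union>n. {X n<..})"
      then show "x \<in> {s<..}" using X(3) by (auto intro: less_trans)
    qed
    finally have "exp_neg (cumul lam a s) = 0" using surv'[of s] s by simp
    then show False using s by (simp add: exp_neg_eq_0_iff)
  qed
  \<comment> \<open>The survival formula says nothing at \<open>b\<close> itself. A limit from the
    left yields the mass of \<open>{b..}\<close>, and by \<open>supp\<close> this is the atom at
    \<open>b\<close>.\<close>
  obtain Y where Y: "incseq Y" "\<And>n. a \<le> Y n" "\<And>n::nat. Y n < b" "Y \<longlonglongrightarrow> b"
    using left_approx[OF ab] by auto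
  have "(\<Inter>n. {Y n<..}) = {b..}"
  proof (intro equalityI subsetI)
    fix x assume "x \<in> (\<Inter>n. {Y n<..})"
    then have "b \<le> x" by (intro LIMSEQ_le_const2[OF Y(4)]) (auto intro: less_imp_le)
    then show "x \<in> {b..}" by simp
  qed (use Y(3) in \<open>auto intro: less_le_trans\<close>)
  moreover have "(\<lambda>n. emeasure mu {Y n<..}) \<longlonglongrightarrow> emeasure mu (\<Inter>n. {Y n<..})"
    using Y(1) by (intro Lim_emeasure_decseq) (auto simp: decseq_def incseq_def intro: le_less_trans)
  moreover have "(\<lambda>n. emeasure mu {Y n<..}) \<longlonglongrightarrow> ennreal (exp_neg (cumul lam a b))"
    unfolding surv'[OF Y(2,3)]
    by (intro tendsto_ennrealI tendsto_exp_neg cumul_sup_left[OF lam Y(1,3,4)])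
  ultimately have atb: "emeasure mu {b..} = ennreal (exp_neg (cumul lam a b))"
    using LIMSEQ_unique by fastforce
  also have "emeasure mu {b..} = emeasure mu {b}"
    using supp by (intro emeasure_eq_AE) auto
  finally show "emeasure mu {b} = ennreal (exp_neg (cumul lam a b))" .

  define g where "g t = indicator {a<..b} t * (lam t * ennreal (exp_neg (cumul lam a t)))" for t
  have [measurable]: "g \<in> borel_measurable borel" unfolding g_def by measurable
  let ?L = "\<lambda>t. \<integral>\<^sup>+s. g s * indicator {..t} s \<partial>lborel"
  let ?R = "\<lambda>x. \<integral>\<^sup>+s. g s * indicator {x<..} s \<partial>lborel"
  have int: "?L t = ennreal (1 - exp_neg (cumul lam a t))"
    if t: "a \<le> t" "t \<le> b" for t
  proof -
    have "?L t =
        (\<integral>\<^sup>+s. indicator {a<..t} s * (lam s * ennreal (exp_neg (cumul lam a s))) \<partial>lborel)"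
      unfolding g_def using t by (intro nn_integral_cong) (auto simp: indicator_def)
    also have "\<dots> = ennreal (1 - exp_neg (cumul lam a t))"
    proof (rule nn_integral_hazard[OF lam t(1)])
      fix s assume s: "a \<le> s" "s < t" "cumul lam a s < \<infinity>"
      then obtain r where r: "s < r" "r \<le> b" "cumul lam a r < \<infinity>" using nojump[of s] t by auto
      have "cumul lam a (min r t) \<le> cumul lam a r" by (intro cumul_mono) auto
      then show "\<exists>r>s. r \<le> t \<and> cumul lam a r < \<infinity>"
        using r s by (intro exI[of _ "min r t"]) (auto intro: le_less_trans)
    qed
    finally show ?thesis .
  qed
  \<comment> \<open>After removal of the atom at \<open>b\<close> the two measures are compared on
    half-lines, which suffices since these have finite mass.\<close>
  have eq: "density mu (indicator {..<b}) = density lborel g"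
  proof (rule measure_eqI_lessThan)
    fix x
    have L: "emeasure (density mu (indicator {..<b})) {x<..} = emeasure mu {x<..<b}"
      by (subst emeasure_density) (auto intro!: nn_integral_cong simp: indicator_def simp flip: nn_integral_indicator)
    then show "emeasure (density mu (indicator {..<b})) {x<..} < \<infinity>"
      by (simp add: emeasure_eq_measure)
    have R: "emeasure (density lborel g) {x<..} = ?R x"
      by (subst emeasure_density) auto
    have main: "emeasure mu {x<..<b} = ?R x" if x: "a \<le> x" "x < b" for x
    proof -
      have "emeasure mu {x<..} = emeasure mu {x<..<b} + emeasure mu {b..}"
        using x by (subst plus_emeasure) (auto intro!: arg_cong[where f="emeasure mu"])
      then have 1: "ennreal (exp_neg (cumul lam a x)) = emeasure mu {x<..<b} + ennreal (exp_neg (cumul lam a b))"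
        using surv'[of x] x atb by simp
      have "?L b = (\<integral>\<^sup>+s. g s * indicator {..x} s + g s * indicator {x<..} s \<partial>lborel)"
        using x by (intro nn_integral_cong) (auto simp: indicator_def g_def)
      also have "\<dots> = ?L x + ?R x"
        by (rule nn_integral_add) auto
      finally have 2: "ennreal (1 - exp_neg (cumul lam a b)) = ennreal (1 - exp_neg (cumul lam a x)) + ?R x"
        using int x by simp
      \<comment> \<open>All quantities are finite, so the two decompositions can be solved as real
        equations; both \<open>p\<close> and \<open>q\<close> come out as the drop of the survival
        function between \<open>x\<close> and \<open>b\<close>.\<close>
      obtain p where p: "0 \<le> p" "emeasure mu {x<..<b} = ennreal p"
        using that[OF measure_nonneg emeasure_eq_measure] .
      have "?R x \<le> ennreal (1 - exp_neg (cumul lam a b))" unfolding 2 by simp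
      then obtain q where q: "0 \<le> q" "?R x = ennreal q"
        by (cases "?R x") (auto simp: top_unique)
      have "exp_neg (cumul lam a x) = p + exp_neg (cumul lam a b)"
        using 1 p by (simp flip: ennreal_plus)
      moreover have "1 - exp_neg (cumul lam a b) = 1 - exp_neg (cumul lam a x) + q"
        using 2 q exp_neg_le_1 by (simp flip: ennreal_plus)
      ultimately show ?thesis using p q by simp
    qed
    consider "x < a" | "a \<le> x" "x < b" | "b \<le> x" by linarith
    then show "emeasure (density mu (indicator {..<b})) {x<..} = emeasure (density lborel g) {x<..}"
    proof cases
      case 1
      have "emeasure mu {x<..<b} = emeasure mu {a<..<b}"
        using supp 1 by (intro emeasure_eq_AE) auto
      also have "\<dots> = (\<integral>\<^sup>+s. g s * indicator {a<..} s \<partial>lborel)" using ab by (intro main) auto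
      also have "\<dots> = ?R x"
        using 1 by (intro nn_integral_cong) (auto simp: indicator_def g_def)
      finally show ?thesis unfolding L R .
    next
      case 2
      then show ?thesis unfolding L R by (rule main)
    next
      case 3
      then have "?R x = (\<integral>\<^sup>+s. 0 \<partial>(lborel :: real measure))"
        by (intro nn_integral_cong) (auto simp: indicator_def g_def)
      then show ?thesis unfolding L R using 3 by simp
    qed
  qed (auto simp: sets_mu)
  assume F[measurable]: "F \<in> borel_measurable borel"
  have "(\<integral>\<^sup>+t. indicator {..<b} t * F t \<partial>mu) = (\<integral>\<^sup>+t. F t \<partial>density mu (indicator {..<b}))"
    by (subst nn_integral_density) auto
  also have "\<dots> = (\<integral>\<^sup>+t. g t * F t \<partial>lborel)"
    unfolding eq by (subst nn_integral_density) auto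
  also have "\<dots> = (\<integral>\<^sup>+t. indicator {a<..<b} t * (lam t * ennreal (exp_neg (cumul lam a t)) * F t) \<partial>lborel)"
  proof (rule nn_integral_cong_AE, use AE_lborel_singleton[of b] in eventually_elim)
    case (elim t)
    then have "indicator {a<..b} t = (indicator {a<..<b} t :: ennreal)" by (auto simp: indicator_def)
    then show ?case by (simp add: g_def mult.assoc)
  qed
  finally show "(\<integral>\<^sup>+t. indicator {..<b} t * F t \<partial>mu) =
      (\<integral>\<^sup>+t. indicator {a<..<b} t * (lam t * ennreal (exp_neg (cumul lam a t)) * F t) \<partial>lborel)" .
qed

section \<open>Temporal point processes\<close>

lemma cumul_cong: "(\<And>s. a < s \<Longrightarrow> s \<le> t \<Longrightarrow> f s = g s) \<Longrightarrow> cumul f a t = cumul g a t"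
  unfolding cumul_def by (intro nn_integral_cong) (auto simp: indicator_def)

lemma has_cond_intensity_cong:
  "sets S = sets S' \<Longrightarrow> has_cond_intensity loc S l lam Q \<longleftrightarrow> has_cond_intensity loc S' l lam Q"
  unfolding has_cond_intensity_def by (simp add: patterns_cong[of S S'])

section \<open>Ranks of the points on the time axis\<close>

definition hist :: "('r \<Rightarrow> real) \<Rightarrow> 'r set \<Rightarrow> real \<Rightarrow> 'r set" where
  "hist loc y s = {q \<in> y. loc q < s}"

definition loc_rank :: "('r \<Rightarrow> real) \<Rightarrow> 'r set \<Rightarrow> 'r \<Rightarrow> nat" where
  "loc_rank loc y p = card (hist loc y (loc p))"

text \<open>The value \<open>l\<close> when no point follows makes this a real-valued waiting time
  of the kind treated in \<open>hazard_law\<close>, with a possible atom at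
  \<open>l\<close>.\<close>

definition next_time :: "('r \<Rightarrow> real) \<Rightarrow> real \<Rightarrow> real \<Rightarrow> 'r set \<Rightarrow> real" where
  "next_time loc l a y = Min (insert l (loc ` {p \<in> y. a < loc p}))"

context
  fixes loc :: "'r \<Rightarrow> real" and y :: "'r set"
  assumes fin: "finite y" and inj: "inj_on loc y"
begin

lemma rank_less_iff: "p \<in> y \<Longrightarrow> q \<in> y \<Longrightarrow> loc_rank loc y p < loc_rank loc y q \<longleftrightarrow> loc p < loc q"
proof -
  have less: "loc_rank loc y p < loc_rank loc y q" if "p \<in> y" "q \<in> y" "loc p < loc q" for p q
    unfolding loc_rank_def
  proof (rule psubset_card_mono)
    have "p \<in> hist loc y (loc q)" "p \<notin> hist loc y (loc p)" using that by (auto simp: hist_def)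
    then show "hist loc y (loc p) \<subset> hist loc y (loc q)"
      using that by (auto simp: hist_def)
  qed (use fin in \<open>simp add: hist_def\<close>)
  assume pq: "p \<in> y" "q \<in> y"
  consider "loc p < loc q" | "loc q < loc p" | "p = q" using inj pq by (force simp: inj_on_def)
  then show ?thesis using less[of p q] less[of q p] pq by cases auto
qed

lemma inj_on_rank: "inj_on (loc_rank loc y) y"
proof (rule inj_onI)
  fix p q assume pq: "p \<in> y" "q \<in> y" "loc_rank loc y p = loc_rank loc y q"
  then have "\<not> loc p < loc q" "\<not> loc q < loc p" using rank_less_iff[of p q] rank_less_iff[of q p] by auto
  then show "p = q" using inj pq by (auto simp: inj_on_def)
qed

lemma rank_image: "loc_rank loc y ` y = {..<card y}"
proof (rule card_subset_eq)
  show "loc_rank loc y ` y \<subseteq> {..<card y}"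
  proof safe
    fix p assume "p \<in> y"
    then have "hist loc y (loc p) \<subset> y" by (auto simp: hist_def)
    then show "loc_rank loc y p < card y" unfolding loc_rank_def using fin by (rule psubset_card_mono[rotated])
  qed
qed (simp_all add: card_image[OF inj_on_rank])

lemma rank_less_card: "p \<in> y \<Longrightarrow> loc_rank loc y p < card y"
  using rank_image by blast

lemma first_points_rank: "first_points loc n y = {p \<in> y. loc_rank loc y p < n}"
  by (simp add: first_points_def loc_rank_def hist_def)

lemma card_first_points: "card (first_points loc n y) = min n (card y)"
proof -
  have "card (first_points loc n y) = card (loc_rank loc y ` first_points loc n y)"
    by (rule card_image[symmetric], rule inj_on_subset[OF inj_on_rank]) (auto simp: first_points_rank)
  also have "loc_rank loc y ` first_points loc n y = {..<card y} \<inter> {..<n}"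
    unfolding rank_image[symmetric] first_points_rank by auto
  also have "\<dots> = {..<min n (card y)}" by auto
  finally show ?thesis by simp
qed

lemma first_points_all: "card y \<le> n \<Longrightarrow> first_points loc n y = y"
  unfolding first_points_rank using rank_less_card by (auto intro: less_le_trans)

lemma next_point_rank:
  assumes "n < card y"
  shows "next_point loc n y \<in> y" "loc_rank loc y (next_point loc n y) = n"
proof -
  obtain p where p: "p \<in> y" "loc_rank loc y p = n" using rank_image assms by (metis imageE lessThan_iff)
  have "next_point loc n y = (THE p. p \<in> y \<and> loc_rank loc y p = n)"
    by (simp add: next_point_def loc_rank_def hist_def)
  also have "\<dots> = p" using p inj_on_rank by (intro the_equality) (auto simp: inj_on_def)
  finally show "next_point loc n y \<in> y" "loc_rank loc y (next_point loc n y) = n" using p by auto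
qed

lemma first_points_Suc:
  assumes "n < card y"
  shows "first_points loc (Suc n) y = insert (next_point loc n y) (first_points loc n y)"
  using next_point_rank[OF assms] inj_on_rank
  by (auto simp: first_points_rank less_Suc_eq inj_on_def)

lemma first_points_less_next:
  assumes "n < card y" "q \<in> first_points loc n y"
  shows "loc q < loc (next_point loc n y)"
  using next_point_rank[OF assms(1)] assms(2) rank_less_iff[of q "next_point loc n y"]
  by (auto simp: first_points_rank)

lemma last_time_less_iff:
  assumes "h \<subseteq> y" "0 < t" shows "last_time loc h < t \<longleftrightarrow> (\<forall>q\<in>h. loc q < t)"
  unfolding last_time_def using finite_subset[OF assms(1) fin] assms(2) by (subst Max_less_iff) auto

text \<open>Positivity of the times is needed because \<open>last_time\<close> of the empty set is
  0: for \<open>n = 0\<close> every point has to lie strictly after it.\<close>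

lemma after_first_points:
  assumes "\<And>p. p \<in> y \<Longrightarrow> 0 < loc p"
  shows "{p \<in> y. last_time loc (first_points loc n y) < loc p} = {p \<in> y. n \<le> loc_rank loc y p}"
proof (intro Collect_cong conj_cong refl)
  fix p assume p: "p \<in> y"
  have "last_time loc (first_points loc n y) < loc p \<longleftrightarrow> (\<forall>q\<in>first_points loc n y. loc q < loc p)"
    using p assms by (intro last_time_less_iff) (auto simp: first_points_rank)
  also have "\<dots> \<longleftrightarrow> (\<forall>q\<in>y. loc_rank loc y q < n \<longrightarrow> loc_rank loc y q < loc_rank loc y p)"
    using p by (auto simp: first_points_rank rank_less_iff)
  also have "\<dots> \<longleftrightarrow> n \<le> loc_rank loc y p"
  proof
    assume *: "\<forall>q\<in>y. loc_rank loc y q < n \<longrightarrow> loc_rank loc y q < loc_rank loc y p"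
    show "n \<le> loc_rank loc y p"
    proof (rule ccontr)
      assume "\<not> n \<le> loc_rank loc y p"
      then have "loc_rank loc y p < n" by simp
      then show False using * p by blast
    qed
  qed auto
  finally show "last_time loc (first_points loc n y) < loc p \<longleftrightarrow> n \<le> loc_rank loc y p" .
qed

text \<open>\<open>next_point\<close> is meaningful only for patterns with more than
  \<open>n\<close> points, while a kernel is integrated over arbitrary patterns for a fixed history.
  \<open>next_time\<close> is defined for every history and every pattern and is jointly
  measurable.\<close>

lemma next_time_first_points:
  assumes "\<And>p. p \<in> y \<Longrightarrow> 0 < loc p \<and> loc p < l"
  shows "next_time loc l (last_time loc (first_points loc n y)) y =
    (if n < card y then loc (next_point loc n y) else l)"
proof (cases "n < card y")
  case True
  note np = next_point_rank[OF True]
  have "Min (insert l (loc ` {p \<in> y. n \<le> loc_rank loc y p})) = loc (next_point loc n y)"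
  proof (rule Min_eqI)
    show "finite (insert l (loc ` {p \<in> y. n \<le> loc_rank loc y p}))" using fin by simp
    show "loc (next_point loc n y) \<in> insert l (loc ` {p \<in> y. n \<le> loc_rank loc y p})"
      using np by auto
    fix t assume "t \<in> insert l (loc ` {p \<in> y. n \<le> loc_rank loc y p})"
    then consider "t = l" | p where "p \<in> y" "n \<le> loc_rank loc y p" "t = loc p" by auto
    then show "loc (next_point loc n y) \<le> t"
    proof cases
      case 1 then show ?thesis using assms np by (auto intro: less_imp_le)
    next
      case 2 then show ?thesis using rank_less_iff[of p "next_point loc n y"] np by force
    qed
  qed
  then show ?thesis using True assms by (simp add: next_time_def after_first_points)
next
  case False
  then have e: "{p \<in> y. n \<le> loc_rank loc y p} = {}"
    using rank_less_card by (auto simp: not_less not_le intro: less_le_trans)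
  have "next_time loc l (last_time loc (first_points loc n y)) y =
      Min (insert l (loc ` {p \<in> y. n \<le> loc_rank loc y p}))"
    using assms by (simp add: next_time_def after_first_points)
  then show ?thesis using False by (simp only: e image_empty Min_singleton if_False)
qed

end

lemma next_time_greater_iff:
  "finite y \<Longrightarrow> t < next_time loc l a y \<longleftrightarrow> t < l \<and> (\<forall>p\<in>y. \<not> (a < loc p \<and> loc p \<le> t))"
  unfolding next_time_def by (subst Min_gr_iff) auto

lemma next_time_le: "finite y \<Longrightarrow> next_time loc l a y \<le> l"
  unfolding next_time_def by (rule Min_le) auto

context line_space
begin

lemma measurable_last_time [measurable (raw)]:
  assumes Y[measurable]: "Y \<in> measurable M PS"
  shows "(\<lambda>a. last_time loc (Y a)) \<in> borel_measurable M"
  unfolding borel_measurable_iff_le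
proof
  fix t
  have "last_time loc (Y a) \<le> t \<longleftrightarrow> 0 \<le> t \<and> (\<forall>p\<in>Y a. loc p \<le> t)" if "a \<in> space M" for a
    using finite_patterns[OF measurable_space[OF Y that]] by (simp add: last_time_def)
  then have "{a \<in> space M. last_time loc (Y a) \<le> t} = {a \<in> space M. 0 \<le> t \<and> (\<forall>p\<in>Y a. loc p \<le> t)}"
    by auto
  also have "\<dots> \<in> sets M" by measurable
  finally show "{a \<in> space M. last_time loc (Y a) \<le> t} \<in> sets M" .
qed

lemma measurable_next_time [measurable (raw)]:
  assumes Y[measurable]: "Y \<in> measurable M PS" and [measurable]: "u \<in> borel_measurable M"
  shows "(\<lambda>a. next_time loc l (u a) (Y a)) \<in> borel_measurable M"
  unfolding borel_measurable_iff_greater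
proof
  fix t
  have "{a \<in> space M. t < next_time loc l (u a) (Y a)} =
      {a \<in> space M. t < l \<and> (\<forall>p\<in>Y a. \<not> (u a < loc p \<and> loc p \<le> t))}"
    using measurable_space[OF Y] finite_patterns next_time_greater_iff by blast
  also have "\<dots> \<in> sets M" by measurable
  finally show "{a \<in> space M. t < next_time loc l (u a) (Y a)} \<in> sets M" .
qed

lemma measurable_hist [measurable (raw)]:
  assumes Y[measurable]: "Y \<in> measurable M PS" and [measurable]: "u \<in> borel_measurable M"
  shows "(\<lambda>a. hist loc (Y a) (u a)) \<in> measurable M PS"
  unfolding hist_def by measurable

lemma measurable_card_pattern [measurable (raw)]:
  assumes [measurable]: "Y \<in> measurable M PS"
  shows "(\<lambda>a. card (Y a)) \<in> measurable M (count_space UNIV)"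
proof -
  have "(\<lambda>a. card {p \<in> Y a. True}) \<in> measurable M (count_space UNIV)" by measurable
  then show ?thesis by simp
qed

end

section \<open>The law of the next point on a time interval\<close>

locale temporal_process = line_space S loc for S :: "'r measure" and loc :: "'r \<Rightarrow> real" +
  fixes l :: real and lam :: "real \<Rightarrow> 'r set \<Rightarrow> real" and Q :: "'r set measure"
  assumes l_pos: "0 < l" and loc_range: "x \<in> space S \<Longrightarrow> 0 < loc x \<and> loc x < l"
    and lam_measurable: "(\<lambda>(s, h). lam s h) \<in> borel_measurable (time_space l \<Otimes>\<^sub>M PS)"
    and lam_nonneg: "0 < s \<Longrightarrow> s < l \<Longrightarrow> h \<in> space PS \<Longrightarrow> 0 \<le> lam s h"
    and cond_intensity: "has_cond_intensity loc S l lam Q"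
begin

text \<open>The intensity is given on (0, l) only. Extension by 0 makes it a Borel function on the
  whole line, as \<open>cumul\<close> and \<open>hazard_law\<close> require.\<close>

definition lamE :: "'r set \<Rightarrow> real \<Rightarrow> ennreal" where
  "lamE h s = (if 0 < s \<and> s < l then ennreal (lam s h) else 0)"

abbreviation "fp \<equiv> first_points loc"
abbreviation "np \<equiv> next_point loc"
abbreviation "lt \<equiv> last_time loc"
abbreviation "surv h t \<equiv> ennreal (exp_neg (cumul (lamE h) (lt h) t))"

lemma sets_Q [measurable_cong]: "sets Q = sets PS"
  using cond_intensity by (simp add: has_cond_intensity_def)

lemma space_Q: "space Q = space PS"
  using sets_Q by (rule sets_eq_imp_space_eq)

lemma prob_space_Q: "prob_space Q"
  using cond_intensity by (simp add: has_cond_intensity_def)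

lemma measurable_lamE [measurable (raw)]:
  assumes [measurable]: "Y \<in> measurable M PS" "u \<in> borel_measurable M"
  shows "(\<lambda>a. lamE (Y a) (u a)) \<in> borel_measurable M"
proof -
  \<comment> \<open>A measurable retraction of the line onto (0, l). Its value l/2 outside is
    arbitrary and is masked by the case distinction below.\<close>
  define r where "r s = (if 0 < s \<and> s < l then s else l / 2)" for s
  have [measurable]: "r \<in> measurable borel (time_space l)"
    unfolding time_space_def r_def using l_pos by (intro measurable_restrict_space2) auto
  have "(\<lambda>a. lam (r (u a)) (Y a)) \<in> borel_measurable M"
    using measurable_compose[OF measurable_Pair[of "\<lambda>a. r (u a)" M "time_space l" Y PS] lam_measurable] by simp
  then have "(\<lambda>a. if 0 < u a \<and> u a < l then ennreal (lam (r (u a)) (Y a)) else 0) \<in> borel_measurable M"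
    by measurable
  also have "(\<lambda>a. if 0 < u a \<and> u a < l then ennreal (lam (r (u a)) (Y a)) else 0) = (\<lambda>a. lamE (Y a) (u a))"
    by (auto simp: lamE_def r_def)
  finally show ?thesis .
qed

lemma measurable_cumul_lamE [measurable (raw)]:
  assumes [measurable]: "Y \<in> measurable M PS" "u \<in> borel_measurable M" "v \<in> borel_measurable M"
  shows "(\<lambda>a. cumul (lamE (Y a)) (u a) (v a)) \<in> borel_measurable M"
proof -
  have "(\<lambda>a. \<integral>\<^sup>+s. (if u a < s \<and> s \<le> v a then lamE (Y a) s else 0) \<partial>lborel) \<in> borel_measurable M"
    by measurable
  also have "(\<lambda>a. \<integral>\<^sup>+s. (if u a < s \<and> s \<le> v a then lamE (Y a) s else 0) \<partial>lborel) = (\<lambda>a. cumul (lamE (Y a)) (u a) (v a))"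
    unfolding cumul_def by (intro ext nn_integral_cong) (auto simp: indicator_def)
  finally show ?thesis .
qed

lemma PS_points:
  assumes "y \<in> space PS"
  shows "finite y" "inj_on loc y" "\<And>p. p \<in> y \<Longrightarrow> 0 < loc p \<and> loc p < l"
  using assms loc_range by (auto simp: space_patterns)

lemma last_time_less: "y \<in> space PS \<Longrightarrow> lt y < l"
  using PS_points[of y] l_pos by (auto simp: last_time_def)

lemma last_time_nonneg: "y \<in> space PS \<Longrightarrow> 0 \<le> lt y"
  using PS_points[of y] by (auto simp: last_time_def)

text \<open>Given the first \<open>n\<close> points, the waiting time has by
  \<open>hazard_law\<close> an atom of mass \<open>surv h l\<close> at \<open>l\<close> and the
  density \<open>lamE h t * surv h t\<close> before. The atom gives the first formula, the density
  the second. Both are integrals over all of \<open>Q\<close>, restricted through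
  \<open>card y\<close>, so they can be iterated over \<open>n\<close>.\<close>

lemma next_event:
  fixes n :: nat
  defines "h \<equiv> fp n"
  shows "G \<in> borel_measurable PS \<Longrightarrow>
     (\<integral>\<^sup>+y. (if card y = n then G (h y) else 0) \<partial>Q) =
     (\<integral>\<^sup>+y. (if n \<le> card y then G (h y) * surv (h y) l else 0) \<partial>Q)"
   and "F \<in> borel_measurable (PS \<Otimes>\<^sub>M borel) \<Longrightarrow>
     (\<integral>\<^sup>+y. (if n < card y then F (h y, loc (np n y)) else 0) \<partial>Q) =
     (\<integral>\<^sup>+y. (if n \<le> card y then \<integral>\<^sup>+t. indicator {lt (h y)<..<l} t *
        (lamE (h y) t * surv (h y) t * F (h y, t)) \<partial>lborel else 0) \<partial>Q)"
proof -
  interpret Q: prob_space Q by (rule prob_space_Q)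
  obtain K where K: "cond_law Q (fp n) PS (\<lambda>y. y) PS K"
    and surv: "AE y in Q. n \<le> card y \<longrightarrow>
           (let h = fp n y; tn = lt h in
            \<forall>t. tn \<le> t \<and> t < l \<longrightarrow>
              measure (K h) {y' \<in> space PS. \<forall>p\<in>y'. loc p \<notin> {tn<..t}} =
              exp_neg (\<integral>\<^sup>+s\<in>{tn<..t}. ennreal (lam s h) \<partial>lborel))"
    using cond_intensity by (auto simp: has_cond_intensity_def)
  have ne: "space PS \<noteq> {}" using empty_in_patterns by blast
  obtain K' where K': "K' \<in> measurable PS (subprob_algebra PS)"
      "AE y in Q. K' (fp n y) = K (fp n y)"
      "\<And>F. F \<in> borel_measurable (PS \<Otimes>\<^sub>M PS) \<Longrightarrow>
       (\<integral>\<^sup>+y. F (fp n y, y) \<partial>Q) = (\<integral>\<^sup>+y. \<integral>\<^sup>+y'. F (fp n y, y') \<partial>K' (fp n y) \<partial>Q)"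
    by (rule cond_law_kernel[OF Q.finite_measure_axioms K ne]) blast
  note K' = K'[folded h_def] and K'_int = K'(3)[folded h_def]
  have h[measurable]: "h \<in> measurable Q PS" using K by (simp add: cond_law_def h_def)
  define nt where "nt h' = next_time loc l (lt h')" for h'
  have nt[measurable]: "(\<lambda>a. nt (f a) (g a)) \<in> borel_measurable M"
    if "f \<in> measurable M PS" "g \<in> measurable M PS" for f g and M :: "'c measure"
    unfolding nt_def using that by measurable
  have nt1: "nt h' \<in> borel_measurable PS" if "h' \<in> space PS" for h' using that by measurable
  \<comment> \<open>The event that there are at least \<open>n\<close> points can be read off from
    the history, so it may be treated as fixed when the kernel is integrated.\<close>
  have card_h: "card (h y) = n \<longleftrightarrow> n \<le> card y" if "y \<in> space PS" for y
    using PS_points[OF that] by (simp add: h_def card_first_points min_def)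
  have nt_h: "nt (h y) y = (if n < card y then loc (np n y) else l)" if "y \<in> space PS" for y
    using next_time_first_points[OF PS_points[OF that]] by (simp add: nt_def h_def)
  have next_loc: "loc (np n y) < l" if "y \<in> space PS" "n < card y" for y
    using next_point_rank[OF PS_points(1,2)[OF that(1)] that(2)] PS_points[OF that(1)] by auto
  let ?D = "\<lambda>y. distr (K' (h y)) borel (nt (h y))"
  let ?law = "\<lambda>y. emeasure (?D y) {l} = surv (h y) l \<and>
    (\<forall>F\<in>borel_measurable borel. (\<integral>\<^sup>+t. indicator {..<l} t * F t \<partial>?D y) =
      (\<integral>\<^sup>+t. indicator {lt (h y)<..<l} t * (lamE (h y) t * surv (h y) t * F t) \<partial>lborel))"
  have law: "AE y in Q. n \<le> card y \<longrightarrow> ?law y"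
    using K'(2) surv cond_law_AE_prob_space[OF Q.finite_measure_axioms K] AE_space
  proof eventually_elim
    case (elim y)
    have y: "y \<in> space PS" using elim space_Q by simp
    then have hy[measurable]: "h y \<in> space PS" using measurable_space[OF h] space_Q by simp
    interpret K: prob_space "K' (h y)" using elim by (simp add: h_def)
    have s[measurable_cong]: "sets (K' (h y)) = sets PS" using K'(1) hy by (rule sets_kernel)
    have sp: "space (K' (h y)) = space PS" using s by (rule sets_eq_imp_space_eq)
    have [measurable]: "nt (h y) \<in> borel_measurable (K' (h y))" 
      using nt1[OF hy] by (simp add: measurable_cong_sets[OF s refl])
    show ?case
    proof
      assume n: "n \<le> card y"
      have 1: "prob_space (?D y)" by (rule K.prob_space_distr) measurable
      have 2: "lt (h y) < l" using hy by (rule last_time_less)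
      have 3: "AE t in ?D y. lt (h y) < t \<and> t \<le> l"
      proof (subst AE_distr_iff)
        show "AE y' in K' (h y). lt (h y) < nt (h y) y' \<and> nt (h y) y' \<le> l"
        proof (rule AE_I2)
          fix y' assume "y' \<in> space (K' (h y))"
          then have "finite y'" using sp PS_points by simp
          then show "lt (h y) < nt (h y) y' \<and> nt (h y) y' \<le> l"
            unfolding nt_def using 2 by (auto simp: next_time_greater_iff next_time_le)
        qed
      qed auto
      have 4: "measure (?D y) {t<..} = exp_neg (cumul (lamE (h y)) (lt (h y)) t)"
        if t: "lt (h y) \<le> t" "t < l" for t
      proof -
        have "measure (?D y) {t<..} = measure (K' (h y)) (nt (h y) -` {t<..} \<inter> space (K' (h y)))"
          by (rule measure_distr) measurable
        \<comment> \<open>A void interval after the last known point is the event that the waiting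
          time exceeds \<open>t\<close>. Here \<open>t < l\<close> matters, as an empty remainder
          gives the waiting time \<open>l\<close>.\<close>
        also have "nt (h y) -` {t<..} \<inter> space (K' (h y)) = {y' \<in> space PS. \<forall>p\<in>y'. loc p \<notin> {lt (h y)<..t}}"
          unfolding sp using PS_points t by (auto simp: nt_def next_time_greater_iff)
        also have "measure (K' (h y)) \<dots> = exp_neg (\<integral>\<^sup>+s\<in>{lt (h y)<..t}. ennreal (lam s (h y)) \<partial>lborel)"
          using elim n t by (simp add: Let_def h_def)
        also have "(\<integral>\<^sup>+s\<in>{lt (h y)<..t}. ennreal (lam s (h y)) \<partial>lborel) = cumul (lamE (h y)) (lt (h y)) t"
          unfolding cumul_def using last_time_nonneg[OF hy] t
          by (intro nn_integral_cong) (auto simp: indicator_def lamE_def)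
        finally show ?thesis .
      qed
      have 5: "lamE (h y) \<in> borel_measurable borel" by measurable
      note law = hazard_law[OF 1 _ 2 5 3 4]
      show "?law y"
        using law by simp
    qed
  qed
  show "(\<integral>\<^sup>+y. (if card y = n then G (h y) else 0) \<partial>Q) =
     (\<integral>\<^sup>+y. (if n \<le> card y then G (h y) * surv (h y) l else 0) \<partial>Q)"
    if [measurable]: "G \<in> borel_measurable PS"
  proof -
    let ?F = "\<lambda>z. if card (fst z) = n \<and> nt (fst z) (snd z) = l then G (fst z) else 0"
    have "(\<integral>\<^sup>+y. (if card y = n then G (h y) else 0) \<partial>Q) = (\<integral>\<^sup>+y. ?F (h y, y) \<partial>Q)"
      using next_loc by (intro nn_integral_cong) (auto simp: space_Q card_h nt_h)
    also have "\<dots> = (\<integral>\<^sup>+y. \<integral>\<^sup>+y'. ?F (h y, y') \<partial>K' (h y) \<partial>Q)"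
      by (rule K'_int) measurable
    also have "\<dots> = (\<integral>\<^sup>+y. (if n \<le> card y then G (h y) * surv (h y) l else 0) \<partial>Q)"
    proof (rule nn_integral_cong_AE, use law AE_space in eventually_elim)
      case (elim y)
      have y: "y \<in> space PS" using elim space_Q by simp
      then have hy[measurable]: "h y \<in> space PS" using measurable_space[OF h] space_Q by simp
      have s[measurable_cong]: "sets (K' (h y)) = sets PS" using K'(1) hy by (rule sets_kernel)
      have [measurable]: "nt (h y) \<in> borel_measurable (K' (h y))" 
        using nt1[OF hy] by (simp add: measurable_cong_sets[OF s refl])
      show ?case
      proof (cases "n \<le> card y")
        case True
        have "(\<integral>\<^sup>+y'. ?F (h y, y') \<partial>K' (h y)) = (\<integral>\<^sup>+y'. G (h y) * indicator {l} (nt (h y) y') \<partial>K' (h y))"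
          using True y by (intro nn_integral_cong) (auto simp: card_h)
        also have "\<dots> = G (h y) * (\<integral>\<^sup>+y'. indicator {l} (nt (h y) y') \<partial>K' (h y))"
          by (rule nn_integral_cmult) measurable
        also have "(\<integral>\<^sup>+y'. indicator {l} (nt (h y) y') \<partial>K' (h y)) = (\<integral>\<^sup>+t. indicator {l} t \<partial>?D y)"
          by (rule nn_integral_distr[symmetric]) measurable
        also have "\<dots> = emeasure (?D y) {l}"
          by simp
        finally show ?thesis using elim True by simp
      next
        case False
        then show ?thesis using y by (simp add: card_h)
      qed
    qed
    finally show ?thesis .
  qed
  show "(\<integral>\<^sup>+y. (if n < card y then F (h y, loc (np n y)) else 0) \<partial>Q) =
     (\<integral>\<^sup>+y. (if n \<le> card y then \<integral>\<^sup>+t. indicator {lt (h y)<..<l} t *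
        (lamE (h y) t * surv (h y) t * F (h y, t)) \<partial>lborel else 0) \<partial>Q)"
    if [measurable]: "F \<in> borel_measurable (PS \<Otimes>\<^sub>M borel)"
  proof -
    let ?F = "\<lambda>z. if card (fst z) = n then indicator {..<l} (nt (fst z) (snd z)) * F (fst z, nt (fst z) (snd z)) else 0"
    have "(\<integral>\<^sup>+y. (if n < card y then F (h y, loc (np n y)) else 0) \<partial>Q) = (\<integral>\<^sup>+y. ?F (h y, y) \<partial>Q)"
      using next_loc by (intro nn_integral_cong) (auto simp: space_Q card_h nt_h)
    also have "\<dots> = (\<integral>\<^sup>+y. \<integral>\<^sup>+y'. ?F (h y, y') \<partial>K' (h y) \<partial>Q)"
      by (rule K'_int) measurable
    also have "\<dots> = (\<integral>\<^sup>+y. (if n \<le> card y then \<integral>\<^sup>+t. indicator {lt (h y)<..<l} t *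
        (lamE (h y) t * surv (h y) t * F (h y, t)) \<partial>lborel else 0) \<partial>Q)"
    proof (rule nn_integral_cong_AE, use law AE_space in eventually_elim)
      case (elim y)
      have y: "y \<in> space PS" using elim space_Q by simp
      then have hy[measurable]: "h y \<in> space PS" using measurable_space[OF h] space_Q by simp
      have s[measurable_cong]: "sets (K' (h y)) = sets PS" using K'(1) hy by (rule sets_kernel)
      have [measurable]: "nt (h y) \<in> borel_measurable (K' (h y))" 
        using nt1[OF hy] by (simp add: measurable_cong_sets[OF s refl])
      show ?case
      proof (cases "n \<le> card y")
        case True
        have [measurable]: "(\<lambda>t. F (h y, t)) \<in> borel_measurable borel" by measurable
        have "(\<integral>\<^sup>+y'. ?F (h y, y') \<partial>K' (h y)) = (\<integral>\<^sup>+y'. indicator {..<l} (nt (h y) y') * F (h y, nt (h y) y') \<partial>K' (h y))"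
          using True y by (intro nn_integral_cong) (auto simp: card_h)
        also have "\<dots> = (\<integral>\<^sup>+t. indicator {..<l} t * F (h y, t) \<partial>?D y)"
          by (simp add: nn_integral_distr)
        finally show ?thesis using elim True by simp
      next
        case False
        then show ?thesis using y by (simp add: card_h)
      qed
    qed
    finally show ?thesis .
  qed
qed

end

text \<open>
  \<open>gam p h\<close> is the density, relative to \<open>S\<close>, at which a point \<open>p\<close> occurs when \<open>h\<close> is the set
  of points before it: the conditional intensity, times the mark density in the marked case.
\<close>

locale temporal_density = temporal_process +
  fixes gam :: "'a \<Rightarrow> 'a set \<Rightarrow> real"
  assumes gam_measurable: "(\<lambda>(p, h). gam p h) \<in> borel_measurable (S \<Otimes>\<^sub>M PS)"
    and gam_nonneg: "p \<in> space S \<Longrightarrow> h \<in> space PS \<Longrightarrow> 0 \<le> gam p h"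
    and next_law: "F \<in> borel_measurable (PS \<Otimes>\<^sub>M S) \<Longrightarrow>
      (\<integral>\<^sup>+y. (if n < card y then F (fp n y, np n y) else 0) \<partial>Q) =
      (\<integral>\<^sup>+y. (if n \<le> card y then \<integral>\<^sup>+p. (if lt (fp n y) < loc p then
         ennreal (gam p (fp n y)) *
         surv (fp n y) (loc p) *
         F (fp n y, p) else 0) \<partial>S else 0) \<partial>Q)"
begin

text \<open>Only the exponent is cut off at \<open>t\<close>; the product runs over all of
  \<open>y\<close>. With \<open>t = lt y\<close> this is the density for the first points of the
  process to be \<open>y\<close>, with \<open>t = l\<close> the density for \<open>y\<close> to be
  the whole pattern.\<close>

definition dens_until :: "'a set \<Rightarrow> real \<Rightarrow> ennreal" where
  "dens_until y t = ennreal (\<Prod>p\<in>y. gam p (hist loc y (loc p))) *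
     ennreal (exp_neg (cumul (\<lambda>s. lamE (hist loc y s) s) 0 t))"

lemma hist_in_PS: "y \<in> space PS \<Longrightarrow> hist loc y s \<in> space PS"
  by (rule subset_in_patterns) (auto simp: hist_def)

lemma measurable_dens_until [measurable (raw)]:
  assumes [measurable]: "Y \<in> measurable M PS" "t \<in> borel_measurable M"
  shows "(\<lambda>a. dens_until (Y a) (t a)) \<in> borel_measurable M"
proof -
  have "(\<lambda>z. gam (snd z) (hist loc (Y (fst z)) (loc (snd z)))) \<in> borel_measurable (M \<Otimes>\<^sub>M S)"
    using measurable_compose[OF measurable_Pair[of snd "M \<Otimes>\<^sub>M S" S "\<lambda>z. hist loc (Y (fst z)) (loc (snd z))" PS] gam_measurable]
    by simp
  then have [measurable]: "(\<lambda>a. \<Prod>p\<in>Y a. gam p (hist loc (Y a) (loc p))) \<in> borel_measurable M"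
  proof (intro measurable_pattern_prod[where S=S and loc=loc])
    fix a p assume a: "a \<in> space M" "p \<in> Y a"
    then have "Y a \<in> space PS" by (auto intro: measurable_space)
    then show "0 \<le> gam p (hist loc (Y a) (loc p))"
      using a by (intro gam_nonneg hist_in_PS) (auto simp: space_patterns)
  qed (simp_all add: split_beta' assms(1))
  have "(\<lambda>a. \<integral>\<^sup>+s. (if 0 < s \<and> s \<le> t a then lamE (hist loc (Y a) s) s else 0) \<partial>lborel) \<in> borel_measurable M"
    by measurable
  also have "(\<lambda>a. \<integral>\<^sup>+s. (if 0 < s \<and> s \<le> t a then lamE (hist loc (Y a) s) s else 0) \<partial>lborel) =
     (\<lambda>a. cumul (\<lambda>s. lamE (hist loc (Y a) s) s) 0 (t a))"
    unfolding cumul_def by (intro ext nn_integral_cong) (auto simp: indicator_def)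
  finally have [measurable]: "(\<lambda>a. cumul (\<lambda>s. lamE (hist loc (Y a) s) s) 0 (t a)) \<in> borel_measurable M" .
  show ?thesis unfolding dens_until_def by measurable
qed

lemma measurable_lamE_hist: "y \<in> space PS \<Longrightarrow> (\<lambda>s. lamE (hist loc y s) s) \<in> borel_measurable borel"
  by measurable

lemma hist_after_last: "y \<in> space PS \<Longrightarrow> lt y < s \<Longrightarrow> hist loc y s = y"
  using PS_points[of y] by (auto simp: hist_def last_time_def)

lemma dens_until_full:
  assumes y: "y \<in> space PS"
  shows "dens_until y l = dens_until y (lt y) * surv y l"
proof -
  have "cumul (\<lambda>s. lamE (hist loc y s) s) 0 l = cumul (\<lambda>s. lamE (hist loc y s) s) 0 (lt y) +
      cumul (\<lambda>s. lamE (hist loc y s) s) (lt y) l"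
    using last_time_nonneg[OF y] last_time_less[OF y] by (intro cumul_add measurable_lamE_hist y) auto
  also have "cumul (\<lambda>s. lamE (hist loc y s) s) (lt y) l = cumul (lamE y) (lt y) l"
    by (intro cumul_cong) (simp add: hist_after_last[OF y])
  finally show ?thesis by (simp add: dens_until_def exp_neg_add ennreal_mult mult.assoc)
qed

text \<open>Histories up to time \<open>loc p\<close> do not see \<open>p\<close>. Hence a new last
  point leaves all earlier factors unchanged and multiplies the density by its own hazard density
  given \<open>h\<close>.\<close>

lemma dens_until_insert:
  assumes h: "h \<in> space PS" and p: "p \<in> space S" and less: "\<forall>q\<in>h. loc q < loc p"
  shows "dens_until (insert p h) (lt (insert p h)) =
    dens_until h (lt h) * (ennreal (gam p h) * surv h (loc p))"
proof -
  let ?y = "insert p h"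
  have fin: "finite h" and ph: "p \<notin> h" using less PS_points[OF h] by auto
  have y: "?y \<in> space PS" using h p less by (intro insert_in_patterns) auto
  have p0: "0 < loc p" using loc_range[OF p] by simp
  have last_y: "lt ?y = loc p"
    unfolding last_time_def using fin less p0 by (intro Max_eqI) (auto intro: less_imp_le)
  have last_h: "lt h < loc p"
    using last_time_less_iff[OF fin PS_points(2)[OF h] subset_refl p0] less by simp
  have hist: "hist loc ?y s = hist loc h s" if "s \<le> loc p" for s
    using that by (auto simp: hist_def)
  have hist_p: "hist loc h (loc p) = h" using less by (auto simp: hist_def)
  have "(\<Prod>q\<in>?y. gam q (hist loc ?y (loc q))) = gam p h * (\<Prod>q\<in>h. gam q (hist loc ?y (loc q)))"
    using fin ph by (simp add: hist hist_p)
  also have "(\<Prod>q\<in>h. gam q (hist loc ?y (loc q))) = (\<Prod>q\<in>h. gam q (hist loc h (loc q)))"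
    using less by (intro prod.cong refl) (simp add: hist less_imp_le)
  finally have 1: "(\<Prod>q\<in>?y. gam q (hist loc ?y (loc q))) = gam p h * (\<Prod>q\<in>h. gam q (hist loc h (loc q)))" .
  have "cumul (\<lambda>s. lamE (hist loc ?y s) s) 0 (loc p) = cumul (\<lambda>s. lamE (hist loc h s) s) 0 (loc p)"
    by (intro cumul_cong) (simp add: hist)
  also have "\<dots> = cumul (\<lambda>s. lamE (hist loc h s) s) 0 (lt h) + cumul (\<lambda>s. lamE (hist loc h s) s) (lt h) (loc p)"
    using last_time_nonneg[OF h] last_h by (intro cumul_add measurable_lamE_hist h) auto
  also have "cumul (\<lambda>s. lamE (hist loc h s) s) (lt h) (loc p) = cumul (lamE h) (lt h) (loc p)"
    by (intro cumul_cong) (simp add: hist_after_last[OF h])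
  finally have 2: "cumul (\<lambda>s. lamE (hist loc ?y s) s) 0 (loc p) =
     cumul (\<lambda>s. lamE (hist loc h s) s) 0 (lt h) + cumul (lamE h) (lt h) (loc p)" .
  have 3: "0 \<le> gam p h" "0 \<le> (\<Prod>q\<in>h. gam q (hist loc h (loc q)))"
    using h p by (auto intro!: gam_nonneg prod_nonneg hist_in_PS simp: space_patterns)
  show ?thesis
    unfolding dens_until_def last_y 1 2 exp_neg_add using 3 by (simp add: ennreal_mult ac_simps)
qed

text \<open>The induction step appends the next point by \<open>next_law\<close>, absorbs its
  density by \<open>dens_until_insert\<close>, and removes the ordering constraint by
  \<open>PI_last_point\<close>, whose factor \<open>Suc n\<close> turns 1/n! into 1/(n+1)!.\<close>

lemma first_points_law:
  assumes "F \<in> borel_measurable PS"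
  shows "(\<integral>\<^sup>+y. (if n \<le> card y then F (fp n y) else 0) \<partial>Q) =
    ennreal (1 / fact n) * PI (space S) n (\<lambda>y. dens_until y (lt y) * F y)"
  using assms
proof (induction n arbitrary: F)
  case 0
  interpret Q: prob_space Q by (rule prob_space_Q)
  have "fp 0 y = {}" for y :: "'a set" by (simp add: first_points_def)
  then show ?case by (simp add: Q.emeasure_space_1 dens_until_def last_time_def)
next
  case (Suc n)
  note [measurable] = Suc.prems
  define Psi where "Psi h = (\<integral>\<^sup>+p. (if lt h < loc p then ennreal (gam p h) *
     surv h (loc p) * top_pt loc p F h else 0) \<partial>S)" for h
  have gam'[measurable]: "(\<lambda>z. gam (snd z) (fst z)) \<in> borel_measurable (PS \<Otimes>\<^sub>M S)"
    using measurable_compose[OF measurable_pair_swap' gam_measurable] by (simp add: split_beta')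
  have m: "(\<lambda>(h, p). top_pt loc p F h) \<in> borel_measurable (PS \<Otimes>\<^sub>M S)"
    unfolding split_beta' by measurable
  have [measurable]: "Psi \<in> borel_measurable PS"
    unfolding Psi_def by measurable
  \<comment> \<open>The next point is later than the first \<open>n\<close>, so the constraint built
    into \<open>top_pt\<close> holds automatically and may be inserted at no cost.\<close>
  have "(\<integral>\<^sup>+y. (if Suc n \<le> card y then F (fp (Suc n) y) else 0) \<partial>Q) =
    (\<integral>\<^sup>+y. (if n < card y then case (fp n y, np n y) of (h, p) \<Rightarrow> top_pt loc p F h else 0) \<partial>Q)"
  proof (intro nn_integral_cong)
    fix y assume "y \<in> space Q"
    then have y: "y \<in> space PS" by (simp add: space_Q)
    note pts = PS_points(1,2)[OF y]
    show "(if Suc n \<le> card y then F (fp (Suc n) y) else 0) =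
      (if n < card y then case (fp n y, np n y) of (h, p) \<Rightarrow> top_pt loc p F h else 0)"
      using first_points_Suc[OF pts, of n] first_points_less_next[OF pts, of n]
      by (auto simp: top_pt_def Suc_le_eq)
  qed
  also have "\<dots> = (\<integral>\<^sup>+y. (if n \<le> card y then Psi (fp n y) else 0) \<partial>Q)"
    unfolding Psi_def by (subst next_law[OF m], unfold prod.case, rule refl)
  also have "\<dots> = ennreal (1 / fact n) * PI (space S) n (\<lambda>h. dens_until h (lt h) * Psi h)"
    by (rule Suc.IH) measurable
  also have "PI (space S) n (\<lambda>h. dens_until h (lt h) * Psi h) =
    PI (space S) n (\<lambda>h. \<integral>\<^sup>+p. top_pt loc p (\<lambda>y. dens_until y (lt y) * F y) h \<partial>S)"
  proof (rule pat_integral_cong)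
    fix h assume h[measurable]: "h \<in> space PS"
    have [measurable]: "(\<lambda>p. gam p h) \<in> borel_measurable S"
      using measurable_compose[OF measurable_Pair1'[OF h] gam'] by simp
    have "dens_until h (lt h) * Psi h = (\<integral>\<^sup>+p. dens_until h (lt h) * 
       (if lt h < loc p then ennreal (gam p h) *
       surv h (loc p) * top_pt loc p F h else 0) \<partial>S)"
      unfolding Psi_def by (rule nn_integral_cmult[symmetric]) measurable
    also have "\<dots> = (\<integral>\<^sup>+p. top_pt loc p (\<lambda>y. dens_until y (lt y) * F y) h \<partial>S)"
    proof (rule nn_integral_cong)
      fix p assume p: "p \<in> space S"
      have "lt h < loc p \<longleftrightarrow> (\<forall>q\<in>h. loc q < loc p)"
        using last_time_less_iff[OF PS_points(1,2)[OF h] subset_refl] loc_range[OF p] by blast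
      then show "dens_until h (lt h) * (if lt h < loc p then ennreal (gam p h) *
       surv h (loc p) * top_pt loc p F h else 0) =
       top_pt loc p (\<lambda>y. dens_until y (lt y) * F y) h"
        using dens_until_insert[OF h p] by (simp add: top_pt_def mult.assoc)
    qed
    finally show "dens_until h (lt h) * Psi h =
      (\<integral>\<^sup>+p. top_pt loc p (\<lambda>y. dens_until y (lt y) * F y) h \<partial>S)" .
  qed
  also have "\<dots> = (\<integral>\<^sup>+p. PI (space S) n (top_pt loc p (\<lambda>y. dens_until y (lt y) * F y)) \<partial>S)"
  proof (rule PI_swap[symmetric])
    show "sigma_finite_measure S" ..
  qed measurable
  also have "\<dots> = (\<integral>\<^sup>+p. indicator (space S) p * PI (space S) n (top_pt loc p (\<lambda>y. dens_until y (lt y) * F y)) \<partial>S)"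
    by (intro nn_integral_cong) simp
  also have "ennreal (1 / fact n) * \<dots> = ennreal (1 / fact (Suc n)) * PI (space S) (Suc n) (\<lambda>y. dens_until y (lt y) * F y)"
  proof -
    have "ennreal (1 / fact n) = ennreal (1 / fact (Suc n) * real (Suc n))"
      by (simp add: fact_Suc del: of_nat_Suc)
    also have "\<dots> = ennreal (1 / fact (Suc n)) * of_nat (Suc n)"
      by (subst ennreal_mult) (auto simp: ennreal_of_nat_eq_real_of_nat simp del: fact_Suc of_nat_Suc)
    finally have c: "ennreal (1 / fact n) = ennreal (1 / fact (Suc n)) * of_nat (Suc n)" .
    show ?thesis unfolding c
      by (subst PI_last_point) (measurable, simp add: mult.assoc del: fact_Suc of_nat_Suc)
  qed
  finally show ?case .
qed

text \<open>On the event of exactly \<open>n\<close> points the first \<open>n\<close> are the whole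
  pattern, and the probability of no further point extends the exponent from the last point to
  \<open>l\<close>. Summation over \<open>n\<close> gives the law.\<close>

theorem temporal_janossy:
  assumes F[measurable]: "F \<in> borel_measurable PS"
  shows "(\<integral>\<^sup>+y. F y \<partial>Q) = pat_total loc S (space S) (\<lambda>y. dens_until y l * F y)"
proof -
  have fp: "fp (card y) y = y" if "y \<in> space PS" for y
    using PS_points[OF that] by (intro first_points_all) auto
  have [measurable]: "(\<lambda>y. F y * surv y l) \<in> borel_measurable PS"
    by measurable
  have n: "(\<integral>\<^sup>+y. (if card y = n then F y else 0) \<partial>Q) = ennreal (1 / fact n) * PI (space S) n (\<lambda>y. dens_until y l * F y)" for n
  proof -
    have "(\<integral>\<^sup>+y. (if card y = n then F y else 0) \<partial>Q) = (\<integral>\<^sup>+y. (if card y = n then F (fp n y) else 0) \<partial>Q)"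
      by (intro nn_integral_cong) (auto simp: space_Q fp)
    also have "\<dots> = (\<integral>\<^sup>+y. (if n \<le> card y then (\<lambda>h. F h * surv h l) (fp n y) else 0) \<partial>Q)"
      by (rule next_event(1)[OF F])
    also have "\<dots> = ennreal (1 / fact n) * PI (space S) n (\<lambda>y. dens_until y (lt y) * (F y * surv y l))"
      by (rule first_points_law) measurable
    also have "\<dots> = ennreal (1 / fact n) * PI (space S) n (\<lambda>y. dens_until y l * F y)"
      by (rule arg_cong2[where f="(*)", OF refl], rule pat_integral_cong) (simp add: dens_until_full ac_simps)
    finally show ?thesis .
  qed
  have "(\<integral>\<^sup>+y. F y \<partial>Q) = (\<integral>\<^sup>+y. (\<Sum>n. if card y = n then F y else 0) \<partial>Q)"
  proof (intro nn_integral_cong)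
    fix y
    have "(\<Sum>n. if card y = n then F y else 0) = (\<Sum>n\<in>{card y}. if card y = n then F y else 0)"
      by (rule suminf_finite) auto
    then show "F y = (\<Sum>n. if card y = n then F y else 0)" by simp
  qed
  also have "\<dots> = (\<Sum>n. \<integral>\<^sup>+y. (if card y = n then F y else 0) \<partial>Q)"
    by (rule nn_integral_suminf) measurable
  finally show ?thesis unfolding n pat_total_def .
qed

end

text \<open>In contrast, \<open>time_space l\<close> restricts \<open>borel\<close> and thus carries the zero measure.\<close>

definition time_measure :: "real \<Rightarrow> real measure" where
  "time_measure l = restrict_space lborel {0<..<l}"

lemma sets_time_measure [measurable_cong]: "sets (time_measure l) = sets (time_space l)"
  by (simp add: time_measure_def time_space_def sets_restrict_space)

lemma space_time_measure [simp]: "space (time_measure l) = {0<..<l}"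
  by (simp add: time_measure_def space_restrict_space)

lemma space_time_space [simp]: "space (time_space l) = {0<..<l}"
  by (simp add: time_space_def space_restrict_space)

lemma nn_integral_time_measure:
  "(\<integral>\<^sup>+t. F t \<partial>time_measure l) = (\<integral>\<^sup>+t. F t * indicator {0<..<l} t \<partial>lborel)"
  unfolding time_measure_def by (rule nn_integral_restrict_space) simp

lemma sigma_finite_time_measure: "sigma_finite_measure (time_measure l)"
proof -
  have "emeasure lborel {0<..<l} < \<infinity>" by (cases "0 \<le> l") auto
  then have "finite_measure (time_measure l)"
    by (intro finite_measureI) (simp add: time_measure_def emeasure_restrict_space space_restrict_space)
  then show ?thesis by (rule finite_measure.axioms)
qed

lemma measurable_time_space_ident: "(\<lambda>t. t) \<in> borel_measurable (time_measure l)"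
  "(\<lambda>t. t) \<in> borel_measurable (time_space l)"
  unfolding time_measure_def time_space_def by (auto intro: measurable_restrict_space1)

section \<open>Unmarked and marked processes as instances of one density scheme\<close>

lemma (in temporal_process) next_event_time:
  assumes F: "F \<in> borel_measurable (PS \<Otimes>\<^sub>M time_space l)"
  shows "(\<integral>\<^sup>+y. (if n < card y then F (fp n y, loc (np n y)) else 0) \<partial>Q) =
     (\<integral>\<^sup>+y. (if n \<le> card y then \<integral>\<^sup>+t. (if lt (fp n y) < t then
        ennreal (lam t (fp n y)) *
        surv (fp n y) t *
        F (fp n y, t) else 0) \<partial>time_measure l else 0) \<partial>Q)"
proof -
  define r where "r s = (if 0 < s \<and> s < l then s else l / 2)" for s
  have [measurable]: "r \<in> measurable borel (time_space l)"
    unfolding time_space_def r_def using l_pos by (intro measurable_restrict_space2) auto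
  define G where "G = (\<lambda>(h, t). F (h, r t))"
  have G: "G \<in> borel_measurable (PS \<Otimes>\<^sub>M borel)" unfolding G_def using F by measurable
  have GF: "G (h, t) = F (h, t)" if "0 < t" "t < l" for h t using that by (simp add: G_def r_def)
  have "(\<integral>\<^sup>+y. (if n < card y then F (fp n y, loc (np n y)) else 0) \<partial>Q) =
      (\<integral>\<^sup>+y. (if n < card y then G (fp n y, loc (np n y)) else 0) \<partial>Q)"
  proof (intro nn_integral_cong)
    fix y assume "y \<in> space Q"
    then have "y \<in> space PS" by (simp add: space_Q)
    note pts = PS_points[OF this]
    have "n < card y \<Longrightarrow> 0 < loc (np n y) \<and> loc (np n y) < l"
      using next_point_rank[OF pts(1,2), of n] pts(3) by blast
    then show "(if n < card y then F (fp n y, loc (np n y)) else 0) =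
       (if n < card y then G (fp n y, loc (np n y)) else 0)"
      by (simp add: GF)
  qed
  also note next_event(2)[OF G]
  also have "(\<integral>\<^sup>+y. (if n \<le> card y then \<integral>\<^sup>+t. indicator {lt (fp n y)<..<l} t *
        (lamE (fp n y) t * surv (fp n y) t *
         G (fp n y, t)) \<partial>lborel else 0) \<partial>Q) =
     (\<integral>\<^sup>+y. (if n \<le> card y then \<integral>\<^sup>+t. (if lt (fp n y) < t then
        ennreal (lam t (fp n y)) *
        surv (fp n y) t *
        F (fp n y, t) else 0) \<partial>time_measure l else 0) \<partial>Q)"
  proof (intro nn_integral_cong if_cong refl)
    fix y assume "y \<in> space Q"
    then have y: "y \<in> space PS" by (simp add: space_Q)
    have "fp n y \<in> space PS"
      using y by (rule subset_in_patterns) (auto simp: first_points_def)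
    then have "0 \<le> lt (fp n y)" by (rule last_time_nonneg)
    then show "(\<integral>\<^sup>+t. indicator {lt (fp n y)<..<l} t *
        (lamE (fp n y) t * surv (fp n y) t *
         G (fp n y, t)) \<partial>lborel) =
      (\<integral>\<^sup>+t. (if lt (fp n y) < t then
        ennreal (lam t (fp n y)) *
        surv (fp n y) t *
        F (fp n y, t) else 0) \<partial>time_measure l)"
      unfolding nn_integral_time_measure by (intro nn_integral_cong) (auto simp: indicator_def lamE_def GF)
  qed
  finally show ?thesis .
qed

lemma temporal_density_unmarked:
  assumes l: "0 < l" and hc: "has_cond_intensity (\<lambda>t. t) (time_space l) l lam Q"
    and lam: "(\<lambda>(s, h). lam s h) \<in> borel_measurable (time_space l \<Otimes>\<^sub>M patterns (\<lambda>t. t) (time_space l))"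
    and nonneg: "\<And>s h. 0 < s \<Longrightarrow> s < l \<Longrightarrow> h \<in> space (patterns (\<lambda>t. t) (time_space l)) \<Longrightarrow> 0 \<le> lam s h"
  shows "temporal_density (time_measure l) (\<lambda>t. t) l lam Q lam"
proof -
  have PS: "patterns (\<lambda>t. t) (time_measure l) = patterns (\<lambda>t. t) (time_space l)"
    by (rule patterns_cong) (rule sets_time_measure)
  interpret sigma_finite_measure "time_measure l" by (rule sigma_finite_time_measure)
  interpret temporal_process "time_measure l" "\<lambda>t. t" l lam Q
  proof unfold_locales
    show "has_cond_intensity (\<lambda>t. t) (time_measure l) l lam Q"
      using hc has_cond_intensity_cong[OF sets_time_measure] by blast
  qed (use l lam nonneg in \<open>auto simp: PS measurable_time_space_ident\<close>)
  have sets_eq: "sets (time_measure l \<Otimes>\<^sub>M PS) = sets (time_space l \<Otimes>\<^sub>M patterns (\<lambda>t. t) (time_space l))"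
    unfolding PS by (rule sets_pair_measure_cong[OF sets_time_measure refl])
  show ?thesis
  proof unfold_locales
    show "(\<lambda>(p, h). lam p h) \<in> borel_measurable (time_measure l \<Otimes>\<^sub>M PS)"
      using lam unfolding measurable_cong_sets[OF sets_eq refl] .
    show "0 \<le> lam p h" if "p \<in> space (time_measure l)" "h \<in> space PS" for p h
      using that nonneg by (simp add: PS)
    fix F :: "real set \<times> real \<Rightarrow> ennreal" and n
    assume "F \<in> borel_measurable (PS \<Otimes>\<^sub>M time_measure l)"
    then have "F \<in> borel_measurable (PS \<Otimes>\<^sub>M time_space l)" by measurable
    from next_event_time[OF this, of n]
    show "(\<integral>\<^sup>+y. (if n < card y then F (fp n y, np n y) else 0) \<partial>Q) =
      (\<integral>\<^sup>+y. (if n \<le> card y then \<integral>\<^sup>+p. (if lt (fp n y) < p then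
         ennreal (lam p (fp n y)) *
         surv (fp n y) p *
         F (fp n y, p) else 0) \<partial>time_measure l else 0) \<partial>Q)" .
  qed
qed

text \<open>The mark is integrated out first: \<open>Phi (h, t)\<close> is the mean of
  \<open>F\<close> over the mark of a next point at \<open>t\<close>, which reduces the law of the
  next marked point to the law of its time. Tonelli then merges time and mark, and the density
  becomes the product of intensity and mark density.\<close>

lemma temporal_density_marked:
  fixes nu :: "'m measure"
  assumes l: "0 < l" and nu: "sigma_finite_measure nu"
    and hc: "has_cond_intensity fst (time_space l \<Otimes>\<^sub>M nu) l lam Q"
    and lam: "(\<lambda>(s, h). lam s h) \<in> borel_measurable (time_space l \<Otimes>\<^sub>M patterns fst (time_space l \<Otimes>\<^sub>M nu))"
    and nonneg: "\<And>s h. 0 < s \<Longrightarrow> s < l \<Longrightarrow> h \<in> space (patterns fst (time_space l \<Otimes>\<^sub>M nu)) \<Longrightarrow> 0 \<le> lam s h"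
    and md: "has_mark_density l nu f Q"
    and f: "(\<lambda>(m, s, h). f m s h) \<in> borel_measurable (nu \<Otimes>\<^sub>M (time_space l \<Otimes>\<^sub>M patterns fst (time_space l \<Otimes>\<^sub>M nu)))"
    and f_nonneg: "\<And>m s h. m \<in> space nu \<Longrightarrow> 0 < s \<Longrightarrow> s < l \<Longrightarrow> h \<in> space (patterns fst (time_space l \<Otimes>\<^sub>M nu)) \<Longrightarrow> 0 \<le> f m s h"
  shows "temporal_density (time_measure l \<Otimes>\<^sub>M nu) fst l lam Q (\<lambda>p h. lam (fst p) h * f (snd p) (fst p) h)"
proof -
  have sets_eq[measurable_cong]: "sets (time_measure l \<Otimes>\<^sub>M nu) = sets (time_space l \<Otimes>\<^sub>M nu)"
    by (rule sets_pair_measure_cong[OF sets_time_measure refl])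
  have PS: "patterns fst (time_measure l \<Otimes>\<^sub>M nu) = patterns fst (time_space l \<Otimes>\<^sub>M nu)"
    by (rule patterns_cong) (rule sets_eq)
  interpret nu: sigma_finite_measure nu by fact
  interpret T: sigma_finite_measure "time_measure l" by (rule sigma_finite_time_measure)
  interpret pair_sigma_finite "time_measure l" nu ..
  interpret temporal_process "time_measure l \<Otimes>\<^sub>M nu" fst l lam Q
  proof unfold_locales
    show "fst \<in> borel_measurable (time_measure l \<Otimes>\<^sub>M nu)"
      by (rule measurable_compose[OF measurable_fst measurable_time_space_ident(1)])
    show "has_cond_intensity fst (time_measure l \<Otimes>\<^sub>M nu) l lam Q"
      using hc has_cond_intensity_cong[OF sets_eq] by blast
  qed (use l lam nonneg in \<open>auto simp: PS space_pair_measure\<close>)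
  note lam[folded PS, measurable]
  have f_measurable[measurable (raw)]: "(\<lambda>a. f (m a) (t a) (h a)) \<in> borel_measurable M"
    if "m \<in> measurable M nu" "t \<in> measurable M (time_space l)" "h \<in> measurable M PS" for m t h and M :: "'c measure"
    using measurable_compose[OF measurable_Pair[OF that(1) measurable_Pair[OF that(2,3)]] f[folded PS]] by simp
  interpret Q: prob_space Q by (rule prob_space_Q)
  show ?thesis
  proof unfold_locales
    show "(\<lambda>(p, h). lam (fst p) h * f (snd p) (fst p) h) \<in> borel_measurable ((time_measure l \<Otimes>\<^sub>M nu) \<Otimes>\<^sub>M PS)"
    proof -
      have "(\<lambda>z. lam (fst (fst z)) (snd z)) \<in> borel_measurable ((time_measure l \<Otimes>\<^sub>M nu) \<Otimes>\<^sub>M PS)"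
        by measurable
      moreover have "(\<lambda>z. f (snd (fst z)) (fst (fst z)) (snd z)) \<in> borel_measurable ((time_measure l \<Otimes>\<^sub>M nu) \<Otimes>\<^sub>M PS)"
        by measurable
      ultimately show ?thesis by (simp add: split_beta')
    qed
    show "0 \<le> lam (fst p) h * f (snd p) (fst p) h" if "p \<in> space (time_measure l \<Otimes>\<^sub>M nu)" "h \<in> space PS" for p h
      using that nonneg f_nonneg by (auto simp: PS space_pair_measure)
    fix F :: "(real \<times> 'm) set \<times> (real \<times> 'm) \<Rightarrow> ennreal" and n
    assume "F \<in> borel_measurable (PS \<Otimes>\<^sub>M (time_measure l \<Otimes>\<^sub>M nu))"
    then have F[measurable]: "F \<in> borel_measurable (PS \<Otimes>\<^sub>M (time_space l \<Otimes>\<^sub>M nu))"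
      by (simp add: measurable_cong_sets[OF sets_pair_measure_cong[OF refl sets_eq] refl])
    define Phi where "Phi = (\<lambda>(h, t). \<integral>\<^sup>+m. ennreal (f m t h) * F (h, (t, m)) \<partial>nu)"
    have [measurable]: "Phi \<in> borel_measurable (PS \<Otimes>\<^sub>M time_space l)"
      unfolding Phi_def by measurable
    have "(\<integral>\<^sup>+y. (if n < card y then F (fp n y, np n y) else 0) \<partial>Q) = 
      (\<integral>\<^sup>+y. (if n < card y then Phi (fp n y, fst (np n y)) else 0) \<partial>Q)"
    \<comment> \<open>Without marks every pattern is empty. In the other case the mark space is a
      nonempty target, as \<open>cond_law_kernel\<close> requires.\<close>
    proof (cases "space nu = {}")
      case True
      have "y = {}" if "y \<in> space Q" for y
        using that True by (auto simp: space_Q space_patterns space_pair_measure)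
      then show ?thesis by (intro nn_integral_cong) (metis card.empty not_less_zero)
    next
      case False
      define A where "A = {y \<in> space Q. n < card y}"
      have A[measurable]: "A \<in> sets Q" unfolding A_def by measurable
      define R where "R = restrict_space Q A"
      have R: "finite_measure R" unfolding R_def
        by (rule finite_measureI) (simp add: emeasure_restrict_space space_restrict_space)
      have cl: "cond_law R (\<lambda>y. (fp n y, fst (np n y))) (PS \<Otimes>\<^sub>M time_space l) (\<lambda>y. snd (np n y)) nu
          (\<lambda>(h, t). density nu (\<lambda>m. ennreal (f m t h)))"
        using md unfolding has_mark_density_def R_def A_def PS by blast
      obtain K' where K': "AE y in R. K' (fp n y, fst (np n y)) = density nu (\<lambda>m. ennreal (f m (fst (np n y)) (fp n y)))"
        and K'_int: "\<And>G. G \<in> borel_measurable ((PS \<Otimes>\<^sub>M time_space l) \<Otimes>\<^sub>M nu) \<Longrightarrow>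
          (\<integral>\<^sup>+y. G ((fp n y, fst (np n y)), snd (np n y)) \<partial>R) = (\<integral>\<^sup>+y. \<integral>\<^sup>+m. G ((fp n y, fst (np n y)), m) \<partial>K' (fp n y, fst (np n y)) \<partial>R)"
        by (rule cond_law_kernel[OF R cl False]) auto
      have restr: "(\<integral>\<^sup>+y. (if n < card y then G y else 0) \<partial>Q) = (\<integral>\<^sup>+y. G y \<partial>R)" for G :: "_ \<Rightarrow> ennreal"
      proof -
        have "(\<integral>\<^sup>+y. G y \<partial>R) = (\<integral>\<^sup>+y. G y * indicator A y \<partial>Q)"
          unfolding R_def by (rule nn_integral_restrict_space) simp
        also have "\<dots> = (\<integral>\<^sup>+y. (if n < card y then G y else 0) \<partial>Q)"
          by (intro nn_integral_cong) (simp add: A_def)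
        finally show ?thesis by simp
      qed
      define G where "G = (\<lambda>((h, t), m). F (h, (t, m)))"
      have G[measurable]: "G \<in> borel_measurable ((PS \<Otimes>\<^sub>M time_space l) \<Otimes>\<^sub>M nu)"
        unfolding G_def split_beta' by measurable
      have "(\<integral>\<^sup>+y. F (fp n y, np n y) \<partial>R) = (\<integral>\<^sup>+y. G ((fp n y, fst (np n y)), snd (np n y)) \<partial>R)"
        by (simp add: G_def)
      also note K'_int[OF G]
      also have "(\<integral>\<^sup>+y. \<integral>\<^sup>+m. G ((fp n y, fst (np n y)), m) \<partial>K' (fp n y, fst (np n y)) \<partial>R) = (\<integral>\<^sup>+y. Phi (fp n y, fst (np n y)) \<partial>R)"
      proof (rule nn_integral_cong_AE, use K' AE_space in eventually_elim)
        case (elim y)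
        have "(\<lambda>y. (fp n y, fst (np n y))) \<in> measurable R (PS \<Otimes>\<^sub>M time_space l)" using cl by (simp add: cond_law_def)
        from measurable_space[OF this elim(2)]
        have [measurable]: "fp n y \<in> space PS" "fst (np n y) \<in> space (time_space l)"
          by (auto simp: space_pair_measure simp del: space_time_space)
        have [measurable]: "(\<lambda>m. f m (fst (np n y)) (fp n y)) \<in> borel_measurable nu" by measurable
        have "(\<integral>\<^sup>+m. G ((fp n y, fst (np n y)), m) \<partial>K' (fp n y, fst (np n y))) =
          (\<integral>\<^sup>+m. ennreal (f m (fst (np n y)) (fp n y)) * G ((fp n y, fst (np n y)), m) \<partial>nu)"
          unfolding elim(1) by (rule nn_integral_density) measurable
        then show ?case by (simp add: Phi_def G_def)
      qed
      finally show ?thesis unfolding restr .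
    qed
    also have "\<dots> = (\<integral>\<^sup>+y. (if n \<le> card y then \<integral>\<^sup>+t. (if lt (fp n y) < t then
        ennreal (lam t (fp n y)) * surv (fp n y) t *
        Phi (fp n y, t) else 0) \<partial>time_measure l else 0) \<partial>Q)"
      by (rule next_event_time) measurable
    also have "\<dots> = (\<integral>\<^sup>+y. (if n \<le> card y then \<integral>\<^sup>+p. (if lt (fp n y) < fst p then
         ennreal (lam (fst p) (fp n y) * f (snd p) (fst p) (fp n y)) *
         surv (fp n y) (fst p) *
         F (fp n y, p) else 0) \<partial>(time_measure l \<Otimes>\<^sub>M nu) else 0) \<partial>Q)"
    proof (intro nn_integral_cong if_cong refl)
      fix y assume "y \<in> space Q"
      then have "y \<in> space PS" by (simp add: space_Q)
      then have h: "fp n y \<in> space PS"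
        by (rule subset_in_patterns) (auto simp: first_points_def)
      define h where "h = fp n y"
      note h[folded h_def, measurable]
      have [measurable]: "(\<lambda>z. lam (fst z) h) \<in> borel_measurable (time_measure l \<Otimes>\<^sub>M nu)"
        "(\<lambda>z. f (snd z) (fst z) h) \<in> borel_measurable (time_measure l \<Otimes>\<^sub>M nu)" by measurable
      have "(\<lambda>p. (if lt h < fst p then ennreal (lam (fst p) h * f (snd p) (fst p) h) *
         surv h (fst p) * F (h, p) else 0)) \<in> borel_measurable (time_measure l \<Otimes>\<^sub>M nu)"
        by measurable
      from nu.nn_integral_fst[OF this]
      have "(\<integral>\<^sup>+p. (if lt h < fst p then ennreal (lam (fst p) h * f (snd p) (fst p) h) *
         surv h (fst p) * F (h, p) else 0) \<partial>(time_measure l \<Otimes>\<^sub>M nu)) =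
        (\<integral>\<^sup>+t. \<integral>\<^sup>+m. (if lt h < t then ennreal (lam t h * f m t h) *
         surv h t * F (h, (t, m)) else 0) \<partial>nu \<partial>time_measure l)"
        unfolding fst_conv snd_conv by (rule sym)
      also have "\<dots> = (\<integral>\<^sup>+t. (if lt h < t then ennreal (lam t h) * surv h t *
        Phi (h, t) else 0) \<partial>time_measure l)"
      proof (rule nn_integral_cong)
        fix t assume t: "t \<in> space (time_measure l)"
        then have [measurable]: "t \<in> space (time_space l)" by simp
        have l0: "0 \<le> lam t h" using nonneg[of t h] h t by (simp add: PS h_def)
        have [measurable]: "(\<lambda>m. f m t h) \<in> borel_measurable nu" by measurable
        have "(\<integral>\<^sup>+m. ennreal (lam t h * f m t h) * surv h t * F (h, (t, m)) \<partial>nu) =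
          (\<integral>\<^sup>+m. ennreal (lam t h) * surv h t * (ennreal (f m t h) * F (h, (t, m))) \<partial>nu)"
          using l0 by (intro nn_integral_cong) (simp add: ennreal_mult' ac_simps)
        also have "\<dots> = ennreal (lam t h) * surv h t * Phi (h, t)"
          unfolding Phi_def prod.case by (rule nn_integral_cmult) measurable
        finally show "(\<integral>\<^sup>+m. (if lt h < t then ennreal (lam t h * f m t h) *
          surv h t * F (h, (t, m)) else 0) \<partial>nu) =
          (if lt h < t then ennreal (lam t h) * surv h t * Phi (h, t) else 0)"
          by simp
      qed
      finally show "(\<integral>\<^sup>+t. (if lt (fp n y) < t then ennreal (lam t (fp n y)) * surv (fp n y) t *
        Phi (fp n y, t) else 0) \<partial>time_measure l) =
        (\<integral>\<^sup>+p. (if lt (fp n y) < fst p then ennreal (lam (fst p) (fp n y) * f (snd p) (fst p) (fp n y)) *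
         surv (fp n y) (fst p) * F (fp n y, p) else 0) \<partial>(time_measure l \<Otimes>\<^sub>M nu))"
        unfolding h_def ..
    qed
    finally show "(\<integral>\<^sup>+y. (if n < card y then F (fp n y, np n y) else 0) \<partial>Q) =
      (\<integral>\<^sup>+y. (if n \<le> card y then \<integral>\<^sup>+p. (if lt (fp n y) < fst p then
         ennreal (lam (fst p) (fp n y) * f (snd p) (fst p) (fp n y)) *
         surv (fp n y) (fst p) *
         F (fp n y, p) else 0) \<partial>(time_measure l \<Otimes>\<^sub>M nu) else 0) \<partial>Q)" .
  qed
qed

section \<open>Geometry of linear networks\<close>

context
  fixes L :: "'a::euclidean_space network"
  assumes net: "linear_network L"
begin

lemma seg_nondegenerate: "i < length L \<Longrightarrow> seg_end L i \<noteq> seg_start L i"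
  using net by (auto simp: linear_network_def)

lemma seg_length_pos: "i < length L \<Longrightarrow> 0 < seg_length L i"
  using seg_nondegenerate by (simp add: seg_length_def)

lemma seg_image: "i < length L \<Longrightarrow> seg L i = seg_param L i ` {0<..<seg_length L i}"
  using net seg_eq[of L i] by (simp add: linear_network_def subseg_def)

lemma seg_disjoint: "i < length L \<Longrightarrow> j < length L \<Longrightarrow> i \<noteq> j \<Longrightarrow> seg L i \<inter> seg L j = {}"
  using net by (simp add: linear_network_def)

lemma norm_seg_param: "i < length L \<Longrightarrow> norm (seg_param L i t - seg_start L i) = \<bar>t\<bar>"
  using seg_nondegenerate by (simp add: seg_param_def)

lemma seg_param_eq_iff:
  assumes "i < length L" shows "seg_param L i s = seg_param L i t \<longleftrightarrow> s = t"
proof -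
  have "seg_end L i - seg_start L i \<noteq> 0" using seg_nondegenerate[OF assms] by simp
  then show ?thesis by (auto simp: seg_param_def)
qed

lemma seg_param_in_seg:
  "i < length L \<Longrightarrow> 0 < t \<Longrightarrow> t < seg_length L i \<Longrightarrow> seg_param L i t \<in> seg L i"
  by (auto simp: seg_image)

lemma seg_borel: "seg L i \<in> sets borel"
proof -
  have "closed_segment a b - {a, b} \<in> sets borel" for a b :: 'a
    by (intro sets.Diff borel_closed closed_segment) (auto intro: finite_imp_closed)
  then show ?thesis by (simp add: seg_def open_segment_def)
qed

lemma upstream_borel: "upstream L i \<in> sets borel"
  unfolding upstream_def using seg_borel by (intro sets.finite_UN) auto

lemma earlier_borel: "earlier L omega k \<in> sets borel"
  unfolding earlier_def using seg_borel by (intro sets.finite_UN) auto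

lemma net_union_borel: "net_union L \<in> sets borel"
  unfolding net_union_def using seg_borel by (intro sets.finite_UN) auto

lemma past_seg_param:
  assumes i: "i < length L" and t: "0 < t" "t < seg_length L i"
  shows "past L (seg_param L i t) = subseg L i 0 t \<union> upstream L i"
proof -
  have "subseg L j 0 s \<union> upstream L j = subseg L i 0 t \<union> upstream L i"
    if "j < length L" "0 < s" "s < seg_length L j" "seg_param L i t = seg_param L j s" for j s
  proof -
    have "seg_param L i t \<in> seg L i \<inter> seg L j"
      using seg_param_in_seg[OF i t] seg_param_in_seg[OF that(1-3)] that(4) by simp
    then have "j = i" using seg_disjoint[OF i that(1)] by auto
    then show ?thesis using that seg_param_eq_iff[OF i] by auto
  qed
  then show ?thesis using assms unfolding past_def by blast
qed

lemma mem_subseg_iff: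
  assumes i: "i < length L" and t: "0 < t" "t < seg_length L i"
  shows "v \<in> subseg L i 0 t \<longleftrightarrow> v \<in> seg L i \<and> norm (v - seg_start L i) < t"
proof -
  have "norm (seg_param L i s - seg_start L i) < t \<longleftrightarrow> s < t" if "0 < s" for s
    using norm_seg_param[OF i] that by simp
  then show ?thesis unfolding subseg_def seg_image[OF i] using t by auto
qed

text \<open>Along a segment the time parameter is the distance from the starting point. The order on
  a segment thus becomes a comparison of norms, and \<open>past\<close> is described by conditions
  that are jointly Borel in \<open>u\<close> and \<open>v\<close>.\<close>

lemma mem_past_iff:
  "v \<in> past L u \<longleftrightarrow> (\<exists>i<length L. u \<in> seg L i \<and>
     (v \<in> seg L i \<and> norm (v - seg_start L i) < norm (u - seg_start L i) \<or> v \<in> upstream L i))"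
proof
  assume "v \<in> past L u"
  then obtain i t where i: "i < length L" "0 < t" "t < seg_length L i" "u = seg_param L i t"
    and v: "v \<in> subseg L i 0 t \<union> upstream L i" by (auto simp: past_def)
  show "\<exists>i<length L. u \<in> seg L i \<and>
     (v \<in> seg L i \<and> norm (v - seg_start L i) < norm (u - seg_start L i) \<or> v \<in> upstream L i)"
    using i v mem_subseg_iff[OF i(1-3)] seg_param_in_seg[OF i(1-3)] norm_seg_param[OF i(1)]
    by (intro exI[of _ i]) auto
next
  assume "\<exists>i<length L. u \<in> seg L i \<and>
     (v \<in> seg L i \<and> norm (v - seg_start L i) < norm (u - seg_start L i) \<or> v \<in> upstream L i)"
  then obtain i where i: "i < length L" "u \<in> seg L i"
    and v: "v \<in> seg L i \<and> norm (v - seg_start L i) < norm (u - seg_start L i) \<or> v \<in> upstream L i" by auto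
  obtain t where t: "0 < t" "t < seg_length L i" "u = seg_param L i t" using i by (auto simp: seg_image)
  show "v \<in> past L u"
    using v mem_subseg_iff[OF i(1) t(1,2)] norm_seg_param[OF i(1)] t past_seg_param[OF i(1) t(1,2)] by auto
qed

lemma measurable_mem_past:
  assumes [measurable]: "u \<in> borel_measurable M" "v \<in> borel_measurable M"
  shows "Measurable.pred M (\<lambda>a. v a \<in> past L (u a))"
proof -
  note [measurable] = seg_borel upstream_borel
  show ?thesis unfolding mem_past_iff by measurable
qed

section \<open>Admissible orders of the segments\<close>

context
  fixes omega :: "nat \<Rightarrow> nat"
  assumes omega: "omega \<in> admissible_orders L"
begin

lemma omega_bij: "bij_betw omega {..<length L} {..<length L}"
  using omega by (simp add: admissible_orders_def)

lemma omega_less: "k < length L \<Longrightarrow> omega k < length L"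
  using bij_betwE[OF omega_bij] by auto

lemma omega_eq_iff: "j < length L \<Longrightarrow> k < length L \<Longrightarrow> omega j = omega k \<longleftrightarrow> j = k"
  using omega_bij by (auto simp: bij_betw_def inj_on_def)

lemma earlier_Suc: "earlier L omega (Suc k) = earlier L omega k \<union> seg L (omega k)"
  by (auto simp: earlier_def less_Suc_eq)

lemma earlier_mono: "j \<le> k \<Longrightarrow> earlier L omega j \<subseteq> earlier L omega k"
  by (force simp: earlier_def)

lemma earlier_disjoint:
  assumes "k < length L" shows "earlier L omega k \<inter> seg L (omega k) = {}"
proof -
  have "seg L (omega j) \<inter> seg L (omega k) = {}" if "j < k" for j
    using that assms by (intro seg_disjoint omega_less) (auto simp: omega_eq_iff)
  then show ?thesis by (auto simp: earlier_def)
qed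

lemma earlier_all: "earlier L omega (length L) = net_union L"
proof -
  have "earlier L omega (length L) = (\<Union>i\<in>omega ` {..<length L}. seg L i)" by (simp add: earlier_def)
  then show ?thesis unfolding bij_betw_imp_surj_on[OF omega_bij] net_union_def .
qed

lemma upstream_earlier:
  assumes "k < length L" shows "upstream L (omega k) \<subseteq> earlier L omega k"
proof
  fix v assume "v \<in> upstream L (omega k)"
  then obtain j where j: "j < length L" "seg_before L j (omega k)" "v \<in> seg L j"
    by (auto simp: upstream_def)
  obtain m where m: "m < length L" "omega m = j"
    using bij_betw_imp_surj_on[OF omega_bij] j(1) by (metis imageE lessThan_iff)
  have "m < k" using omega j m assms by (auto simp: admissible_orders_def)
  then show "v \<in> earlier L omega k" using m j by (auto simp: earlier_def)
qed

text \<open>Admissibility of \<open>omega\<close> puts every upstream segment earlier, so each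
  initial stage is closed under taking pasts. This is why the density on the earlier segments
  ignores the points added later.\<close>

lemma past_earlier:
  assumes "k \<le> length L" "u \<in> earlier L omega k" shows "past L u \<subseteq> earlier L omega k"
proof
  fix v assume "v \<in> past L u"
  then obtain i where i: "i < length L" "u \<in> seg L i" "v \<in> seg L i \<or> v \<in> upstream L i"
    by (auto simp: mem_past_iff)
  obtain j where j: "j < k" "u \<in> seg L (omega j)" using assms(2) by (auto simp: earlier_def)
  have jN: "j < length L" using j assms by simp
  have "i = omega j" using seg_disjoint[OF i(1) omega_less[OF jN]] i(2) j(2) by auto
  then have "v \<in> earlier L omega (Suc j)"
    using i(3) upstream_earlier[OF jN] by (auto simp: earlier_Suc)
  then show "v \<in> earlier L omega k" using earlier_mono[of "Suc j" k] j by auto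
qed

end

section \<open>The length measure\<close>

lemma sets_length_measure_subset: "A \<in> sets borel \<Longrightarrow> A \<subseteq> net_union L \<Longrightarrow> A \<in> sets (length_measure L)"
  by (auto simp: sets_length_measure sets_restrict_space)

lemma measurable_length_measure_ident: "(\<lambda>u. u) \<in> borel_measurable (length_measure L)"
  by (subst measurable_cong_sets[OF sets_length_measure refl]) (rule measurable_restrict_space1, simp)

lemma seg_param_measurable_time:
  assumes i: "i < length L"
  shows "seg_param L i \<in> measurable (time_space (seg_length L i)) (length_measure L)"
proof (subst measurable_cong_sets[OF refl sets_length_measure], rule measurable_restrict_space2)
  show "seg_param L i \<in> space (time_space (seg_length L i)) \<rightarrow> net_union L"
    using i seg_param_in_seg by (force simp: net_union_def)
  show "seg_param L i \<in> borel_measurable (time_space (seg_length L i))"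
    by (rule measurable_compose[OF measurable_time_space_ident(2) seg_param_measurable])
qed

lemma finite_length_measure: "finite_measure (length_measure L)"
proof (rule finite_measureI)
  have "emeasure lborel {t \<in> {0<..<seg_length L i}. seg_param L i t \<in> net_union L} < \<infinity>" for i
  proof -
    have "emeasure lborel {t \<in> {0<..<seg_length L i}. seg_param L i t \<in> net_union L} \<le>
        emeasure lborel {0..seg_length L i}"
      by (intro emeasure_mono) auto
    also have "\<dots> < \<infinity>" by (simp add: emeasure_lborel_Icc_eq)
    finally show ?thesis .
  qed
  then show "emeasure (length_measure L) (space (length_measure L)) \<noteq> \<infinity>"
    by (subst emeasure_length_measure) (auto simp: space_length_measure[symmetric] less_top)
qed

text \<open>Each parametrisation meets \<open>c\<close> at most once, namely at the time given by
  the distance of \<open>c\<close> from the starting point.\<close>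

lemma AE_length_measure_neq: "AE u in length_measure L. u \<noteq> c"
proof (cases "c \<in> net_union L")
  case True
  have c: "{c} \<in> sets (length_measure L)" using True by (intro sets_length_measure_subset) auto
  have "emeasure lborel {t \<in> {0<..<seg_length L i}. seg_param L i t \<in> {c}} = 0" if "i < length L" for i
  proof -
    have "{t \<in> {0<..<seg_length L i}. seg_param L i t \<in> {c}} \<subseteq> {norm (c - seg_start L i)}"
      using norm_seg_param[OF that] by auto
    then have "countable {t \<in> {0<..<seg_length L i}. seg_param L i t \<in> {c}}"
      by (rule countable_subset) simp
    then show ?thesis by (rule emeasure_lborel_countable)
  qed
  then have "emeasure (length_measure L) {c} = 0"
    by (simp add: emeasure_length_measure[OF c])
  then show ?thesis using c by (intro AE_I[of _ _ "{c}"]) auto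
next
  case False
  then show ?thesis by (intro AE_I2) (auto simp: space_length_measure)
qed

text \<open>Of the summands that define \<open>length_measure\<close>, those of the other segments
  vanish on \<open>seg L i\<close> by disjointness; what remains is the image of Lebesgue measure
  under the parametrisation.\<close>

lemma nn_integral_length_measure_seg:
  assumes i: "i < length L" and F: "F \<in> borel_measurable (length_measure L)"
  shows "(\<integral>\<^sup>+u. indicator (seg L i) u * F u \<partial>length_measure L) =
    (\<integral>\<^sup>+t. F (seg_param L i t) \<partial>time_measure (seg_length L i))"
proof -
  have segM[measurable]: "seg L i \<in> sets (length_measure L)"
    using i seg_borel by (intro sets_length_measure_subset) (auto simp: net_union_def)
  have p[measurable]: "seg_param L i \<in> measurable (time_measure (seg_length L i)) (length_measure L)"
    using seg_param_measurable_time[OF i] by (simp add: measurable_cong_sets[OF sets_time_measure refl])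
  have "density (length_measure L) (indicator (seg L i)) = distr (time_measure (seg_length L i)) (length_measure L) (seg_param L i)"
  proof (rule measure_eqI)
    fix A assume "A \<in> sets (density (length_measure L) (indicator (seg L i)))"
    then have A[measurable]: "A \<in> sets (length_measure L)" by simp
    have "emeasure (density (length_measure L) (indicator (seg L i))) A = emeasure (length_measure L) (seg L i \<inter> A)"
      by (subst emeasure_density) (auto simp flip: indicator_inter_arith)
    also have "\<dots> = (\<Sum>j<length L. emeasure lborel {t \<in> {0<..<seg_length L j}. seg_param L j t \<in> seg L i \<inter> A})"
      by (rule emeasure_length_measure) measurable
    also have "\<dots> = (\<Sum>j<length L. if j = i then emeasure lborel {t \<in> {0<..<seg_length L i}. seg_param L i t \<in> A} else 0)"
    proof (intro sum.cong refl)
      fix j assume j: "j \<in> {..<length L}"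
      have "{t \<in> {0<..<seg_length L j}. seg_param L j t \<in> seg L i \<inter> A} =
        (if j = i then {t \<in> {0<..<seg_length L i}. seg_param L i t \<in> A} else {})"
        using j i seg_param_in_seg[of j] seg_disjoint[of j i] by auto
      then show "emeasure lborel {t \<in> {0<..<seg_length L j}. seg_param L j t \<in> seg L i \<inter> A} =
        (if j = i then emeasure lborel {t \<in> {0<..<seg_length L i}. seg_param L i t \<in> A} else 0)" by simp
    qed
    also have "\<dots> = emeasure lborel {t \<in> {0<..<seg_length L i}. seg_param L i t \<in> A}"
      using i by simp
    also have "\<dots> = emeasure (time_measure (seg_length L i)) {t \<in> {0<..<seg_length L i}. seg_param L i t \<in> A}"
      unfolding time_measure_def by (rule emeasure_restrict_space[symmetric]) auto
    also have "\<dots> = emeasure (distr (time_measure (seg_length L i)) (length_measure L) (seg_param L i)) A"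
      by (subst emeasure_distr) (auto intro!: arg_cong[where f="emeasure _"])
    finally show "emeasure (density (length_measure L) (indicator (seg L i))) A =
      emeasure (distr (time_measure (seg_length L i)) (length_measure L) (seg_param L i)) A" .
  qed simp
  then have "(\<integral>\<^sup>+u. F u \<partial>density (length_measure L) (indicator (seg L i))) =
     (\<integral>\<^sup>+u. F u \<partial>distr (time_measure (seg_length L i)) (length_measure L) (seg_param L i))" by simp
  then show ?thesis using F by (simp add: nn_integral_density nn_integral_distr)
qed

end

section \<open>Point processes on networks\<close>

text \<open>A common form of the two restrictions of a pattern to a set of locations: an
  intersection with \<open>B\<close> in the unmarked case, with the preimage of \<open>B\<close>
  under \<open>fst\<close> in the marked case.\<close>

definition located :: "('p \<Rightarrow> 'l) \<Rightarrow> 'l set \<Rightarrow> 'p set \<Rightarrow> 'p set" where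
  "located loc B y = {p \<in> y. loc p \<in> B}"

lemma located_in_patterns: "y \<in> space (patterns loc S) \<Longrightarrow> located loc' B y \<in> space (patterns loc S)"
  by (rule subset_in_patterns) (auto simp: located_def)

lemma pat_total_empty: "pat_total loc S {} F = F {}"
proof -
  have "pat_total loc S {} F = (\<Sum>n\<in>{0}. ennreal (1 / fact n) * pat_integral loc S {} n F)"
    unfolding pat_total_def
  proof (rule suminf_finite)
    fix n :: nat assume "n \<notin> {0}"
    then obtain m where "n = Suc m" by (cases n) auto
    then show "ennreal (1 / fact n) * pat_integral loc S {} n F = 0" by simp
  qed simp
  then show ?thesis by simp
qed

text \<open>
  Both cases of the theorem are instances: \<open>S\<close> is the length measure, or its product with the
  reference measure of the marks, and \<open>gam p y\<close> is the density of a point \<open>p\<close> given the points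
  \<open>y\<close> it may depend on. \<open>TS i\<close> and \<open>emb i\<close> are the time axis of the segment \<open>i\<close> and its embedding.
\<close>

locale segmentwise_process = pat_space S loc for S :: "'p measure" and loc :: "'p \<Rightarrow> 'a::euclidean_space" +
  fixes L :: "'a network" and omega :: "nat \<Rightarrow> nat"
    and lam :: "'a \<Rightarrow> 'p set \<Rightarrow> real" and gam :: "'p \<Rightarrow> 'p set \<Rightarrow> real"
    and P :: "'w measure" and X :: "'w \<Rightarrow> 'p set"
    and TS :: "nat \<Rightarrow> 'r measure" and tloc :: "'r \<Rightarrow> real" and emb :: "nat \<Rightarrow> 'r \<Rightarrow> 'p"
  assumes net: "linear_network L" and omega: "omega \<in> admissible_orders L"
    and loc_net_union: "p \<in> space S \<Longrightarrow> loc p \<in> net_union L"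
    and lam_measurable: "(\<lambda>(u, y). lam u y) \<in> borel_measurable (length_measure L \<Otimes>\<^sub>M PS)"
    and gam_measurable: "(\<lambda>(p, y). gam p y) \<in> borel_measurable (S \<Otimes>\<^sub>M PS)"
    and gam_nonneg: "p \<in> space S \<Longrightarrow> y \<in> space PS \<Longrightarrow> 0 \<le> gam p y"
    and prob_space_P: "prob_space P" and X [measurable]: "X \<in> measurable P PS"
    and TS: "i < length L \<Longrightarrow> pat_space (TS i) tloc"
    and tloc_range: "i < length L \<Longrightarrow> r \<in> space (TS i) \<Longrightarrow> 0 < tloc r \<and> tloc r < seg_length L i"
    and emb: "i < length L \<Longrightarrow> emb i \<in> measurable (TS i) S"
    and loc_emb: "i < length L \<Longrightarrow> r \<in> space (TS i) \<Longrightarrow> loc (emb i r) = seg_param L i (tloc r)"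
    and nn_integral_emb: "i < length L \<Longrightarrow> F \<in> borel_measurable S \<Longrightarrow>
      (\<integral>\<^sup>+p. indicator {p \<in> space S. loc p \<in> seg L i} p * F p \<partial>S) = (\<integral>\<^sup>+r. F (emb i r) \<partial>TS i)"
    and process: "k < length L \<Longrightarrow> i = omega k \<Longrightarrow> \<exists>Q. cond_law P
        (\<lambda>w. located loc (earlier L omega k) (X w)) PS (\<lambda>w. located loc (seg L i) (X w)) PS
        (\<lambda>h. distr (Q (located loc (upstream L i) h)) PS (\<lambda>y. emb i ` y)) \<and>
      (AE w in P. temporal_density (TS i) tloc (seg_length L i)
        (\<lambda>t h. lam (seg_param L i t) (located loc (upstream L i) (X w) \<union> emb i ` h))
        (Q (located loc (upstream L i) (X w)))
        (\<lambda>r h. gam (emb i r) (located loc (upstream L i) (X w) \<union> emb i ` h)))"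
begin

abbreviation "pts \<equiv> located loc"
abbreviation "gam_prod B y \<equiv> \<Prod>p\<in>pts B y. gam p (pts (past L (loc p)) y)"
abbreviation "lam_int B y \<equiv> \<integral>\<^sup>+u. indicator B u * ennreal (lam u (pts (past L u) y)) \<partial>length_measure L"

text \<open>Points and exponent are restricted to \<open>B\<close>, but histories are taken in the
  whole pattern. In this form the factors for disjoint sets multiply to the likelihood on their
  union.\<close>

definition dens :: "'a set \<Rightarrow> 'p set \<Rightarrow> ennreal" where
  "dens B y = ennreal (gam_prod B y) *
     ennreal (exp_neg (lam_int B y))"

lemma measurable_located [measurable (raw)]:
  assumes [measurable]: "B \<in> sets borel" "Y \<in> measurable M PS"
  shows "(\<lambda>a. pts B (Y a)) \<in> measurable M PS"
  unfolding located_def by measurable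

lemma measurable_located_past [measurable (raw)]:
  assumes [measurable]: "u \<in> borel_measurable M" "Y \<in> measurable M PS"
  shows "(\<lambda>a. pts (past L (u a)) (Y a)) \<in> measurable M PS"
proof -
  note measurable_mem_past[OF net, measurable (raw)]
  show ?thesis unfolding located_def by measurable
qed

lemma sigma_finite_length_measure: "sigma_finite_measure (length_measure L)"
  using finite_length_measure[OF net] by (rule finite_measure.axioms)

lemma measurable_lam [measurable (raw)]:
  assumes u[measurable]: "u \<in> measurable M (length_measure L)" and [measurable]: "Y \<in> measurable M PS"
  shows "(\<lambda>a. lam (u a) (Y a)) \<in> borel_measurable M"
  using measurable_compose[OF measurable_Pair lam_measurable, OF assms] by simp

lemma measurable_gam [measurable (raw)]:
  assumes [measurable]: "p \<in> measurable M S" "Y \<in> measurable M PS"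
  shows "(\<lambda>a. gam (p a) (Y a)) \<in> borel_measurable M"
  using measurable_compose[OF measurable_Pair gam_measurable, OF assms] by simp

lemma measurable_lam_past:
  assumes [measurable]: "Y \<in> measurable M PS"
  shows "(\<lambda>z. lam (snd z) (pts (past L (snd z)) (Y (fst z)))) \<in> borel_measurable (M \<Otimes>\<^sub>M length_measure L)"
proof -
  have [measurable]: "snd \<in> borel_measurable (M \<Otimes>\<^sub>M length_measure L)"
    by (rule measurable_compose[OF measurable_snd measurable_length_measure_ident[OF net]])
  show ?thesis by measurable
qed

lemma measurable_dens [measurable (raw)]:
  assumes B[measurable]: "B \<in> sets borel" and [measurable]: "Y \<in> measurable M PS"
  shows "(\<lambda>a. dens B (Y a)) \<in> borel_measurable M"
proof -
  interpret sigma_finite_measure "length_measure L" by (rule sigma_finite_length_measure)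
  have [measurable]: "(\<lambda>a. \<Prod>p\<in>pts B (Y a). gam p (pts (past L (loc p)) (Y a))) \<in> borel_measurable M"
  proof (rule measurable_pattern_prod[where S=S and loc=loc])
    fix a p assume a: "a \<in> space M" "p \<in> pts B (Y a)"
    then have "Y a \<in> space PS" by (auto intro: measurable_space)
    then show "0 \<le> gam p (pts (past L (loc p)) (Y a))"
      using a by (intro gam_nonneg located_in_patterns) (auto simp: space_patterns located_def)
  qed measurable
  have [measurable]: "(\<lambda>z. indicator B (snd z) :: ennreal) \<in> borel_measurable (M \<Otimes>\<^sub>M length_measure L)"
    by (rule measurable_compose[OF measurable_compose[OF measurable_snd measurable_length_measure_ident[OF net]] borel_measurable_indicator[OF B]])
  note measurable_lam_past[OF assms(2), measurable]
  show ?thesis unfolding dens_def by measurable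
qed

lemma dens_Un:
  assumes [measurable]: "B \<in> sets borel" "C \<in> sets borel" and disj: "B \<inter> C = {}" and y[measurable]: "y \<in> space PS"
  shows "dens (B \<union> C) y = dens B y * dens C y"
proof -
  have fin: "finite (pts B y)" "finite (pts C y)"
    using finite_patterns[OF y] by (auto simp: located_def)
  have "pts (B \<union> C) y = pts B y \<union> pts C y" by (auto simp: located_def)
  moreover have "pts B y \<inter> pts C y = {}" using disj by (auto simp: located_def)
  ultimately have 1: "gam_prod (B \<union> C) y =
    gam_prod B y * gam_prod C y"
    using fin by (simp add: prod.union_disjoint)
  have nn: "0 \<le> gam_prod B y" for B
    using y by (intro prod_nonneg gam_nonneg located_in_patterns ballI) (auto simp: space_patterns located_def)
  have [measurable]: "(\<lambda>u. u) \<in> borel_measurable (length_measure L)" by (rule measurable_length_measure_ident[OF net])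
  have [measurable]: "(\<lambda>u. lam u (pts (past L u) y)) \<in> borel_measurable (length_measure L)"
    by measurable
  have [measurable]: "(indicator D :: _ \<Rightarrow> ennreal) \<in> borel_measurable (length_measure L)" if "D \<in> sets borel" for D
    by (rule measurable_compose[OF measurable_length_measure_ident[OF net] borel_measurable_indicator[OF that]])
  have 2: "lam_int (B \<union> C) y =
    lam_int B y +
    lam_int C y"
    using disj by (subst nn_integral_add[symmetric]) (auto intro!: nn_integral_cong simp: indicator_def)
  show ?thesis unfolding dens_def 1 2 exp_neg_add using nn by (simp add: ennreal_mult ac_simps)
qed

lemma dens_cong:
  assumes "pts B y = pts B y'"
    and "\<And>u. u \<in> B \<Longrightarrow> pts (past L u) y = pts (past L u) y'"
  shows "dens B y = dens B y'"
proof -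
  have "lam_int B y =
    lam_int B y'"
    using assms(2) by (intro nn_integral_cong) (auto simp: indicator_def)
  moreover have "gam_prod B y =
    gam_prod B y'"
    unfolding assms(1) using assms(2) by (intro prod.cong) (auto simp: located_def)
  ultimately show ?thesis by (simp add: dens_def)
qed

text \<open>The identification of the temporal density on the time axis with the spatial density on
  the segment: seen from time \<open>t\<close>, the past consists of the upstream part of
  \<open>h\<close> and the embedded temporal history, and the exponent changes variables by the
  parametrisation.\<close>

lemma dens_segment:
  assumes k: "k < length L" and i: "i = omega k"
    and h: "h \<in> space PS" "loc ` h \<subseteq> earlier L omega k"
    and td: "temporal_density (TS i) tloc (seg_length L i)
        (\<lambda>t g. lam (seg_param L i t) (pts (upstream L i) h \<union> emb i ` g)) Q
        (\<lambda>r g. gam (emb i r) (pts (upstream L i) h \<union> emb i ` g))"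
    and y: "y \<in> space (patterns tloc (TS i))"
  shows "temporal_density.dens_until tloc (seg_length L i)
        (\<lambda>t g. lam (seg_param L i t) (pts (upstream L i) h \<union> emb i ` g))
        (\<lambda>r g. gam (emb i r) (pts (upstream L i) h \<union> emb i ` g)) y (seg_length L i) =
      dens (seg L i) (pat_union loc h (emb i ` y))"
proof -
  let ?z = "pts (upstream L i) h" and ?l = "seg_length L i"
  interpret T: temporal_density "TS i" tloc ?l "\<lambda>t g. lam (seg_param L i t) (?z \<union> emb i ` g)" Q
    "\<lambda>r g. gam (emb i r) (?z \<union> emb i ` g)" by (rule td)
  have iN: "i < length L" unfolding i by (rule omega_less[OF net omega k])
  have y_TS: "y \<subseteq> space (TS i)" and y_inj: "inj_on tloc y" using y by (auto simp: space_patterns)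
  have y_S: "emb i ` y \<in> space PS"
    using y measurable_space[OF emb[OF iN]] loc_emb[OF iN] seg_param_eq_iff[OF net iN]
    by (auto simp: space_patterns inj_on_def subset_iff)
  have loc_y: "loc ` emb i ` y \<subseteq> seg L i"
    using y_TS loc_emb[OF iN] tloc_range[OF iN] seg_param_in_seg[OF net iN] by auto
  have disj: "earlier L omega k \<inter> seg L i = {}" unfolding i by (rule earlier_disjoint[OF net omega k])
  have up: "upstream L i \<subseteq> earlier L omega k" unfolding i by (rule upstream_earlier[OF net omega k])
  let ?Y = "pat_union loc h (emb i ` y)"
  have "loc ` h \<inter> loc ` emb i ` y = {}" using h(2) loc_y disj by blast
  then have Y: "?Y = h \<union> emb i ` y" by (simp add: pat_union_def)
  have Y_PS[measurable]: "?Y \<in> space PS" using h(1) y_S by (rule pat_union_in_patterns)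
  have at_seg: "pts (seg L i) ?Y = emb i ` y"
    unfolding Y located_def using h(2) loc_y disj by blast
  \<comment> \<open>Points of \<open>h\<close> lie off the new segment, so only their upstream part
    survives; new points lie off the upstream segments, so only those before \<open>t\<close>
    survive.\<close>
  have at_past: "pts (past L (seg_param L i t)) ?Y = ?z \<union> emb i ` hist tloc y t" if t: "0 < t" "t < ?l" for t
  proof -
    have sub: "subseg L i 0 t \<subseteq> seg L i" using mem_subseg_iff[OF net iN t] by auto
    have mem: "loc (emb i r) \<in> subseg L i 0 t \<longleftrightarrow> tloc r < t" if "r \<in> y" for r
      using that y_TS loc_emb[OF iN, of r] tloc_range[OF iN, of r] seg_param_eq_iff[OF net iN]
      by (auto simp: subseg_def)
    have "pts (past L (seg_param L i t)) ?Y =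
      pts (subseg L i 0 t \<union> upstream L i) h \<union> pts (subseg L i 0 t \<union> upstream L i) (emb i ` y)"
      unfolding past_seg_param[OF net iN t] Y by (auto simp: located_def)
    also have "pts (subseg L i 0 t \<union> upstream L i) h = ?z"
      using h(2) sub disj by (auto simp: located_def)
    also have "pts (subseg L i 0 t \<union> upstream L i) (emb i ` y) = pts (subseg L i 0 t) (emb i ` y)"
      using loc_y up disj by (auto simp: located_def)
    also have "\<dots> = emb i ` hist tloc y t"
      using mem by (auto simp: located_def hist_def)
    finally show ?thesis .
  qed
  have emb_inj: "inj_on (emb i) y"
  proof (rule inj_onI)
    fix r r' assume r: "r \<in> y" "r' \<in> y" "emb i r = emb i r'"
    then have "r \<in> space (TS i)" "r' \<in> space (TS i)" using y_TS by auto
    then have "seg_param L i (tloc r) = seg_param L i (tloc r')"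
      using loc_emb[OF iN] r(3) by metis
    then show "r = r'" using y_inj r seg_param_eq_iff[OF net iN] by (auto simp: inj_on_def)
  qed
  have 1: "gam_prod (seg L i) ?Y =
     (\<Prod>r\<in>y. gam (emb i r) (?z \<union> emb i ` hist tloc y (tloc r)))"
    unfolding at_seg prod.reindex[OF emb_inj] o_def
  proof (intro prod.cong refl)
    fix r assume "r \<in> y"
    then have "r \<in> space (TS i)" using y_TS by auto
    then show "gam (emb i r) (pts (past L (loc (emb i r))) ?Y) = gam (emb i r) (?z \<union> emb i ` hist tloc y (tloc r))"
      using at_past tloc_range[OF iN] loc_emb[OF iN] by simp
  qed
  have [measurable]: "(\<lambda>u. u) \<in> borel_measurable (length_measure L)" by (rule measurable_length_measure_ident[OF net])
  have "lam_int (seg L i) ?Y =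
     (\<integral>\<^sup>+t. ennreal (lam (seg_param L i t) (pts (past L (seg_param L i t)) ?Y)) \<partial>time_measure ?l)"
    by (rule nn_integral_length_measure_seg[OF net iN]) measurable
  also have "\<dots> = cumul (\<lambda>s. T.lamE (hist tloc y s) s) 0 ?l"
    unfolding cumul_def nn_integral_time_measure
    by (rule nn_integral_cong) (auto simp: indicator_def T.lamE_def at_past)
  finally have 2: "lam_int (seg L i) ?Y =
     cumul (\<lambda>s. T.lamE (hist tloc y s) s) 0 ?l" .
  show ?thesis unfolding dens_def T.dens_until_def 1 2 ..
qed

text \<open>The statement is needed for all \<open>F\<close>, since the induction hypothesis is
  applied to \<open>Phi\<close>, the conditional mean of \<open>F\<close> over the new segment. The
  two nested pattern integrals are then merged by superposition, whose disjointness condition holds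
  because the segments are disjoint.\<close>

lemma earlier_law:
  assumes "k \<le> length L" "F \<in> borel_measurable PS"
  shows "(\<integral>\<^sup>+w. F (pts (earlier L omega k) (X w)) \<partial>P) =
    pat_total loc S {p \<in> space S. loc p \<in> earlier L omega k} (\<lambda>y. dens (earlier L omega k) y * F y)"
  using assms
proof (induction k arbitrary: F)
  case 0
  interpret P: prob_space P by (rule prob_space_P)
  show ?case by (simp add: earlier_def located_def pat_total_empty dens_def P.emeasure_space_1)
next
  case (Suc k)
  note [measurable] = Suc.prems(2) earlier_borel[OF net] seg_borel[OF net]
  interpret P: prob_space P by (rule prob_space_P)
  define i where "i = omega k"
  have k: "k < length L" using Suc.prems by simp
  have iN: "i < length L" unfolding i_def by (rule omega_less[OF net omega k])
  let ?E = "earlier L omega k" and ?T = "patterns tloc (TS i)"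
  let ?A = "{p \<in> space S. loc p \<in> ?E}" and ?B = "{p \<in> space S. loc p \<in> seg L i}"
  have disj: "?E \<inter> seg L i = {}" unfolding i_def by (rule earlier_disjoint[OF net omega k])
  have up: "upstream L i \<subseteq> ?E" unfolding i_def by (rule upstream_earlier[OF net omega k])
  have E_Suc: "earlier L omega (Suc k) = ?E \<union> seg L i" unfolding i_def by (rule earlier_Suc[OF net omega])
  obtain Q where cl: "cond_law P (\<lambda>w. pts ?E (X w)) PS (\<lambda>w. pts (seg L i) (X w)) PS
        (\<lambda>h. distr (Q (pts (upstream L i) h)) PS (\<lambda>y. emb i ` y))"
    and td: "AE w in P. temporal_density (TS i) tloc (seg_length L i)
        (\<lambda>t h. lam (seg_param L i t) (pts (upstream L i) (X w) \<union> emb i ` h))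
        (Q (pts (upstream L i) (X w)))
        (\<lambda>r h. gam (emb i r) (pts (upstream L i) (X w) \<union> emb i ` h))"
    using process[OF k i_def] by blast
  have ne: "space PS \<noteq> {}" using empty_in_patterns by blast
  obtain K' where K': "AE w in P. K' (pts ?E (X w)) =
        distr (Q (pts (upstream L i) (pts ?E (X w)))) PS (\<lambda>y. emb i ` y)"
    and K'_int: "\<And>G. G \<in> borel_measurable (PS \<Otimes>\<^sub>M PS) \<Longrightarrow>
      (\<integral>\<^sup>+w. G (pts ?E (X w), pts (seg L i) (X w)) \<partial>P) =
      (\<integral>\<^sup>+w. \<integral>\<^sup>+y. G (pts ?E (X w), y) \<partial>K' (pts ?E (X w)) \<partial>P)"
    by (rule cond_law_kernel[OF P.finite_measure_axioms cl ne]) blast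
  \<comment> \<open>An integral over patterns in \<open>S\<close>, measurable in \<open>h\<close> on
    all of \<open>PS\<close>; the integral of \<open>F\<close> against the kernel agrees with it
    almost surely only.\<close>
  define Phi where "Phi h = pat_total loc S ?B (\<lambda>x. dens (seg L i) (pat_union loc h x) * F (pat_union loc h x))" for h
  have [measurable]: "Phi \<in> borel_measurable PS" unfolding Phi_def by measurable
  have emb_pat: "(\<lambda>y. emb i ` y) \<in> measurable ?T PS"
  proof (rule measurable_image_pattern[OF emb[OF iN]])
    fix y assume "y \<in> space ?T"
    then show "inj_on (\<lambda>p. loc (emb i p)) y"
      using loc_emb[OF iN] seg_param_eq_iff[OF net iN] by (auto simp: space_patterns inj_on_def subset_iff)
  qed
  have "(\<integral>\<^sup>+w. F (pts (earlier L omega (Suc k)) (X w)) \<partial>P) =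
    (\<integral>\<^sup>+w. (\<lambda>(h, x). F (pat_union loc h x)) (pts ?E (X w), pts (seg L i) (X w)) \<partial>P)"
  proof (intro nn_integral_cong)
    fix w
    have "pts (earlier L omega (Suc k)) (X w) = pts ?E (X w) \<union> pts (seg L i) (X w)"
      unfolding E_Suc by (auto simp: located_def)
    moreover have "loc ` pts ?E (X w) \<inter> loc ` pts (seg L i) (X w) = {}"
      using disj by (auto simp: located_def)
    ultimately show "F (pts (earlier L omega (Suc k)) (X w)) =
       (\<lambda>(h, x). F (pat_union loc h x)) (pts ?E (X w), pts (seg L i) (X w))"
      by (simp add: pat_union_def)
  qed
  also have "\<dots> = (\<integral>\<^sup>+w. \<integral>\<^sup>+x. (\<lambda>(h, x). F (pat_union loc h x)) (pts ?E (X w), x) \<partial>K' (pts ?E (X w)) \<partial>P)"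
    by (rule K'_int) (unfold split_beta', measurable)
  also have "\<dots> = (\<integral>\<^sup>+w. Phi (pts ?E (X w)) \<partial>P)"
  proof (rule nn_integral_cong_AE, use K' td AE_space in eventually_elim)
    case (elim w)
    define h where "h = pts ?E (X w)"
    have Xw: "X w \<in> space PS" using X elim by (auto intro: measurable_space)
    then have h[measurable]: "h \<in> space PS" unfolding h_def by (rule located_in_patterns)
    have h_loc: "loc ` h \<subseteq> ?E" by (auto simp: h_def located_def)
    \<comment> \<open>The kernel is evaluated at the earlier points \<open>h\<close>, the temporal
      law is prescribed along \<open>X w\<close>. Both depend only on the upstream points, and
      upstream segments are among the earlier ones.\<close>
    have z: "pts (upstream L i) (X w) = pts (upstream L i) h"
      using up by (auto simp: h_def located_def)
    note td = elim(2)[unfolded z]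
    interpret T: temporal_density "TS i" tloc "seg_length L i"
      "\<lambda>t g. lam (seg_param L i t) (pts (upstream L i) h \<union> emb i ` g)" "Q (pts (upstream L i) h)"
      "\<lambda>r g. gam (emb i r) (pts (upstream L i) h \<union> emb i ` g)" by (rule td)
    note [measurable] = emb_pat
    have H: "(\<lambda>x. dens (seg L i) (pat_union loc h x) * F (pat_union loc h x)) \<in> borel_measurable PS"
      by measurable
    have "(\<integral>\<^sup>+x. F (pat_union loc h x) \<partial>K' h) = (\<integral>\<^sup>+x. F (pat_union loc h x) \<partial>distr (Q (pts (upstream L i) h)) PS (\<lambda>y. emb i ` y))"
      using elim(1) by (simp add: h_def)
    also have "\<dots> = (\<integral>\<^sup>+y. F (pat_union loc h (emb i ` y)) \<partial>Q (pts (upstream L i) h))"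
      by (rule nn_integral_distr) measurable
    also have "\<dots> = pat_total tloc (TS i) (space (TS i)) (\<lambda>y. T.dens_until y (seg_length L i) * F (pat_union loc h (emb i ` y)))"
      by (rule T.temporal_janossy) measurable
    also have "\<dots> = pat_total tloc (TS i) (space (TS i)) (\<lambda>y. dens (seg L i) (pat_union loc h (emb i ` y)) * F (pat_union loc h (emb i ` y)))"
      by (rule T.pat_total_cong) (simp add: dens_segment[OF k i_def h h_loc td])
    also have "\<dots> = Phi h"
      \<comment> \<open>The pattern is moved from the time axis onto the segment, separately for
        each number of points.\<close>
      unfolding Phi_def pat_total_def
    proof (intro suminf_cong arg_cong2[where f="(*)", OF refl] pat_integral_transport[symmetric])
      show "pat_space S loc" ..
      show "pat_space (TS i) tloc" by (rule TS[OF iN])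
      show "emb i \<in> measurable (TS i) S" by (rule emb[OF iN])
      show "?B \<in> sets S" by measurable
      show "(loc (emb i r) = loc (emb i r')) = (tloc r = tloc r')" if "r \<in> space (TS i)" "r' \<in> space (TS i)" for r r'
        using that loc_emb[OF iN] seg_param_eq_iff[OF net iN] by simp
      show "(\<integral>\<^sup>+x. indicator ?B x * F x \<partial>S) = (\<integral>\<^sup>+r. F (emb i r) \<partial>TS i)" if "F \<in> borel_measurable S" for F
        by (rule nn_integral_emb[OF iN that])
    qed (rule H)
    finally show ?case by (simp add: h_def)
  qed
  also have "\<dots> = pat_total loc S ?A (\<lambda>h. dens ?E h * Phi h)"
    using k by (intro Suc.IH) auto
  also have "\<dots> = pat_total loc S ?A (\<lambda>h. pat_total loc S ?B (\<lambda>x. dens (?E \<union> seg L i) (pat_union loc h x) * F (pat_union loc h x)))"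
  proof (rule pat_total_cong)
    fix h assume h[measurable]: "h \<in> space PS" and hA: "h \<subseteq> ?A"
    have "dens ?E h * Phi h = pat_total loc S ?B (\<lambda>x. dens ?E h * (dens (seg L i) (pat_union loc h x) * F (pat_union loc h x)))"
      unfolding Phi_def by (rule pat_total_cmult[symmetric]) measurable
    also have "\<dots> = pat_total loc S ?B (\<lambda>x. dens (?E \<union> seg L i) (pat_union loc h x) * F (pat_union loc h x))"
    proof (rule pat_total_cong)
      fix x assume x: "x \<in> space PS" and xB: "x \<subseteq> ?B"
      have "loc ` h \<subseteq> ?E" "loc ` x \<subseteq> seg L i" using hA xB by auto
      then have "loc ` h \<inter> loc ` x = {}" using disj by blast
      then have pu: "pat_union loc h x = h \<union> x" by (simp add: pat_union_def)
      \<comment> \<open>Points on the new segment enter neither the points in \<open>?E\<close> nor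
        the pasts of locations in \<open>?E\<close>.\<close>
      have "dens ?E h = dens ?E (pat_union loc h x)"
      proof (rule dens_cong)
        show "pts ?E h = pts ?E (pat_union loc h x)"
          unfolding pu located_def using xB disj by blast
        fix u assume "u \<in> ?E"
        then have "past L u \<subseteq> ?E" using k by (intro past_earlier[OF net omega]) auto
        then show "pts (past L u) h = pts (past L u) (pat_union loc h x)"
          unfolding pu located_def using xB disj by blast
      qed
      then show "dens ?E h * (dens (seg L i) (pat_union loc h x) * F (pat_union loc h x)) =
         dens (?E \<union> seg L i) (pat_union loc h x) * F (pat_union loc h x)"
        using dens_Un[OF _ _ disj pat_union_in_patterns[OF h x]] earlier_borel[OF net] seg_borel[OF net]
        by (simp add: mult.assoc)
    qed
    finally show "dens ?E h * Phi h = pat_total loc S ?B (\<lambda>x. dens (?E \<union> seg L i) (pat_union loc h x) * F (pat_union loc h x))" .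
  qed
  also have "\<dots> = pat_total loc S (?A \<union> ?B) (\<lambda>y. dens (?E \<union> seg L i) y * F y)"
    by (rule pat_total_superposition[symmetric]) (measurable, use disj in auto)
  also have "?A \<union> ?B = {p \<in> space S. loc p \<in> earlier L omega (Suc k)}"
    unfolding E_Suc by auto
  finally show ?case unfolding E_Suc .
qed

theorem network_law:
  assumes F: "F \<in> borel_measurable PS"
  shows "(\<integral>\<^sup>+w. F (X w) \<partial>P) = pat_total loc S (space S) (\<lambda>y. dens (net_union L) y * F y)"
proof -
  have "pts (net_union L) (X w) = X w" if "w \<in> space P" for w
    using measurable_space[OF X that] loc_net_union by (auto simp: located_def space_patterns)
  then have "(\<integral>\<^sup>+w. F (X w) \<partial>P) = (\<integral>\<^sup>+w. F (pts (net_union L) (X w)) \<partial>P)"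
    by (intro nn_integral_cong) simp
  also have "\<dots> = pat_total loc S {p \<in> space S. loc p \<in> net_union L} (\<lambda>y. dens (net_union L) y * F y)"
    using earlier_law[OF order_refl F] unfolding earlier_all[OF net omega] .
  also have "{p \<in> space S. loc p \<in> net_union L} = space S" using loc_net_union by auto
  finally show ?thesis .
qed

text \<open>\<open>J\<close> is prescribed on patterns only, so its measurability is transferred
  from \<open>dens\<close>, with which it agrees there.\<close>

lemma janossy:
  assumes diffuse: "\<And>c. AE p in S. loc p \<noteq> c"
    and J: "\<And>y. y \<in> space PS \<Longrightarrow> J y = (\<Prod>p\<in>y. gam p (pts (past L (loc p)) y)) *
      exp_neg (\<integral>\<^sup>+u. ennreal (lam u (pts (past L u) y)) \<partial>length_measure L)"
  shows "janossy_density loc S P X J"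
proof -
  have nonneg: "0 \<le> (\<Prod>p\<in>y. gam p (pts (past L (loc p)) y))" if "y \<in> space PS" for y
    using that by (intro prod_nonneg gam_nonneg located_in_patterns ballI) (auto simp: space_patterns)
  have J0: "0 \<le> J y" if "y \<in> space PS" for y using nonneg[OF that] J[OF that] by simp
  have J_dens: "ennreal (J y) = dens (net_union L) y" if y: "y \<in> space PS" for y
  proof -
    have "pts (net_union L) y = y"
      using y loc_net_union by (auto simp: located_def space_patterns)
    moreover have "lam_int (net_union L) y =
      (\<integral>\<^sup>+u. ennreal (lam u (pts (past L u) y)) \<partial>length_measure L)"
      by (intro nn_integral_cong) (simp add: space_length_measure)
    ultimately show ?thesis using J[OF y] nonneg[OF y] by (simp add: dens_def ennreal_mult)
  qed
  have "(\<lambda>y. enn2real (dens (net_union L) y)) \<in> borel_measurable PS"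
    using net_union_borel[OF net] by measurable
  also have "?this \<longleftrightarrow> J \<in> borel_measurable PS"
    by (intro measurable_cong) (simp add: J_dens[symmetric] J0)
  finally have J_meas[measurable]: "J \<in> borel_measurable PS" .
  show ?thesis
    unfolding janossy_density_def
  proof (intro conjI ballI)
    show "J \<in> borel_measurable PS" by fact
    show "0 \<le> J y" if "y \<in> space PS" for y using that by (rule J0)
    fix F assume F[measurable]: "F \<in> sets PS"
    have "emeasure P {w \<in> space P. X w \<in> F} = (\<integral>\<^sup>+w. indicator F (X w) \<partial>P)"
    proof -
      have "(\<integral>\<^sup>+w. indicator F (X w) \<partial>P) = (\<integral>\<^sup>+w. indicator {w \<in> space P. X w \<in> F} w \<partial>P)"
        by (intro nn_integral_cong) (simp add: indicator_def)
      also have "\<dots> = emeasure P {w \<in> space P. X w \<in> F}" by (rule nn_integral_indicator) measurable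
      finally show ?thesis by simp
    qed
    also have "\<dots> = pat_total loc S (space S) (\<lambda>y. dens (net_union L) y * indicator F y)"
      by (rule network_law) measurable
    also have "\<dots> = pat_total loc S (space S) (\<lambda>y. indicator F y * ennreal (J y))"
      by (rule pat_total_cong) (simp add: J_dens mult.commute)
    also have "\<dots> = (\<Sum>n. ennreal (1 / fact n) *
      (\<integral>\<^sup>+xs. indicator F (xs ` {..<n}) * ennreal (J (xs ` {..<n})) \<partial>PiM {..<n} (\<lambda>_. S)))"
      by (rule janossy_sum_eq_pat_total[OF diffuse, symmetric]) measurable
    finally show "emeasure P {w \<in> space P. X w \<in> F} = (\<Sum>n. ennreal (1 / fact n) *
      (\<integral>\<^sup>+xs. indicator F (xs ` {..<n}) * ennreal (J (xs ` {..<n})) \<partial>PiM {..<n} (\<lambda>_. S)))" .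
  qed
qed

end

text \<open>Embedded points never share a location with \<open>z\<close>. The plain union therefore
  coincides with \<open>pat_union\<close>, whose measurability is known.\<close>

lemma (in pat_space) measurable_history:
  assumes e: "(\<lambda>y. e ` y) \<in> measurable (patterns tloc T) PS" and z: "z \<in> space PS"
    and disj: "\<And>r. r \<in> space T \<Longrightarrow> loc (e r) \<notin> loc ` z"
  shows "(\<lambda>h. z \<union> e ` h) \<in> measurable (patterns tloc T) PS"
proof -
  note [measurable] = e
  have "(\<lambda>h. pat_union loc z (e ` h)) \<in> measurable (patterns tloc T) PS" using z by measurable
  also have "?this \<longleftrightarrow> ?thesis"
  proof (intro measurable_cong)
    fix h assume "h \<in> space (patterns tloc T)"
    then have "h \<subseteq> space T" by (simp add: space_patterns)
    have "loc ` z \<inter> loc ` e ` h = {}"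
    proof (rule equals0I)
      fix u assume "u \<in> loc ` z \<inter> loc ` e ` h"
      then obtain r where r: "r \<in> h" "u = loc (e r)" "u \<in> loc ` z" by (elim IntE imageE) auto
      then show False using disj[of r] \<open>h \<subseteq> space T\<close> by auto
    qed
    then show "pat_union loc z (e ` h) = z \<union> e ` h" by (simp add: pat_union_def)
  qed
  finally show ?thesis .
qed

section \<open>The two cases of the likelihood formula\<close>

lemma unmarked_segmentwise:
  fixes L :: "'a::euclidean_space network" and P :: "'w measure"
  assumes net: "linear_network L" and omega: "omega \<in> admissible_orders L"
    and int: "intensity_fun (length_measure L) (net_patterns L) lam"
    and proc: "network_process L omega lam P X"
  shows "segmentwise_process (length_measure L) (\<lambda>u. u) L omega lam lam P X
    (\<lambda>i. time_measure (seg_length L i)) (\<lambda>t. t) (seg_param L)"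
proof -
  interpret finite_measure "length_measure L" by (rule finite_length_measure[OF net])
  interpret pat_space "length_measure L" "\<lambda>u. u"
    by unfold_locales (rule measurable_length_measure_ident[OF net])
  have lam: "(\<lambda>(u, y). lam u y) \<in> borel_measurable (length_measure L \<Otimes>\<^sub>M PS)"
    and lam_nonneg: "\<And>u y. u \<in> space (length_measure L) \<Longrightarrow> y \<in> space PS \<Longrightarrow> 0 \<le> lam u y"
    using int by (auto simp: intensity_fun_def)
  have X: "X \<in> measurable P PS" using proc by (simp add: network_process_def)
  have emb: "seg_param L i \<in> measurable (time_measure (seg_length L i)) (length_measure L)" if "i < length L" for i
    using seg_param_measurable_time[OF net that] by (simp add: measurable_cong_sets[OF sets_time_measure refl])
  have loc: "located (\<lambda>u. u) B y = y \<inter> B" for B and y :: "'a set" by (auto simp: located_def)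
  show ?thesis
  proof (intro segmentwise_process.intro segmentwise_process_axioms.intro)
    fix k i assume k: "k < length L" and i: "i = omega k"
    let ?l = "seg_length L i" and ?z = "\<lambda>w. X w \<inter> upstream L i"
    have iN: "i < length L" unfolding i by (rule omega_less[OF net omega k])
    have TP: "patterns (\<lambda>t. t) (time_measure ?l) = patterns (\<lambda>t. t) (time_space ?l)"
      by (rule patterns_cong) (rule sets_time_measure)
    obtain Q where cl: "cond_law P (\<lambda>w. X w \<inter> earlier L omega k) PS (\<lambda>w. X w \<inter> seg L i) PS
        (\<lambda>h. distr (Q (h \<inter> upstream L i)) PS (\<lambda>y. seg_param L i ` y))"
      and hc: "AE w in P. has_cond_intensity (\<lambda>t. t) (time_space ?l) ?l
           (\<lambda>t h. lam (seg_param L i t) (?z w \<union> seg_param L i ` h)) (Q (?z w))"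
      using proc k unfolding network_process_def Let_def i by blast
    have "AE w in P. temporal_density (time_measure ?l) (\<lambda>t. t) ?l
        (\<lambda>t h. lam (seg_param L i t) (?z w \<union> seg_param L i ` h)) (Q (?z w))
        (\<lambda>t h. lam (seg_param L i t) (?z w \<union> seg_param L i ` h))"
      using hc AE_space
    proof eventually_elim
      case (elim w)
      have z: "?z w \<in> space PS"
        using measurable_space[OF X elim(2)] by (rule subset_in_patterns) auto
      have img: "(\<lambda>y. seg_param L i ` y) \<in> measurable (patterns (\<lambda>t. t) (time_space ?l)) PS"
        unfolding TP[symmetric] using emb[OF iN]
        by (rule measurable_image_pattern) (auto simp: inj_on_def seg_param_eq_iff[OF net iN])
      have h: "(\<lambda>h. ?z w \<union> seg_param L i ` h) \<in> measurable (patterns (\<lambda>t. t) (time_space ?l)) PS"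
      proof (rule measurable_history[OF img z])
        fix t assume "t \<in> space (time_space ?l)"
        then have "seg_param L i t \<in> seg L i" by (intro seg_param_in_seg[OF net iN]) auto
        then show "seg_param L i t \<notin> (\<lambda>u. u) ` ?z w"
          using upstream_earlier[OF net omega k] earlier_disjoint[OF net omega k] unfolding i by auto
      qed
      show ?case
      proof (rule temporal_density_unmarked[OF seg_length_pos[OF net iN] elim(1)])
        show "(\<lambda>(s, h). lam (seg_param L i s) (?z w \<union> seg_param L i ` h)) \<in>
            borel_measurable (time_space ?l \<Otimes>\<^sub>M patterns (\<lambda>t. t) (time_space ?l))"
          using measurable_compose[OF measurable_Pair[OF
              measurable_compose[OF measurable_fst seg_param_measurable_time[OF net iN]]
              measurable_compose[OF measurable_snd h]] lam]
          by (simp add: split_beta')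
        fix s h assume "0 < s" "s < ?l" "h \<in> space (patterns (\<lambda>t. t) (time_space ?l))"
        then show "0 \<le> lam (seg_param L i s) (?z w \<union> seg_param L i ` h)"
          using measurable_space[OF h] measurable_space[OF seg_param_measurable_time[OF net iN], of s]
          by (intro lam_nonneg) auto
      qed
    qed
    with cl show "\<exists>Q. cond_law P
        (\<lambda>w. located (\<lambda>u. u) (earlier L omega k) (X w)) PS (\<lambda>w. located (\<lambda>u. u) (seg L i) (X w)) PS
        (\<lambda>h. distr (Q (located (\<lambda>u. u) (upstream L i) h)) PS (\<lambda>y. seg_param L i ` y)) \<and>
      (AE w in P. temporal_density (time_measure ?l) (\<lambda>t. t) ?l
        (\<lambda>t h. lam (seg_param L i t) (located (\<lambda>u. u) (upstream L i) (X w) \<union> seg_param L i ` h))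
        (Q (located (\<lambda>u. u) (upstream L i) (X w)))
        (\<lambda>r h. lam (seg_param L i r) (located (\<lambda>u. u) (upstream L i) (X w) \<union> seg_param L i ` h)))"
      unfolding loc by blast
  next
    fix i and F :: "_ \<Rightarrow> ennreal" assume i: "i < length L" and F: "F \<in> borel_measurable (length_measure L)"
    have "(\<integral>\<^sup>+p. indicator {p \<in> space (length_measure L). p \<in> seg L i} p * F p \<partial>length_measure L) =
      (\<integral>\<^sup>+p. indicator (seg L i) p * F p \<partial>length_measure L)"
      by (intro nn_integral_cong) (simp add: indicator_def)
    also have "\<dots> = (\<integral>\<^sup>+r. F (seg_param L i r) \<partial>time_measure (seg_length L i))"
      by (rule nn_integral_length_measure_seg[OF net i F])
    finally show "(\<integral>\<^sup>+p. indicator {p \<in> space (length_measure L). p \<in> seg L i} p * F p \<partial>length_measure L) =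
      (\<integral>\<^sup>+r. F (seg_param L i r) \<partial>time_measure (seg_length L i))" .
  next
    fix i assume "i < length L"
    show "pat_space (time_measure (seg_length L i)) (\<lambda>t. t)"
      by (intro pat_space.intro pat_space_axioms.intro sigma_finite_time_measure measurable_time_space_ident)
  next
    show "pat_space (length_measure L) (\<lambda>u. u)" ..
  next
    show "prob_space P" using proc by (simp add: network_process_def)
  qed (use net omega lam lam_nonneg X emb in \<open>auto simp: space_length_measure\<close>)
qed

lemma marked_segmentwise:
  fixes L :: "'a::euclidean_space network" and P :: "'w measure" and nu :: "'m measure"
  assumes net: "linear_network L" and omega: "omega \<in> admissible_orders L"
    and nu: "sigma_finite_measure nu"
    and int: "intensity_fun (length_measure L) (marked_net_patterns L nu) lam"
    and md: "mark_density_fun (length_measure L) (marked_net_patterns L nu) nu f"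
    and proc: "marked_network_process L omega nu lam f P Y"
  shows "segmentwise_process (length_measure L \<Otimes>\<^sub>M nu) fst L omega lam (\<lambda>p y. lam (fst p) y * f (snd p) (fst p) y) P Y
    (\<lambda>i. time_measure (seg_length L i) \<Otimes>\<^sub>M nu) fst (\<lambda>i. map_prod (seg_param L i) (\<lambda>m. m))"
proof -
  interpret finite_measure "length_measure L" by (rule finite_length_measure[OF net])
  interpret nu: sigma_finite_measure nu by fact
  interpret pair_sigma_finite "length_measure L" nu ..
  interpret pat_space "length_measure L \<Otimes>\<^sub>M nu" fst
    by unfold_locales (rule measurable_compose[OF measurable_fst measurable_length_measure_ident[OF net]])
  have lam: "(\<lambda>(u, y). lam u y) \<in> borel_measurable (length_measure L \<Otimes>\<^sub>M PS)"
    and lam_nonneg: "\<And>u y. u \<in> space (length_measure L) \<Longrightarrow> y \<in> space PS \<Longrightarrow> 0 \<le> lam u y"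
    using int by (auto simp: intensity_fun_def)
  have f: "(\<lambda>(m, u, y). f m u y) \<in> borel_measurable (nu \<Otimes>\<^sub>M (length_measure L \<Otimes>\<^sub>M PS))"
    and f_nonneg: "\<And>m u y. m \<in> space nu \<Longrightarrow> u \<in> space (length_measure L) \<Longrightarrow> y \<in> space PS \<Longrightarrow> 0 \<le> f m u y"
    using md by (auto simp: mark_density_fun_def)
  have X: "Y \<in> measurable P PS" using proc by (simp add: marked_network_process_def)
  let ?emb = "\<lambda>i. map_prod (seg_param L i) (\<lambda>m::'m. m)"
  have emb: "?emb i \<in> measurable (time_measure (seg_length L i) \<Otimes>\<^sub>M nu) (length_measure L \<Otimes>\<^sub>M nu)" if "i < length L" for i
  proof -
    have [measurable]: "seg_param L i \<in> measurable (time_measure (seg_length L i)) (length_measure L)"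
      using seg_param_measurable_time[OF net that] by (simp add: measurable_cong_sets[OF sets_time_measure refl])
    show ?thesis unfolding map_prod_def by measurable
  qed
  have loc: "located fst B y = y \<inter> fst -` B" for B and y :: "('a \<times> 'm) set" by (auto simp: located_def)
  show ?thesis
  proof (intro segmentwise_process.intro segmentwise_process_axioms.intro)
    fix k i assume k: "k < length L" and i: "i = omega k"
    let ?l = "seg_length L i" and ?z = "\<lambda>w. Y w \<inter> fst -` upstream L i"
    have iN: "i < length L" unfolding i by (rule omega_less[OF net omega k])
    let ?TP = "patterns fst (time_space ?l \<Otimes>\<^sub>M nu)"
    have TP: "patterns fst (time_measure ?l \<Otimes>\<^sub>M nu) = ?TP"
      by (rule patterns_cong) (rule sets_pair_measure_cong[OF sets_time_measure refl])
    obtain Q where cl: "cond_law P (\<lambda>w. Y w \<inter> fst -` earlier L omega k) PS (\<lambda>w. Y w \<inter> fst -` seg L i) PS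
        (\<lambda>h. distr (Q (h \<inter> fst -` upstream L i)) PS (\<lambda>y. ?emb i ` y))"
      and hc: "AE w in P. has_cond_intensity fst (time_space ?l \<Otimes>\<^sub>M nu) ?l
           (\<lambda>t h. lam (seg_param L i t) (?z w \<union> ?emb i ` h)) (Q (?z w)) \<and>
         has_mark_density ?l nu (\<lambda>m t h. f m (seg_param L i t) (?z w \<union> ?emb i ` h)) (Q (?z w))"
      using proc k unfolding marked_network_process_def Let_def i by blast
    have "AE w in P. temporal_density (time_measure ?l \<Otimes>\<^sub>M nu) fst ?l
        (\<lambda>t h. lam (seg_param L i t) (?z w \<union> ?emb i ` h)) (Q (?z w))
        (\<lambda>p h. lam (seg_param L i (fst p)) (?z w \<union> ?emb i ` h) * f (snd p) (seg_param L i (fst p)) (?z w \<union> ?emb i ` h))"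
      using hc AE_space
    proof eventually_elim
      case (elim w)
      have z: "?z w \<in> space PS"
        using measurable_space[OF X elim(2)] by (rule subset_in_patterns) auto
      have img: "(\<lambda>y. ?emb i ` y) \<in> measurable ?TP PS"
        unfolding TP[symmetric] using emb[OF iN]
        by (rule measurable_image_pattern)
           (auto simp: inj_on_def space_patterns seg_param_eq_iff[OF net iN])
      have h: "(\<lambda>h. ?z w \<union> ?emb i ` h) \<in> measurable ?TP PS"
      proof (rule measurable_history[OF img z])
        fix r assume "r \<in> space (time_space ?l \<Otimes>\<^sub>M nu)"
        then have "fst (?emb i r) \<in> seg L i"
          by (auto simp: space_pair_measure intro!: seg_param_in_seg[OF net iN])
        then show "fst (?emb i r) \<notin> fst ` ?z w"
          using upstream_earlier[OF net omega k] earlier_disjoint[OF net omega k] unfolding i by auto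
      qed
      note seg_param_measurable_time[OF net iN, measurable]
      have sp: "seg_param L i s \<in> space (length_measure L)" if "0 < s" "s < ?l" for s
        using measurable_space[OF seg_param_measurable_time[OF net iN], of s] that by auto
      show ?case
      proof (rule temporal_density_marked[OF seg_length_pos[OF net iN] nu])
        show "has_cond_intensity fst (time_space ?l \<Otimes>\<^sub>M nu) ?l
           (\<lambda>t h. lam (seg_param L i t) (?z w \<union> ?emb i ` h)) (Q (?z w))"
          "has_mark_density ?l nu (\<lambda>m t h. f m (seg_param L i t) (?z w \<union> ?emb i ` h)) (Q (?z w))"
          using elim(1) by auto
        show "(\<lambda>(s, h). lam (seg_param L i s) (?z w \<union> ?emb i ` h)) \<in> borel_measurable (time_space ?l \<Otimes>\<^sub>M ?TP)"
          using measurable_compose[OF measurable_Pair[OF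
              measurable_compose[OF measurable_fst seg_param_measurable_time[OF net iN]]
              measurable_compose[OF measurable_snd h]] lam]
          by (simp add: split_beta')
        show "(\<lambda>(m, s, h). f m (seg_param L i s) (?z w \<union> ?emb i ` h)) \<in> borel_measurable (nu \<Otimes>\<^sub>M (time_space ?l \<Otimes>\<^sub>M ?TP))"
          using measurable_compose[OF measurable_Pair[OF measurable_fst measurable_Pair[OF
              measurable_compose[OF measurable_compose[OF measurable_snd measurable_fst] seg_param_measurable_time[OF net iN]]
              measurable_compose[OF measurable_compose[OF measurable_snd measurable_snd] h]]] f]
          by (simp add: split_beta')
        show "0 \<le> lam (seg_param L i s) (?z w \<union> ?emb i ` h)"
          if "0 < s" "s < ?l" "h \<in> space ?TP" for s h
          using measurable_space[OF h] sp that by (intro lam_nonneg) auto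
        show "0 \<le> f m (seg_param L i s) (?z w \<union> ?emb i ` h)"
          if "m \<in> space nu" "0 < s" "s < ?l" "h \<in> space ?TP" for m s h
          using measurable_space[OF h] sp that by (intro f_nonneg) auto
      qed
    qed
    with cl show "\<exists>Q. cond_law P
        (\<lambda>w. located fst (earlier L omega k) (Y w)) PS (\<lambda>w. located fst (seg L i) (Y w)) PS
        (\<lambda>h. distr (Q (located fst (upstream L i) h)) PS (\<lambda>y. ?emb i ` y)) \<and>
      (AE w in P. temporal_density (time_measure ?l \<Otimes>\<^sub>M nu) fst ?l
        (\<lambda>t h. lam (seg_param L i t) (located fst (upstream L i) (Y w) \<union> ?emb i ` h))
        (Q (located fst (upstream L i) (Y w)))
        (\<lambda>r h. lam (fst (?emb i r)) (located fst (upstream L i) (Y w) \<union> ?emb i ` h) *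
           f (snd (?emb i r)) (fst (?emb i r)) (located fst (upstream L i) (Y w) \<union> ?emb i ` h)))"
      unfolding loc fst_map_prod snd_map_prod by blast
  next
    fix i and F :: "_ \<Rightarrow> ennreal" assume i: "i < length L" and F[measurable]: "F \<in> borel_measurable (length_measure L \<Otimes>\<^sub>M nu)"
    let ?T = "time_measure (seg_length L i)"
    have [measurable]: "{u \<in> space (length_measure L). u \<in> seg L i} \<in> sets (length_measure L)"
      using i seg_borel[OF net] by (intro sets_length_measure_subset[OF net]) (auto simp: net_union_def space_length_measure intro!: sets.Int)
    let ?S = "{p \<in> space (length_measure L \<Otimes>\<^sub>M nu). fst p \<in> seg L i}"
    have "?S = {u \<in> space (length_measure L). u \<in> seg L i} \<times> space nu" by (auto simp: space_pair_measure)
    then have [measurable]: "?S \<in> sets (length_measure L \<Otimes>\<^sub>M nu)" by simp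
    have "(\<integral>\<^sup>+p. indicator ?S p * F p \<partial>(length_measure L \<Otimes>\<^sub>M nu)) =
      (\<integral>\<^sup>+u. \<integral>\<^sup>+m. indicator ?S (u, m) * F (u, m) \<partial>nu \<partial>length_measure L)"
      by (rule nu.nn_integral_fst[symmetric]) measurable
    also have "\<dots> = (\<integral>\<^sup>+u. indicator (seg L i) u * (\<integral>\<^sup>+m. F (u, m) \<partial>nu) \<partial>length_measure L)"
    proof (rule nn_integral_cong)
      fix u assume u: "u \<in> space (length_measure L)"
      have "(\<integral>\<^sup>+m. indicator ?S (u, m) * F (u, m) \<partial>nu) = (\<integral>\<^sup>+m. indicator (seg L i) u * F (u, m) \<partial>nu)"
        using u by (intro nn_integral_cong) (auto simp: indicator_def space_pair_measure)
      also have "\<dots> = indicator (seg L i) u * (\<integral>\<^sup>+m. F (u, m) \<partial>nu)"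
        using u by (intro nn_integral_cmult) measurable
      finally show "(\<integral>\<^sup>+m. indicator ?S (u, m) * F (u, m) \<partial>nu) = indicator (seg L i) u * (\<integral>\<^sup>+m. F (u, m) \<partial>nu)" .
    qed
    also have "\<dots> = (\<integral>\<^sup>+t. \<integral>\<^sup>+m. F (seg_param L i t, m) \<partial>nu \<partial>?T)"
      by (rule nn_integral_length_measure_seg[OF net i]) measurable
    also have "\<dots> = (\<integral>\<^sup>+r. F (?emb i r) \<partial>(?T \<Otimes>\<^sub>M nu))"
      using nu.nn_integral_fst[OF measurable_compose[OF emb[OF i] F]] by simp
    finally show "(\<integral>\<^sup>+p. indicator ?S p * F p \<partial>(length_measure L \<Otimes>\<^sub>M nu)) = (\<integral>\<^sup>+r. F (?emb i r) \<partial>(?T \<Otimes>\<^sub>M nu))" .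
  next
    fix i assume "i < length L"
    interpret T: sigma_finite_measure "time_measure (seg_length L i)" by (rule sigma_finite_time_measure)
    interpret TN: pair_sigma_finite "time_measure (seg_length L i)" nu ..
    show "pat_space (time_measure (seg_length L i) \<Otimes>\<^sub>M nu) fst"
      by unfold_locales (rule measurable_compose[OF measurable_fst measurable_time_space_ident(1)])
  next
    have "(\<lambda>z. lam (fst (fst z)) (snd z)) \<in> borel_measurable ((length_measure L \<Otimes>\<^sub>M nu) \<Otimes>\<^sub>M PS)"
      using measurable_compose[OF measurable_Pair[OF measurable_compose[OF measurable_fst measurable_fst] measurable_snd] lam] by simp
    moreover have "(\<lambda>z. f (snd (fst z)) (fst (fst z)) (snd z)) \<in> borel_measurable ((length_measure L \<Otimes>\<^sub>M nu) \<Otimes>\<^sub>M PS)"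
      using measurable_compose[OF measurable_Pair[OF measurable_compose[OF measurable_fst measurable_snd]
          measurable_Pair[OF measurable_compose[OF measurable_fst measurable_fst] measurable_snd]] f] by simp
    ultimately show "(\<lambda>(p, y). lam (fst p) y * f (snd p) (fst p) y) \<in> borel_measurable ((length_measure L \<Otimes>\<^sub>M nu) \<Otimes>\<^sub>M PS)"
      by (simp add: split_beta')
  next
    show "pat_space (length_measure L \<Otimes>\<^sub>M nu) fst" ..
  next
    show "prob_space P" using proc by (simp add: marked_network_process_def)
  qed (use net omega lam lam_nonneg f_nonneg X emb in \<open>auto simp: space_length_measure space_pair_measure\<close>)
qed

theorem proposition1:
  fixes L :: "'a::euclidean_space network"
    and omega :: "nat \<Rightarrow> nat"
    and Theta :: "(real ^ 'd) set"
    and lamX :: "real ^ 'd \<Rightarrow> 'a \<Rightarrow> 'a set \<Rightarrow> real"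
    and PX :: "real ^ 'd \<Rightarrow> 'w measure"
    and X :: "'w \<Rightarrow> 'a set"
    and nu :: "'m measure"
    and lamY :: "real ^ 'd \<Rightarrow> 'a \<Rightarrow> ('a \<times> 'm) set \<Rightarrow> real"
    and f :: "real ^ 'd \<Rightarrow> 'm \<Rightarrow> 'a \<Rightarrow> ('a \<times> 'm) set \<Rightarrow> real"
    and PY :: "real ^ 'd \<Rightarrow> 'v measure"
    and Y :: "'v \<Rightarrow> ('a \<times> 'm) set"
  assumes "DIM('a) \<ge> 2"
    and "daln L"
    and "omega \<in> admissible_orders L"
  shows "((\<forall>theta\<in>Theta.
              intensity_fun (length_measure L) (net_patterns L) (lamX theta) \<and>
              network_process L omega (lamX theta) (PX theta) X)
          \<longrightarrow>
          likelihood_function (\<lambda>u. u) (length_measure L) Theta PX X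
            (\<lambda>theta x.
               (\<Prod>u\<in>x. lamX theta u (x \<inter> past L u)) *
               exp_neg (\<integral>\<^sup>+u. ennreal (lamX theta u (x \<inter> past L u)) \<partial>length_measure L)))
       \<and>
         (sigma_finite_measure nu \<and>
          (\<forall>theta\<in>Theta.
              intensity_fun (length_measure L) (marked_net_patterns L nu) (lamY theta) \<and>
              mark_density_fun (length_measure L) (marked_net_patterns L nu) nu (f theta) \<and>
              marked_network_process L omega nu (lamY theta) (f theta) (PY theta) Y)
          \<longrightarrow>
          likelihood_function fst (length_measure L \<Otimes>\<^sub>M nu) Theta PY Y
            (\<lambda>theta y.
               (\<Prod>(u, m)\<in>y. lamY theta u (y \<inter> fst -` past L u) * f theta m u (y \<inter> fst -` past L u)) *
               exp_neg (\<integral>\<^sup>+u. ennreal (lamY theta u (y \<inter> fst -` past L u)) \<partial>length_measure L)))"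
proof (intro conjI impI)
  have net: "linear_network L" using \<open>daln L\<close> by (simp add: daln_def)
  note omega = \<open>omega \<in> admissible_orders L\<close>
  {
    assume X: "\<forall>theta\<in>Theta. intensity_fun (length_measure L) (net_patterns L) (lamX theta) \<and>
      network_process L omega (lamX theta) (PX theta) X"
    show "likelihood_function (\<lambda>u. u) (length_measure L) Theta PX X
      (\<lambda>theta x. (\<Prod>u\<in>x. lamX theta u (x \<inter> past L u)) *
         exp_neg (\<integral>\<^sup>+u. ennreal (lamX theta u (x \<inter> past L u)) \<partial>length_measure L))"
      unfolding likelihood_function_def
    proof
      fix theta assume "theta \<in> Theta"
      then interpret segmentwise_process "length_measure L" "\<lambda>u. u" L omega "lamX theta" "lamX theta" "PX theta" X
        "\<lambda>i. time_measure (seg_length L i)" "\<lambda>t. t" "seg_param L"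
        using X by (intro unmarked_segmentwise net omega) auto
      have loc: "located (\<lambda>u. u) B y = y \<inter> B" for B and y :: "'a set" by (auto simp: located_def)
      show "janossy_density (\<lambda>u. u) (length_measure L) (PX theta) X
         (\<lambda>x. (\<Prod>u\<in>x. lamX theta u (x \<inter> past L u)) *
           exp_neg (\<integral>\<^sup>+u. ennreal (lamX theta u (x \<inter> past L u)) \<partial>length_measure L))"
        by (rule janossy) (simp_all add: AE_length_measure_neq[OF net] loc)
    qed
  next
    assume Y: "sigma_finite_measure nu \<and> (\<forall>theta\<in>Theta.
      intensity_fun (length_measure L) (marked_net_patterns L nu) (lamY theta) \<and>
      mark_density_fun (length_measure L) (marked_net_patterns L nu) nu (f theta) \<and>
      marked_network_process L omega nu (lamY theta) (f theta) (PY theta) Y)"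
    show "likelihood_function fst (length_measure L \<Otimes>\<^sub>M nu) Theta PY Y
      (\<lambda>theta y. (\<Prod>(u, m)\<in>y. lamY theta u (y \<inter> fst -` past L u) * f theta m u (y \<inter> fst -` past L u)) *
         exp_neg (\<integral>\<^sup>+u. ennreal (lamY theta u (y \<inter> fst -` past L u)) \<partial>length_measure L))"
      unfolding likelihood_function_def
    proof
      fix theta assume "theta \<in> Theta"
      then interpret segmentwise_process "length_measure L \<Otimes>\<^sub>M nu" fst L omega "lamY theta"
        "\<lambda>p y. lamY theta (fst p) y * f theta (snd p) (fst p) y" "PY theta" Y
        "\<lambda>i. time_measure (seg_length L i) \<Otimes>\<^sub>M nu" fst "\<lambda>i. map_prod (seg_param L i) (\<lambda>m. m)"
        using Y by (intro marked_segmentwise net omega) auto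
      interpret nu: sigma_finite_measure nu using Y by simp
      interpret LM: finite_measure "length_measure L" by (rule finite_length_measure[OF net])
      interpret LN: pair_sigma_finite "length_measure L" nu ..
      have loc: "located fst B y = y \<inter> fst -` B" for B and y :: "('a \<times> 'm) set" by (auto simp: located_def)
      have diffuse: "AE p in length_measure L \<Otimes>\<^sub>M nu. fst p \<noteq> c" for c
      proof (rule LN.AE_pair_measure)
        show "{p \<in> space (length_measure L \<Otimes>\<^sub>M nu). fst p \<noteq> c} \<in> sets (length_measure L \<Otimes>\<^sub>M nu)"
          using loc_measurable by measurable
        show "AE u in length_measure L. AE m in nu. fst (u, m) \<noteq> c"
          using AE_length_measure_neq[OF net, of c] by eventually_elim simp
      qed
      show "janossy_density fst (length_measure L \<Otimes>\<^sub>M nu) (PY theta) Y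
         (\<lambda>y. (\<Prod>(u, m)\<in>y. lamY theta u (y \<inter> fst -` past L u) * f theta m u (y \<inter> fst -` past L u)) *
           exp_neg (\<integral>\<^sup>+u. ennreal (lamY theta u (y \<inter> fst -` past L u)) \<partial>length_measure L))"
        by (rule janossy[OF diffuse]) (simp add: loc split_beta')
    qed
  }
qed

end
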